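(* Let $1\le p<n$ and let $w\in A_q$ be a weight on $\mathbb{R}^n$ with $1\le q\le p$. Define the exponent $p_w^*$ by $$\frac1p-\frac{1}{p_w^*}=\frac{1}{nq}.$$ Then there is a constant $C=C_{n,p}$ depending only on $n$ and $p$ such that for every Lipschitz function $f$ and every cube $Q$ $$\left(\frac{1}{w(Q)}\int_Q|f-f_Q|^{p_w^*}\,w\,dx\right)^{1/p_w^*}\le C\,[w]_{A_q}^{\frac{1}{nq}}\,[w]_{A_p}^{\frac2p}\,\ell(Q)\left(\frac{1}{w(Q)}\int_Q|\nabla f|^p\,w\,dx\right)^{1/p}.$$
   Context: Cubes are cubes in $\mathbb{R}^n$ with sides parallel to the coordinate axes, with side length $\ell(Q)$. A weight is a locally integrable non-negative function; $w(Q)=\int_Q w\,dx$; $f_Q=\frac{1}{|Q|}\int_Q f\,dx$. For $1<q<\infty$, $$[w]_{A_q}:=\sup_Q\left(\frac{1}{|Q|}\int_Q w\right)\left(\frac{1}{|Q|}\int_Q w^{1-q'}\right)^{q-1},\quad q'=\frac{q}{q-1},\qquad [w]_{A_1}:=\sup_Q\left(\frac{1}{|Q|}\int_Q w\right)\operatorname*{ess\,sup}_Q(w^{-1}),$$ and $w\in A_q$ means $[w]_{A_q}<\infty$. *)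

theory Defs
  imports "HOL-Analysis.Analysis" "HOL-Probability.Essential_Supremum"
begin

text \<open>
  All integrals of non-negative quantities are taken in \<^typ>\<open>ennreal\<close>, where
  \<open>0 * \<infinity> = 0\<close> and \<open>x / 0 = x * \<infinity>\<close>.  The next function is the real power on
  \<open>[0, \<infinity>]\<close>, with \<open>0 ^ a = \<infinity>\<close> and \<open>\<infinity> ^ a = 0\<close> for \<open>a < 0\<close>, and \<open>x ^ 0 = 1\<close>.
\<close>

definition epowr :: "ennreal \<Rightarrow> real \<Rightarrow> ennreal"  (infixr "epowr" 80) where
  "x epowr a =
    (if a = 0 then 1
     else if x = 0 then (if a < 0 then \<infinity> else 0)
     else if x = \<infinity> then (if a < 0 then 0 else \<infinity>)
     else ennreal (enn2real x powr a))"

definition cube :: "real ^ 'n \<Rightarrow> real \<Rightarrow> (real ^ 'n) set" where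
  "cube a l = cbox a (a + (\<chi> i. l))"

definition cubes :: "(real ^ 'n) set set" where
  "cubes = {cube a l | a l. 0 < l}"

definition weight :: "(real ^ 'n \<Rightarrow> real) \<Rightarrow> bool" where
  "weight w \<longleftrightarrow> (\<forall>x. 0 \<le> w x) \<and> (\<forall>K. compact K \<longrightarrow> set_integrable lebesgue K w)"

definition wmeas :: "(real ^ 'n \<Rightarrow> real) \<Rightarrow> (real ^ 'n) set \<Rightarrow> ennreal" where
  "wmeas w Q = (\<integral>\<^sup>+x\<in>Q. ennreal (w x) \<partial>lebesgue)"

definition eavg :: "(real ^ 'n) set \<Rightarrow> (real ^ 'n \<Rightarrow> ennreal) \<Rightarrow> ennreal" where
  "eavg Q g = (\<integral>\<^sup>+x\<in>Q. g x \<partial>lebesgue) / emeasure lebesgue Q"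

definition avg :: "(real ^ 'n) set \<Rightarrow> (real ^ 'n \<Rightarrow> real) \<Rightarrow> real" where
  "avg Q f = (LINT x:Q|lebesgue. f x) / measure lebesgue Q"

text \<open>Only meaningful for \<open>q \<ge> 1\<close>; the conjugate exponent is \<open>q' = q / (q - 1)\<close>.\<close>

definition Aq_const :: "real \<Rightarrow> (real ^ 'n \<Rightarrow> real) \<Rightarrow> ennreal" where
  "Aq_const q w =
    (if q = 1 then
       (SUP Q\<in>cubes. eavg Q (\<lambda>x. ennreal (w x)) *
          esssup (restrict_space lebesgue Q) (\<lambda>x. inverse (ennreal (w x))))
     else
       (SUP Q\<in>cubes. eavg Q (\<lambda>x. ennreal (w x)) *
          (eavg Q (\<lambda>x. ennreal (w x) epowr (1 - q / (q - 1)))) epowr (q - 1)))"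

definition Aq :: "real \<Rightarrow> (real ^ 'n \<Rightarrow> real) set" where
  "Aq q = {w. weight w \<and> Aq_const q w < \<infinity>}"

text \<open>
  The gradient as the vector of partial derivatives.  For Lipschitz functions these
  exist almost everywhere; the unspecified value of \<^const>\<open>deriv\<close> at the
  remaining points does not influence integrals.
\<close>

definition gradient :: "(real ^ 'n \<Rightarrow> real) \<Rightarrow> real ^ 'n \<Rightarrow> real ^ 'n" where
  "gradient f x = (\<chi> i. deriv (\<lambda>t. f (x + t *\<^sub>R axis i 1)) 0)"

lemma gradient_eq_if_GDERIV:
  assumes "GDERIV f x :> D"
  shows "gradient f x = D"
proof -
  have "deriv (\<lambda>t. f (x + t *\<^sub>R axis i 1)) 0 = D $ i" for i
  proof -
    have f: "(f has_derivative (\<lambda>h. h \<bullet> D)) (at (x + 0 *\<^sub>R axis i 1))"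
      using assms by (simp add: gderiv_def)
    have "((\<lambda>t::real. x + t *\<^sub>R axis i 1) has_derivative (\<lambda>t. t *\<^sub>R axis i 1)) (at 0)"
      by (auto intro!: derivative_eq_intros)
    from has_derivative_compose[OF this f]
    have "((\<lambda>t. f (x + t *\<^sub>R axis i 1)) has_field_derivative D $ i) (at 0)"
      by (simp add: has_field_derivative_def inner_axis' mult_commute_abs)
    then show ?thesis
      by (rule DERIV_imp_deriv)
  qed
  then show ?thesis
    by (simp add: gradient_def vec_eq_iff)
qed

end

theory Submission
  imports Defs
begin


text \<open>
  Write \<open>g\<close> for the norm of the gradient, \<open>W\<close> for the weight of the cube \<open>Q\<close> and \<open>G\<close> for the weighted
  \<open>L\<^sup>p\<close> mean of \<open>g\<close> on \<open>Q\<close>.  Telescoping the averages of \<open>f\<close> over the dyadic cubes \<open>Q\<^sub>k\<close> that shrink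
  to \<open>x\<close> bounds \<open>\<bar>f x - avg Q f\<bar>\<close> by a multiple of the sum of \<open>l / 2 ^ k\<close> times the average of \<open>g\<close>
  over \<open>Q\<^sub>k\<close>, and the \<open>A\<^sub>p\<close> condition turns that average into a weighted \<open>L\<^sup>p\<close> mean.  The weighted mean is
  controlled in two ways: by \<open>\<lambda>\<close> off the set where the dyadic maximal function of \<open>g ^ p\<close> exceeds
  \<open>\<lambda> ^ p\<close>, and by \<open>(A * 2 ^ (k * n * q)) ^ (1 / p) * G\<close>, since the \<open>A\<^sub>q\<close> condition keeps the weight
  of \<open>Q\<^sub>k\<close> from being too small.  Because \<open>n * q / p \<ge> n / p > 1\<close>, summing the minimum of the two bounds
  gives two geometric series that balance at \<open>A ^ (1 / (n * q))\<close>, and the weak type inequality of the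
  dyadic maximal function yields the inequality in weak form, uniformly in \<open>q\<close>.

  Truncation upgrades it to the strong form: the weak inequality for \<open>f\<close> clamped between consecutive
  levels \<open>2 ^ k * t\<close> only sees the gradient between these levels, so the resulting bounds can be summed.
  Since the gradient is made of partial derivatives, the analysis of \<open>f\<close> itself only requires the almost
  everywhere existence of partial derivatives, which is derived from Vitali's covering theorem.
\<close>

text \<open>The dependence on \<open>q\<close> is confined to exponents: the growing geometric
  series has ratio \<open>2 powr (n * q / p - 1)\<close>, and as \<open>q\<close> is at least 1 its
  normalised sum is at most the one for \<open>n / p\<close>. The factor \<open>A\<close> enters
  only through the balance point, hence with the power \<open>1 / (n * q)\<close>. The A_p constant
  enters once, with the power \<open>1 / p\<close>, when an average of \<open>g\<close> becomes a
  weighted mean; the power \<open>2 / p\<close> follows because the constant is at least 1.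

  Truncation meets an obstacle: the weak inequality for a clamped function controls the distance to
  the average of that function, about which nothing is known. It is therefore used as a bound on the
  smaller of the two sets where the clamped function sits at an end of its range. The bounds for the
  levels can be added up because \<open>pw > p\<close>.

  The right-hand side lives in \<open>ennreal\<close>, and the A_p constant in it may be infinite.
  Then that side is infinite, or it is 0 when the weighted integral of the gradient vanishes. In the
  latter case the left-hand side has to be shown to vanish by means of the A_q condition.\<close>

section \<open>Almost everywhere differentiability along lines\<close>

text \<open>
  The points where some arbitrarily small difference quotients in direction \<open>e\<close> are less than \<open>r\<close>.
  The points where some of them exceed \<open>s\<close> are \<open>flat_points (\<lambda>x. - f x) e (- s)\<close>.
\<close>

definition flat_points :: "('a::real_normed_vector \<Rightarrow> real) \<Rightarrow> 'a \<Rightarrow> real \<Rightarrow> 'a set" where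
  "flat_points f e r =
     {x. \<forall>d>0. \<exists>h. h \<noteq> 0 \<and> \<bar>h\<bar> < d \<and> (f (x + h *\<^sub>R e) - f x) / h < r}"

text \<open>Only the quantifier over \<open>d\<close> has to be made countable. The one over
  \<open>h\<close> may stay an uncountable union, since each \<open>A h\<close> is open by
  continuity of \<open>f\<close>.\<close>

lemma flat_points_borel:
  fixes f :: "'a::real_normed_vector \<Rightarrow> real"
  assumes f: "continuous_on UNIV f"
  shows "flat_points f e r \<in> sets borel"
proof -
  define A where "A h = {x. (f (x + h *\<^sub>R e) - f x) / h < r}" for h
  have opA: "open (A h)" if "h \<noteq> 0" for h
    unfolding A_def using that
    by (intro open_Collect_less continuous_intros continuous_on_compose2[OF f]) auto
  have eq: "flat_points f e r = (\<Inter>m::nat. \<Union>h\<in>{h. h \<noteq> 0 \<and> \<bar>h\<bar> < inverse (real (Suc m))}. A h)" (is "_ = ?R")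
  proof
    show "flat_points f e r \<subseteq> ?R"
    proof
      fix x assume "x \<in> flat_points f e r"
      then have "\<exists>h. h \<noteq> 0 \<and> \<bar>h\<bar> < inverse (real (Suc m)) \<and> x \<in> A h" for m
        unfolding flat_points_def A_def mem_Collect_eq by (metis inverse_positive_iff_positive of_nat_0_less_iff zero_less_Suc)
      then show "x \<in> ?R" by blast
    qed
    show "?R \<subseteq> flat_points f e r"
    proof
      fix x assume x: "x \<in> ?R"
      show "x \<in> flat_points f e r"
        unfolding flat_points_def
      proof (intro CollectI allI impI)
        fix d :: real assume "d > 0"
        then obtain m where m: "inverse (real (Suc m)) < d" using reals_Archimedean by blast
        from x have "x \<in> (\<Union>h\<in>{h. h \<noteq> 0 \<and> \<bar>h\<bar> < inverse (real (Suc m))}. A h)" by blast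
        then obtain h where "h \<noteq> 0" "\<bar>h\<bar> < inverse (real (Suc m))" "x \<in> A h" by blast
        with m show "\<exists>h. h \<noteq> 0 \<and> \<bar>h\<bar> < d \<and> (f (x + h *\<^sub>R e) - f x) / h < r"
          by (intro exI[of _ h]) (auto simp: A_def)
      qed
    qed
  qed
  show ?thesis
    unfolding eq
    by (intro sets.countable_INT'') (auto intro!: borel_open open_UN opA)
qed

text \<open>Arbitrarily short intervals with an end point in \<open>S\<close> on which
  \<open>\<Phi>\<close> has slope at most \<open>r\<close> form a Vitali cover of \<open>S\<close>.
  Countably many disjoint ones exhaust \<open>S\<close> up to a null set. Their images are intervals
  of total length at most \<open>r\<close> times the measure of \<open>U\<close>, and the image of
  the null set is null by the Lipschitz bound. The measurable set \<open>T\<close> stands in for the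
  image of \<open>S\<close>.\<close>

lemma measure_image_flat_le:
  fixes \<Phi> :: "real \<Rightarrow> real"
  assumes mono: "strict_mono \<Phi>" and lip: "B-lipschitz_on UNIV \<Phi>"
    and "S \<subseteq> U" "open U" and r: "0 < r" and flat: "S \<subseteq> flat_points \<Phi> 1 r"
  obtains T where "T \<in> sets lebesgue" "\<Phi> ` S \<subseteq> T"
    "emeasure lebesgue T \<le> ennreal r * emeasure lebesgue U"
proof -
  define K where "K = {(c, e). 0 < e \<and> cball c e \<subseteq> U \<and> \<Phi> (c + e) - \<Phi> (c - e) \<le> r * (2 * e)}"
  have vit: "\<exists>i. i \<in> K \<and> x \<in> cball (fst i) (snd i) \<and> snd i < d" if "x \<in> S" "0 < d" for x d
  proof -
    from \<open>S \<subseteq> U\<close> that have "x \<in> U" by blast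
    with \<open>open U\<close> obtain \<delta> where "\<delta> > 0" and \<delta>: "ball x \<delta> \<subseteq> U"
      unfolding open_contains_ball by blast
    have "x \<in> flat_points \<Phi> 1 r" using flat that by blast
    moreover have "0 < min d \<delta>" using \<open>\<delta> > 0\<close> that by simp
    ultimately have "\<exists>h. h \<noteq> 0 \<and> \<bar>h\<bar> < min d \<delta> \<and> (\<Phi> (x + h *\<^sub>R 1) - \<Phi> x) / h < r"
      unfolding flat_points_def mem_Collect_eq by blast
    then obtain h where h: "h \<noteq> 0" "\<bar>h\<bar> < min d \<delta>" "(\<Phi> (x + h) - \<Phi> x) / h < r"
      by auto
    \<comment> \<open>The interval between \<open>x\<close> and \<open>x + h\<close>, written as a
      ball; \<open>h\<close> may be negative.\<close>
    have "(x + h/2, \<bar>h\<bar>/2) \<in> K"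
    proof -
      have "cball (x + h/2) (\<bar>h\<bar>/2) \<subseteq> ball x \<delta>"
        using h by (auto simp: dist_real_def abs_if split: if_splits)
      moreover have "\<Phi> (x + h/2 + \<bar>h\<bar>/2) - \<Phi> (x + h/2 - \<bar>h\<bar>/2) \<le> r * (2 * (\<bar>h\<bar>/2))"
      proof (cases "h > 0")
        case True
        with h have e: "x + h/2 + \<bar>h\<bar>/2 = x + h" "x + h/2 - \<bar>h\<bar>/2 = x"
          and "\<Phi> (x + h) - \<Phi> x < r * h"
          by (auto simp: pos_divide_less_eq)
        with True show ?thesis unfolding e by simp
      next
        case False
        with h have e: "x + h/2 + \<bar>h\<bar>/2 = x" "x + h/2 - \<bar>h\<bar>/2 = x + h"
          and "\<Phi> (x + h) - \<Phi> x > r * h"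
          by (auto simp: neg_divide_less_eq)
        with False show ?thesis unfolding e by simp
      qed
      ultimately show ?thesis using h \<delta> by (auto simp: K_def)
    qed
    moreover have "x \<in> cball (x + h/2) (\<bar>h\<bar>/2)" by (auto simp: dist_real_def)
    ultimately show ?thesis using h by (intro exI[of _ "(x + h/2, \<bar>h\<bar>/2)"]) auto
  qed
  obtain C where C: "countable C" "C \<subseteq> K"
    "pairwise (\<lambda>i j. disjnt (cball (fst i) (snd i)) (cball (fst j) (snd j))) C"
    and neg: "negligible (S - (\<Union>i\<in>C. cball (fst i) (snd i)))"
  proof (rule Vitali_covering_theorem_cballs[of K snd S fst])
    show "0 < snd i" if "i \<in> K" for i using that by (auto simp: K_def)
  qed (use vit in auto)
  define N where "N = S - (\<Union>i\<in>C. cball (fst i) (snd i))"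
  have lip': "\<bar>\<Phi> y - \<Phi> x\<bar> \<le> B * \<bar>y - x\<bar>" for x y
    using lipschitz_onD[OF lip, of y x] by (simp add: dist_real_def)
  have negN: "negligible (\<Phi> ` N)"
    using neg unfolding N_def
    by (rule negligible_locally_Lipschitz_image[rotated])
       (auto intro!: exI[of _ UNIV] exI[of _ B] lip')
  define I where "I i = {\<Phi> (fst i - snd i) .. \<Phi> (fst i + snd i)}" for i
  have Ke: "0 < snd i" "cball (fst i) (snd i) \<subseteq> U"
    "\<Phi> (fst i + snd i) - \<Phi> (fst i - snd i) \<le> r * (2 * snd i)" if "i \<in> C" for i
  proof -
    have "i \<in> K" using that C(2) by blast
    then show "0 < snd i" "cball (fst i) (snd i) \<subseteq> U"
      "\<Phi> (fst i + snd i) - \<Phi> (fst i - snd i) \<le> r * (2 * snd i)"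
      unfolding K_def by (cases i; simp)+
  qed
  have disI: "disjoint_family_on I C"
    unfolding disjoint_family_on_def
  proof (intro ballI impI)
    fix i j assume ij: "i \<in> C" "j \<in> C" "i \<noteq> j"
    then have d: "cball (fst i) (snd i) \<inter> cball (fst j) (snd j) = {}"
      using C(3) by (auto simp: pairwise_def disjnt_def)
    have "fst i + snd i < fst j - snd j \<or> fst j + snd j < fst i - snd i"
    proof (rule ccontr)
      assume "\<not> ?thesis"
      then have "max (fst i - snd i) (fst j - snd j) \<in> cball (fst i) (snd i) \<inter> cball (fst j) (snd j)"
        using Ke(1)[OF ij(1)] Ke(1)[OF ij(2)] by (auto simp: dist_real_def)
      with d show False by auto
    qed
    then show "I i \<inter> I j = {}"
      using strict_monoD[OF mono, of "fst i + snd i" "fst j - snd j"]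
        strict_monoD[OF mono, of "fst j + snd j" "fst i - snd i"] unfolding I_def by auto
  qed
  define T where "T = \<Phi> ` N \<union> (\<Union>i\<in>C. I i)"
  have Im: "I i \<in> sets lebesgue" for i by (auto simp: I_def)
  have UIm: "(\<Union>i\<in>C. I i) \<in> sets lebesgue" using C(1) Im by (intro sets.countable_UN'') auto
  have e1: "emeasure lebesgue (\<Union>i\<in>C. I i) = (\<integral>\<^sup>+i. emeasure lebesgue (I i) \<partial>count_space C)"
    by (rule emeasure_UN_countable[OF Im C(1) disI])
  have "\<dots> \<le> (\<integral>\<^sup>+i. ennreal r * emeasure lebesgue (cball (fst i) (snd i)) \<partial>count_space C)"
  proof (rule nn_integral_mono)
    fix i assume i: "i \<in> space (count_space C)"
    have "\<Phi> (fst i - snd i) \<le> \<Phi> (fst i + snd i)"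
      using mono Ke(1)[of i] i by (auto simp: strict_mono_less_eq)
    then have "emeasure lebesgue (I i) = ennreal (\<Phi> (fst i + snd i) - \<Phi> (fst i - snd i))"
      by (simp add: I_def)
    also have "\<dots> \<le> ennreal (r * (2 * snd i))" using Ke(3)[of i] i by (intro ennreal_leI) auto
    also have "\<dots> = ennreal r * emeasure lebesgue (cball (fst i) (snd i))"
      using Ke(1)[of i] i r by (simp add: cball_eq_atLeastAtMost ennreal_mult)
    finally show "emeasure lebesgue (I i) \<le> \<dots>" .
  qed
  also have "\<dots> = ennreal r * (\<integral>\<^sup>+i. emeasure lebesgue (cball (fst i) (snd i)) \<partial>count_space C)"
    by (rule nn_integral_cmult) auto
  also have "(\<integral>\<^sup>+i. emeasure lebesgue (cball (fst i) (snd i)) \<partial>count_space C)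
      = emeasure lebesgue (\<Union>i\<in>C. cball (fst i) (snd i))"
    by (rule emeasure_UN_countable[symmetric, OF _ C(1)])
       (use C(3) in \<open>auto simp: disjoint_family_on_def pairwise_def disjnt_def\<close>)
  also have "\<dots> \<le> emeasure lebesgue U"
    using Ke(2) \<open>open U\<close> by (intro emeasure_mono) auto
  finally have "emeasure lebesgue (\<Union>i\<in>C. I i) \<le> ennreal r * emeasure lebesgue U"
    using e1 by (simp add: mult_left_mono)
  moreover have "emeasure lebesgue T \<le> emeasure lebesgue (\<Phi> ` N) + emeasure lebesgue (\<Union>i\<in>C. I i)"
    unfolding T_def using negN UIm by (intro emeasure_subadditive) (auto simp: negligible_iff_null_sets)
  moreover have "emeasure lebesgue (\<Phi> ` N) = 0"
    using negN by (auto simp: negligible_iff_null_sets)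
  ultimately have "emeasure lebesgue T \<le> ennreal r * emeasure lebesgue U"
    by simp
  moreover have "T \<in> sets lebesgue"
    unfolding T_def using negN UIm by (auto simp: negligible_imp_sets)
  moreover have "\<Phi> ` S \<subseteq> T"
  proof
    fix y assume "y \<in> \<Phi> ` S"
    then obtain x where x: "x \<in> S" "y = \<Phi> x" by auto
    show "y \<in> T"
    proof (cases "x \<in> N")
      case False
      then obtain i where i: "i \<in> C" "x \<in> cball (fst i) (snd i)" using x by (auto simp: N_def)
      then have "fst i - snd i \<le> x" "x \<le> fst i + snd i" by (auto simp: dist_real_def)
      then have "y \<in> I i" using mono x by (auto simp: I_def strict_mono_less_eq)
      then show ?thesis using i by (auto simp: T_def)
    qed (use x in \<open>auto simp: T_def\<close>)
  qed
  ultimately show ?thesis using that by blast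
qed


section \<open>Points with a gap between small and large slopes\<close>

lemma steep_quotient_if_flat_uminus:
  assumes "x \<in> flat_points (\<lambda>x. - f x) e (- s)" "0 < d"
  obtains h where "h \<noteq> 0" "\<bar>h\<bar> < d" "s < (f (x + h *\<^sub>R e) - f x) / h"
proof -
  from assms obtain h where "h \<noteq> 0" "\<bar>h\<bar> < d" "(- f (x + h *\<^sub>R e) - - f x) / h < - s"
    unfolding flat_points_def by blast
  moreover have "(- f (x + h *\<^sub>R e) - - f x) / h = - ((f (x + h *\<^sub>R e) - f x) / h)"
    by (simp add: diff_divide_distrib)
  ultimately show ?thesis using that by simp
qed

text \<open>
  Passing to images under \<open>\<Phi>\<close> multiplies the measure of \<open>S\<close> by at most \<open>r\<close>, and passing back by
  \<open>\<Phi>\<close>'s inverse multiplies it by at most \<open>1 / s\<close>; hence \<open>S\<close> has measure at most \<open>r / s < 1\<close> times its own.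
\<close>

lemma negligible_slope_gap_aux:
  fixes \<Phi> :: "real \<Rightarrow> real"
  assumes lip: "B-lipschitz_on UNIV \<Phi>" and "0 < B"
    and expand: "\<And>x y. x \<le> y \<Longrightarrow> y - x \<le> \<Phi> y - \<Phi> x"
    and rs: "0 < r" "r < s"
    and S: "S \<in> lmeasurable" "S \<subseteq> flat_points \<Phi> 1 r" "S \<subseteq> flat_points (\<lambda>x. - \<Phi> x) 1 (- s)"
  shows "negligible S"
proof -
  have mono: "strict_mono \<Phi>"
    by (rule strict_monoI) (smt (verit) expand)
  have cont: "continuous_on A \<Phi>" for A
    using lip lipschitz_on_continuous_on continuous_on_subset by blast
  have "\<exists>x. \<Phi> x = y" for y
  proof -
    let ?m = "\<bar>y - \<Phi> 0\<bar>"
    have "\<Phi> (- ?m) \<le> y" "y \<le> \<Phi> ?m" using expand[of "- ?m" 0] expand[of 0 ?m] by auto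
    then show ?thesis using IVT'[of \<Phi> "- ?m" y ?m] cont by auto
  qed
  then have bij: "bij \<Phi>" using mono by (metis bijI strict_mono_imp_inj_on surjI)
  define \<Psi> where "\<Psi> = inv \<Phi>"
  have PsiPhi[simp]: "\<Psi> (\<Phi> x) = x" for x using bij by (simp add: \<Psi>_def bij_is_inj)
  have PhiPsi[simp]: "\<Phi> (\<Psi> x) = x" for x using bij by (simp add: \<Psi>_def bij_is_surj surj_f_inv_f)
  have monoPsi: "strict_mono \<Psi>"
    by (rule strict_monoI) (metis PhiPsi mono strict_mono_less)
  have lipPsi: "1-lipschitz_on UNIV \<Psi>"
  proof (rule lipschitz_onI)
    fix x y :: real
    show "dist (\<Psi> x) (\<Psi> y) \<le> 1 * dist x y"
      using expand[of "\<Psi> x" "\<Psi> y"] expand[of "\<Psi> y" "\<Psi> x"]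
      by (cases "\<Psi> x \<le> \<Psi> y") (auto simp: dist_real_def)
  qed simp
  have flatPsi: "\<Phi> ` S \<subseteq> flat_points \<Psi> 1 (1 / s)"
    unfolding flat_points_def
  proof (intro subsetI CollectI allI impI)
    fix y d :: real assume "y \<in> \<Phi> ` S" "0 < d"
    then obtain x where x: "x \<in> S" "y = \<Phi> x" by blast
    \<comment> \<open>Keeping \<open>h\<close> below \<open>d / B\<close> keeps the increment
      \<open>k\<close> of \<open>\<Phi>\<close>, which is the increment fed to
      \<open>\<Psi>\<close>, below \<open>d\<close>.\<close>
    have "0 < d / B" using \<open>0 < d\<close> \<open>0 < B\<close> by simp
    moreover have "x \<in> flat_points (\<lambda>x. - \<Phi> x) 1 (- s)" using S(3) x(1) by blast
    ultimately obtain h where h: "h \<noteq> 0" "\<bar>h\<bar> < d / B" "s < (\<Phi> (x + h *\<^sub>R 1) - \<Phi> x) / h"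
      using steep_quotient_if_flat_uminus by blast
    define k where "k = \<Phi> (x + h) - \<Phi> x"
    have k0: "k \<noteq> 0" using h(1) mono unfolding k_def by (simp add: strict_mono_eq)
    have "\<bar>k\<bar> \<le> B * \<bar>h\<bar>"
      using lipschitz_onD[OF lip, of "x + h" x] by (simp add: dist_real_def k_def)
    also have "\<dots> < d" using h(2) \<open>0 < B\<close> by (simp add: pos_less_divide_eq mult.commute)
    finally have kd: "\<bar>k\<bar> < d" .
    have s: "s < k / h" using h(3) by (simp add: k_def)
    have "(\<Psi> (y + k *\<^sub>R 1) - \<Psi> y) / k = h / k"
      unfolding x(2) k_def by simp
    also have "\<dots> = inverse (k / h)" by simp
    also have "\<dots> < inverse s" using s rs by (intro less_imp_inverse_less) auto
    finally have "(\<Psi> (y + k *\<^sub>R 1) - \<Psi> y) / k < 1 / s" by (simp add: inverse_eq_divide)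
    with k0 kd show "\<exists>h. h \<noteq> 0 \<and> \<bar>h\<bar> < d \<and> (\<Psi> (y + h *\<^sub>R 1) - \<Psi> y) / h < 1 / s" by blast
  qed
  let ?m = "measure lebesgue S"
  have m: "emeasure lebesgue S = ennreal ?m" using S(1) by (rule emeasure_eq_measure2)
  \<comment> \<open>Each of the two passages needs an open superset, first of \<open>S\<close>, then
    of \<open>T\<close>; each of these costs \<open>\<epsilon>\<close> in measure.\<close>
  have step: "s * ?m \<le> r * (?m + \<epsilon>) + \<epsilon>" if "\<epsilon> > 0" for \<epsilon>
  proof -
    obtain U where U: "open U" "S \<subseteq> U" "U - S \<in> lmeasurable" "emeasure lebesgue (U - S) < ennreal \<epsilon>"
      using sets_lebesgue_outer_open[OF fmeasurableD[OF S(1)] \<open>\<epsilon> > 0\<close>] by blast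
    obtain T where T: "T \<in> sets lebesgue" "\<Phi> ` S \<subseteq> T" "emeasure lebesgue T \<le> ennreal r * emeasure lebesgue U"
      using measure_image_flat_le[OF mono lip U(2,1) rs(1) S(2)] by blast
    obtain V where V: "open V" "T \<subseteq> V" "V - T \<in> lmeasurable" "emeasure lebesgue (V - T) < ennreal \<epsilon>"
      using sets_lebesgue_outer_open[OF T(1) \<open>\<epsilon> > 0\<close>] by blast
    have "\<Phi> ` S \<subseteq> V" using T V by blast
    then obtain Z where Z: "Z \<in> sets lebesgue" "\<Psi> ` (\<Phi> ` S) \<subseteq> Z" "emeasure lebesgue Z \<le> ennreal (1/s) * emeasure lebesgue V"
      using measure_image_flat_le[OF monoPsi lipPsi _ V(1) _ flatPsi] rs by auto
    have "S \<subseteq> Z" using Z(2) by (simp add: image_image)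
    then have "ennreal ?m \<le> emeasure lebesgue Z"
      unfolding m[symmetric] using Z(1) by (intro emeasure_mono)
    also note Z(3)
    also have "emeasure lebesgue V \<le> emeasure lebesgue T + emeasure lebesgue (V - T)"
      using emeasure_subadditive[of T lebesgue "V - T"] T(1) V by (simp add: Un_absorb1)
    also have "\<dots> \<le> ennreal r * emeasure lebesgue U + ennreal \<epsilon>"
      using T(3) V(4) by (intro add_mono) auto
    also have "emeasure lebesgue U \<le> emeasure lebesgue S + emeasure lebesgue (U - S)"
      using emeasure_subadditive[of S lebesgue "U - S"] S(1) U by (simp add: Un_absorb1 fmeasurableD)
    also have "\<dots> \<le> ennreal ?m + ennreal \<epsilon>"
      using m U(4) by (intro add_mono) auto
    finally have "ennreal ?m \<le> ennreal (1/s) * (ennreal r * (ennreal ?m + ennreal \<epsilon>) + ennreal \<epsilon>)"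
      by (simp add: mult_left_mono add_right_mono)
    also have "\<dots> = ennreal ((1/s) * (r * (?m + \<epsilon>) + \<epsilon>))"
      using rs that by (simp flip: ennreal_plus ennreal_mult)
    finally have "?m \<le> (1/s) * (r * (?m + \<epsilon>) + \<epsilon>)"
      by (subst (asm) ennreal_le_iff) (use rs that in auto)
    then show ?thesis using rs by (simp add: field_simps)
  qed
  have "?m = 0"
  proof (rule ccontr)
    assume "?m \<noteq> 0"
    then have "?m > 0" using zero_less_measure_iff by blast
    \<comment> \<open>With this value, \<open>step\<close> bounds \<open>(s - r) * ?m\<close> by
      half of itself.\<close>
    define \<epsilon> where "\<epsilon> = (s - r) * ?m / (2 * (r + 1))"
    have "\<epsilon> > 0" unfolding \<epsilon>_def using rs \<open>?m > 0\<close> by simp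
    have "(r + 1) * \<epsilon> = (s - r) * ?m / 2" unfolding \<epsilon>_def using rs by (simp add: field_simps)
    moreover have "(s - r) * ?m > 0" using rs \<open>?m > 0\<close> by simp
    ultimately show False using step[OF \<open>\<epsilon> > 0\<close>] by (simp add: algebra_simps)
  qed
  then show ?thesis using S(1) by (simp add: negligible_iff_measure)
qed

text \<open>Over all rational \<open>r < s\<close> these sets exhaust the points where a Lipschitz
  function on the line fails to be differentiable.\<close>

lemma negligible_slope_gap:
  fixes f :: "real \<Rightarrow> real"
  assumes lip: "L-lipschitz_on UNIV f" and "r < s"
  shows "negligible (flat_points f 1 r \<inter> flat_points (\<lambda>x. - f x) 1 (- s))"
proof -
  have L: "0 \<le> L" using lip by (rule lipschitz_on_nonneg)
  define c where "c = L + 1 + \<bar>r\<bar>"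
  \<comment> \<open>Adding a steep linear function makes \<open>f\<close> bi-Lipschitz and shifts all difference quotients.\<close>
  define \<Phi> where "\<Phi> x = f x + c * x" for x
  have c: "0 < c" "L + 1 \<le> c" "0 < r + c" using L by (auto simp: c_def)
  have lipPhi: "(L + c)-lipschitz_on UNIV \<Phi>"
  proof (rule lipschitz_onI)
    fix x y :: real
    have "\<bar>\<Phi> x - \<Phi> y\<bar> \<le> \<bar>f x - f y\<bar> + c * \<bar>x - y\<bar>"
      unfolding \<Phi>_def using c abs_triangle_ineq[of "f x - f y" "c * (x - y)"]
      by (simp add: abs_mult) (simp add: algebra_simps)
    also have "\<bar>f x - f y\<bar> \<le> L * \<bar>x - y\<bar>" using lipschitz_onD[OF lip, of x y] by (simp add: dist_real_def)
    finally show "dist (\<Phi> x) (\<Phi> y) \<le> (L + c) * dist x y" by (simp add: dist_real_def algebra_simps)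
  qed (use L c in simp)
  have expand: "y - x \<le> \<Phi> y - \<Phi> x" if "x \<le> y" for x y
  proof -
    have "\<bar>f y - f x\<bar> \<le> L * (y - x)" using lipschitz_onD[OF lip, of y x] that by (simp add: dist_real_def)
    moreover have "(L + 1) * (y - x) \<le> c * (y - x)" using c that by (intro mult_right_mono) auto
    ultimately show ?thesis unfolding \<Phi>_def by (simp add: algebra_simps)
  qed
  have eq1: "flat_points f 1 r = flat_points \<Phi> 1 (r + c)"
  proof -
    have "(\<Phi> (x + h) - \<Phi> x) / h = (f (x + h) - f x) / h + c" if "h \<noteq> 0" for x h
      using that by (simp add: \<Phi>_def field_simps)
    then show ?thesis unfolding flat_points_def by (intro Collect_cong) (auto cong: conj_cong)
  qed
  have eq2: "flat_points (\<lambda>x. - f x) 1 (- s) = flat_points (\<lambda>x. - \<Phi> x) 1 (- (s + c))"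
  proof -
    have "(\<Phi> x - \<Phi> (x + h)) / h = (f x - f (x + h)) / h - c" if "h \<noteq> 0" for x h
      using that by (simp add: \<Phi>_def field_simps)
    then show ?thesis unfolding flat_points_def by (intro Collect_cong) (auto cong: conj_cong)
  qed
  let ?E = "flat_points f 1 r \<inter> flat_points (\<lambda>x. - f x) 1 (- s)"
  have cont: "continuous_on UNIV f" using lip by (rule lipschitz_on_continuous_on)
  have Eb: "?E \<in> sets borel"
    by (intro sets.Int flat_points_borel continuous_intros cont)
  \<comment> \<open>The measure comparison in \<open>negligible_slope_gap_aux\<close> needs a set of
    finite measure, so the set is cut by boxes.\<close>
  have "negligible (?E \<inter> cbox a b)" for a b
  proof (rule negligible_slope_gap_aux[OF lipPhi _ expand])
    show "?E \<inter> cbox a b \<in> lmeasurable" 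
      using Eb by (intro fmeasurableI2[OF lmeasurable_cbox[of a b]]) auto
    show "?E \<inter> cbox a b \<subseteq> flat_points \<Phi> 1 (r + c)" "?E \<inter> cbox a b \<subseteq> flat_points (\<lambda>x. - \<Phi> x) 1 (- (s + c))"
      unfolding eq1[symmetric] eq2[symmetric] by auto
  qed (use c L assms in auto)
  then show ?thesis by (subst negligible_on_intervals) blast
qed


text \<open>Completeness of \<open>lebesgue\<close> is the point: \<open>f\<close> may be arbitrary
  on a null set. This is how \<open>gradient\<close>, unspecified at points without partial
  derivatives, becomes measurable.\<close>

lemma measurable_lebesgue_AE_cong:
  fixes f g :: "'a::euclidean_space \<Rightarrow> 'b::topological_space"
  assumes g: "g \<in> borel_measurable lborel" and eq: "AE x in lborel. f x = g x"
  shows "f \<in> borel_measurable lebesgue"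
proof (rule measurableI)
  fix A :: "'b set" assume "A \<in> sets borel"
  then have "g -` A \<in> sets lborel" using g by (auto dest: measurable_sets)
  then have "g -` A \<in> sets lebesgue" by (metis sets_completionI_sets)
  moreover have "AE x in lebesgue. x \<in> g -` A \<longleftrightarrow> x \<in> f -` A"
    using AE_completion[OF eq] by eventually_elim auto
  ultimately have "f -` A \<in> sets lebesgue"
    by (intro completion.in_sets_AE[of "g -` A" "f -` A"]) auto
  then show "f -` A \<inter> space lebesgue \<in> sets lebesgue" by simp
qed auto

section \<open>From lines to almost every point of the space\<close>

lemma AE_lborel_translate:
  fixes c :: "'a::euclidean_space"
  assumes "AE x in lborel. P x"
  shows "AE x in lborel. P (c + x)"
proof -
  have "AE x in distr lborel borel ((+) c). P x"
    by (subst lborel_distr_plus) (rule assms)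
  then show ?thesis
    by (rule AE_distrD[rotated]) simp
qed

text \<open>By translation invariance the measure of \<open>G\<close> is the mean, over
  \<open>t\<close> in \<open>{0..1}\<close>, of the measures of \<open>G\<close> shifted by
  multiples of \<open>e\<close>. After Fubini the inner integral is the length of a part of a line
  inside \<open>G\<close>, which is 0. This works for any direction \<open>e\<close> without
  splitting off a coordinate.\<close>

lemma null_sets_if_null_on_lines:
  fixes G :: "'a::euclidean_space set"
  assumes G: "G \<in> sets borel" and lines: "\<And>x. negligible {t::real. x + t *\<^sub>R e \<in> G}"
  shows "G \<in> null_sets lborel"
proof -
  have [measurable]: "(\<lambda>(t::real, x). indicator {0..1} t * indicator G (x + t *\<^sub>R e) :: ennreal)
      \<in> borel_measurable (lborel \<Otimes>\<^sub>M lborel)"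
    using G by measurable
  have "emeasure lborel G = (\<integral>\<^sup>+t. indicator {0..1::real} t * emeasure lborel G \<partial>lborel)"
    by (subst nn_integral_multc) auto
  also have "\<dots> = (\<integral>\<^sup>+t. (\<integral>\<^sup>+x. indicator {0..1::real} t * indicator G (x + t *\<^sub>R e) \<partial>lborel) \<partial>lborel)"
  proof (rule nn_integral_cong)
    fix t :: real
    have "emeasure lborel G = (\<integral>\<^sup>+x. indicator G x \<partial>distr lborel borel ((+) (t *\<^sub>R e)))"
      using G by (simp add: lborel_distr_plus)
    also have "\<dots> = (\<integral>\<^sup>+x. indicator G (x + t *\<^sub>R e) \<partial>lborel)"
      using G by (subst nn_integral_distr) (auto simp: add.commute)
    finally show "indicator {0..1} t * emeasure lborel G
        = (\<integral>\<^sup>+x. indicator {0..1} t * indicator G (x + t *\<^sub>R e) \<partial>lborel)"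
      using G by (subst nn_integral_cmult) auto
  qed
  also have "\<dots> = (\<integral>\<^sup>+x. (\<integral>\<^sup>+t. indicator {0..1::real} t * indicator G (x + t *\<^sub>R e) \<partial>lborel) \<partial>lborel)"
    by (rule lborel_pair.Fubini'[symmetric]) simp
  also have "\<dots> = (\<integral>\<^sup>+x. 0 \<partial>(lborel :: 'a measure))"
  proof (rule nn_integral_cong)
    fix x :: 'a
    have Gx: "{t::real. x + t *\<^sub>R e \<in> G} \<in> sets borel"
      using G measurable_sets_borel[of "\<lambda>t. x + t *\<^sub>R e" borel G] by (auto simp: vimage_def)
    have "AE t in lebesgue. t \<notin> {t::real. x + t *\<^sub>R e \<in> G}"
      using lines[of x] unfolding negligible_iff_null_sets by (rule AE_not_in)
    then have "AE t in lborel. t \<notin> {t::real. x + t *\<^sub>R e \<in> G}"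
      by (simp add: AE_completion_iff)
    then have "AE t in lborel. indicator {0..1::real} t * indicator G (x + t *\<^sub>R e) = (0::ennreal)"
      by eventually_elim auto
    then show "(\<integral>\<^sup>+t. indicator {0..1::real} t * indicator G (x + t *\<^sub>R e) \<partial>lborel) = 0"
      by (subst nn_integral_cong_AE[where v = "\<lambda>_. 0"]) auto
  qed
  finally show ?thesis using G by (auto simp: null_sets_def)
qed

lemma flat_points_line:
  "{t. x + t *\<^sub>R e \<in> flat_points f e r} = flat_points (\<lambda>t::real. f (x + t *\<^sub>R e)) 1 r"
  by (simp add: flat_points_def algebra_simps)

lemma lipschitz_on_line:
  fixes f :: "'a::real_normed_vector \<Rightarrow> real"
  assumes lip: "L-lipschitz_on UNIV f" and e: "norm e = 1"
  shows "L-lipschitz_on UNIV (\<lambda>t. f (x + t *\<^sub>R e))"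
proof (rule lipschitz_onI)
  fix s t :: real
  have "dist (f (x + s *\<^sub>R e)) (f (x + t *\<^sub>R e)) \<le> L * dist (x + s *\<^sub>R e) (x + t *\<^sub>R e)"
    by (rule lipschitz_onD[OF lip]) auto
  also have "dist (x + s *\<^sub>R e) (x + t *\<^sub>R e) = dist s t"
    using e by (simp add: dist_norm flip: scaleR_diff_left)
  finally show "dist (f (x + s *\<^sub>R e)) (f (x + t *\<^sub>R e)) \<le> L * dist s t" .
qed (use lip in \<open>rule lipschitz_on_nonneg\<close>)

lemma lipschitz_quotient_le:
  fixes f :: "'a::real_normed_vector \<Rightarrow> real"
  assumes lip: "L-lipschitz_on UNIV f" and e: "norm e = 1"
  shows "\<bar>(f (x + h *\<^sub>R e) - f x) / h\<bar> \<le> L"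
proof (cases "h = 0")
  case False
  have "\<bar>f (x + h *\<^sub>R e) - f x\<bar> \<le> L * \<bar>h\<bar>"
    using lipschitz_onD[OF lip, of "x + h *\<^sub>R e" x] e by (simp add: dist_norm)
  with False show ?thesis by (simp add: abs_divide pos_divide_le_eq)
qed (use lip lipschitz_on_nonneg in auto)

text \<open>The derivative is found as the lower derivative \<open>D\<close>, the infimum of the
  thresholds that some difference quotients undercut at arbitrarily small scales. For rationals just
  above \<open>D\<close> the point is flat, and the absence of a gap forces all small quotients to
  stay below any slightly larger rational.\<close>

lemma line_derivative_if_no_slope_gap:
  fixes f :: "'a::real_normed_vector \<Rightarrow> real"
  assumes lip: "L-lipschitz_on UNIV f" and e: "norm e = 1"
    and nogap: "\<And>r s. r \<in> \<rat> \<Longrightarrow> s \<in> \<rat> \<Longrightarrow> r < s \<Longrightarrow>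
      x \<notin> flat_points f e r \<inter> flat_points (\<lambda>x. - f x) e (- s)"
  obtains D where "((\<lambda>t. f (x + t *\<^sub>R e)) has_field_derivative D) (at 0)"
proof -
  define q where "q h = (f (x + h *\<^sub>R e) - f x) / h" for h
  have q: "\<bar>q h\<bar> \<le> L" for h unfolding q_def by (rule lipschitz_quotient_le[OF lip e])
  define A where "A = {r. x \<in> flat_points f e r}"
  have notA: "\<exists>d>0. \<forall>h. h \<noteq> 0 \<longrightarrow> \<bar>h\<bar> < d \<longrightarrow> r \<le> q h" if "r \<notin> A" for r
    using that unfolding A_def flat_points_def q_def mem_Collect_eq by (meson not_less)
  have notB: "\<exists>d>0. \<forall>h. h \<noteq> 0 \<longrightarrow> \<bar>h\<bar> < d \<longrightarrow> q h \<le> s" if "x \<notin> flat_points (\<lambda>x. - f x) e (- s)" for s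
  proof -
    from that obtain d where "d > 0" and d: "\<And>h. h \<noteq> 0 \<Longrightarrow> \<bar>h\<bar> < d \<Longrightarrow> \<not> (- f (x + h *\<^sub>R e) - - f x) / h < - s"
      unfolding flat_points_def by blast
    have "(- f (x + h *\<^sub>R e) - - f x) / h = - q h" for h
      by (simp add: diff_divide_distrib q_def)
    with d \<open>d > 0\<close> show ?thesis by (intro exI[of _ d]) force
  qed
  have "L + 1 \<in> A"
    unfolding A_def flat_points_def
  proof (intro CollectI allI impI)
    fix d :: real assume "d > 0"
    have "q (d/2) < L + 1" using q[of "d/2"] by linarith
    then show "\<exists>h. h \<noteq> 0 \<and> \<bar>h\<bar> < d \<and> (f (x + h *\<^sub>R e) - f x) / h < L + 1"
      unfolding q_def using \<open>d > 0\<close> by (intro exI[of _ "d/2"] conjI) simp_all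
  qed
  then have ne: "A \<noteq> {}" by auto
  have "-L \<le> r" if "r \<in> A" for r
  proof -
    have "\<exists>h. h \<noteq> 0 \<and> \<bar>h\<bar> < 1 \<and> q h < r"
      using that unfolding A_def flat_points_def q_def by simp
    then show ?thesis using q by (smt (verit))
  qed
  then have bdd: "bdd_below A" by (rule bdd_belowI)
  define D where "D = Inf A"
  have "\<exists>d>0. \<forall>h. h \<noteq> 0 \<and> norm (h - 0) < d \<longrightarrow> norm (q h - D) < \<epsilon>" if eps: "\<epsilon> > 0" for \<epsilon>
  proof -
    have "D - \<epsilon>/2 \<notin> A" using cInf_lower[OF _ bdd] eps unfolding D_def by force
    then obtain d1 where d1: "d1 > 0" "\<And>h. h \<noteq> 0 \<Longrightarrow> \<bar>h\<bar> < d1 \<Longrightarrow> D - \<epsilon>/2 \<le> q h"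
      using notA by blast
    obtain r where r: "r \<in> A" "r < D + \<epsilon>/4"
      using cInf_lessD[OF ne, of "D + \<epsilon>/4"] eps unfolding D_def by auto
    obtain r' where r': "r' \<in> \<rat>" "r < r'" "r' < D + \<epsilon>/4" using Rats_dense_in_real[OF r(2)] by blast
    obtain s where s: "s \<in> \<rat>" "D + \<epsilon>/4 < s" "s < D + \<epsilon>/2"
      using Rats_dense_in_real[of "D + \<epsilon>/4" "D + \<epsilon>/2"] eps by auto
    have "x \<in> flat_points f e r'" using r(1) r'(2) unfolding A_def flat_points_def by force
    then have "x \<notin> flat_points (\<lambda>x. - f x) e (- s)" using nogap[of r' s] r' s by auto
    then obtain d2 where d2: "d2 > 0" "\<And>h. h \<noteq> 0 \<Longrightarrow> \<bar>h\<bar> < d2 \<Longrightarrow> q h \<le> s"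
      using notB by blast
    have "norm (q h - D) < \<epsilon>" if h: "h \<noteq> 0 \<and> norm (h - 0) < min d1 d2" for h
    proof -
      have "D - \<epsilon>/2 \<le> q h" "q h \<le> s" using d1(2)[of h] d2(2)[of h] h by auto
      then show ?thesis using s \<open>\<epsilon> > 0\<close> by auto
    qed
    then show ?thesis using d1(1) d2(1) by (intro exI[of _ "min d1 d2"]) auto
  qed
  then have "q \<midarrow>0\<rightarrow> D" by (rule LIM_I)
  then have "((\<lambda>t. f (x + t *\<^sub>R e)) has_field_derivative D) (at 0)"
    unfolding has_field_derivative_iff by (simp add: q_def[abs_def])
  then show ?thesis by (rule that)
qed

text \<open>The limit along a fixed sequence is a Borel function of \<open>x\<close> for continuous
  \<open>f\<close>, whether or not the directional derivative exists, and equals it wherever it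
  exists.\<close>

definition line_deriv :: "('a::real_normed_vector \<Rightarrow> real) \<Rightarrow> 'a \<Rightarrow> 'a \<Rightarrow> real" where
  "line_deriv f e x = lim (\<lambda>m. (f (x + (1 / real (Suc m)) *\<^sub>R e) - f x) / (1 / real (Suc m)))"

lemma line_deriv_measurable:
  fixes f :: "'a::euclidean_space \<Rightarrow> real"
  assumes "continuous_on UNIV f"
  shows "line_deriv f e \<in> borel_measurable borel"
proof -
  have [measurable]: "f \<in> borel_measurable borel"
    using assms by (rule borel_measurable_continuous_onI)
  show ?thesis unfolding line_deriv_def[abs_def] by measurable
qed

lemma line_deriv_eq:
  assumes "((\<lambda>t. f (x + t *\<^sub>R e)) has_field_derivative D) (at 0)"
  shows "line_deriv f e x = D"
proof -
  have "((\<lambda>h. (f (x + h *\<^sub>R e) - f x) / h) \<longlongrightarrow> D) (at 0)"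
    using assms unfolding has_field_derivative_iff by simp
  moreover have "filterlim (\<lambda>m. 1 / real (Suc m)) (at 0) sequentially"
    unfolding filterlim_at using LIMSEQ_Suc[OF lim_1_over_n] by (auto simp: o_def)
  ultimately have "(\<lambda>m. (f (x + (1 / real (Suc m)) *\<^sub>R e) - f x) / (1 / real (Suc m))) \<longlonglongrightarrow> D"
    by (rule filterlim_compose)
  then show ?thesis unfolding line_deriv_def by (rule limI)
qed

text \<open>The bad points lie in the countable union of the sets \<open>G r s\<close> over
  rationals \<open>r < s\<close>, and each of these meets every line in direction \<open>e\<close>
  in a null set.\<close>

lemma AE_line_derivative:
  fixes f :: "'a::euclidean_space \<Rightarrow> real"
  assumes lip: "L-lipschitz_on UNIV f" and e: "norm e = 1"
  shows "AE x in lborel. ((\<lambda>t. f (x + t *\<^sub>R e)) has_field_derivative line_deriv f e x) (at 0)"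
proof -
  have cont: "continuous_on UNIV f" using lip by (rule lipschitz_on_continuous_on)
  define G where "G r s = flat_points f e r \<inter> flat_points (\<lambda>x. - f x) e (- s)" for r s
  have null: "G r s \<in> null_sets lborel" if "r < s" for r s
  proof (rule null_sets_if_null_on_lines)
    show "G r s \<in> sets borel" unfolding G_def by (intro sets.Int flat_points_borel continuous_intros cont)
    show "negligible {t. x + t *\<^sub>R e \<in> G r s}" for x
      using negligible_slope_gap[OF lipschitz_on_line[OF lip e, of x] that]
        flat_points_line[of x e f r] flat_points_line[of x e "\<lambda>x. - f x" "- s"]
      unfolding G_def by (simp add: Collect_conj_eq)
  qed
  have "AE x in lborel. \<forall>r\<in>\<rat>. \<forall>s\<in>\<rat>. r < s \<longrightarrow> x \<notin> G r s"
    using null by (intro AE_ball_countable[THEN iffD2] ballI countable_rat AE_impI AE_not_in)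
  then show ?thesis
  proof eventually_elim
    fix x assume x: "\<forall>r\<in>\<rat>. \<forall>s\<in>\<rat>. r < s \<longrightarrow> x \<notin> G r s"
    obtain D where "((\<lambda>t. f (x + t *\<^sub>R e)) has_field_derivative D) (at 0)"
      using line_derivative_if_no_slope_gap[OF lip e, of x] x unfolding G_def by blast
    with line_deriv_eq[OF this] show "((\<lambda>t. f (x + t *\<^sub>R e)) has_field_derivative line_deriv f e x) (at 0)"
      by simp
  qed
qed

lemma line_derivative_bound:
  fixes f :: "'a::real_normed_vector \<Rightarrow> real"
  assumes lip: "L-lipschitz_on UNIV f" and e: "norm e = 1"
    and D: "((\<lambda>t. f (x + t *\<^sub>R e)) has_field_derivative D) (at 0)"
  shows "\<bar>D\<bar> \<le> L"
proof -
  have "((\<lambda>h. \<bar>(f (x + h *\<^sub>R e) - f x) / h\<bar>) \<longlongrightarrow> \<bar>D\<bar>) (at 0)"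
    using D unfolding has_field_derivative_iff by (intro tendsto_rabs) simp
  then show ?thesis
    by (rule tendsto_upperbound)
       (use lipschitz_quotient_le[OF lip e] in \<open>auto intro!: always_eventually simp del: abs_divide\<close>)
qed


section \<open>Averages of Lipschitz functions over cubes\<close>

lemma lborel_integral_translate:
  fixes u :: "'a::euclidean_space \<Rightarrow> real"
  assumes "u \<in> borel_measurable borel"
  shows "(\<integral>x. u (x + c) \<partial>lborel) = (\<integral>x. u x \<partial>lborel)"
proof -
  have "(\<integral>x. u x \<partial>distr lborel borel ((+) c)) = (\<integral>x. u (c + x) \<partial>lborel)"
    using assms by (intro integral_distr) auto
  then show ?thesis by (simp add: lborel_distr_plus add.commute)
qed

lemma lborel_nn_integral_translate:
  fixes u :: "'a::euclidean_space \<Rightarrow> ennreal"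
  assumes "u \<in> borel_measurable borel"
  shows "(\<integral>\<^sup>+x. u (x + c) \<partial>lborel) = (\<integral>\<^sup>+x. u x \<partial>lborel)"
proof -
  have "(\<integral>\<^sup>+x. u x \<partial>distr lborel borel ((+) c)) = (\<integral>\<^sup>+x. u (c + x) \<partial>lborel)"
    using assms by (intro nn_integral_distr) auto
  then show ?thesis by (simp add: lborel_distr_plus add.commute)
qed

lemma integrable_indicator_continuous:
  fixes u :: "'a::euclidean_space \<Rightarrow> real"
  assumes "compact R" "continuous_on UNIV u"
  shows "integrable lborel (\<lambda>x. indicator R x * u x)"
  using borel_integrable_compact[OF assms(1), of u] continuous_on_subset[OF assms(2)]
  by (simp add: indicator_def if_distrib cong: if_cong)

text \<open>Although \<open>f\<close> is differentiable only almost everywhere, its integral over a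
  translate of \<open>R\<close> is differentiable in the translation at every \<open>t\<close>: the
  difference quotients are bounded by \<open>L\<close>, so dominated convergence applies. This makes
  the mean value inequality available.\<close>

lemma translated_integral_has_derivative:
  fixes f :: "'a::euclidean_space \<Rightarrow> real"
  assumes lip: "L-lipschitz_on UNIV f" and e: "norm e = 1" and R: "compact R"
  defines "g \<equiv> \<lambda>t x. indicator R x * line_deriv f e (x + t *\<^sub>R e)"
  shows "((\<lambda>t. \<integral>x. indicator R x * f (x + t *\<^sub>R e) \<partial>lborel)
      has_field_derivative (\<integral>x. g t x \<partial>lborel)) (at t)" (is "(?F has_field_derivative _) _")
    and "integrable lborel (g t)"
proof -
  have cont: "continuous_on UNIV f" using lip by (rule lipschitz_on_continuous_on)
  have [measurable]: "f \<in> borel_measurable borel" "line_deriv f e \<in> borel_measurable borel" "R \<in> sets borel"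
    using cont R by (auto intro: borel_measurable_continuous_onI line_deriv_measurable borel_compact)
  have int: "integrable lborel (\<lambda>x. indicator R x * f (x + c))" for c
    by (intro integrable_indicator_continuous R continuous_on_compose2[OF cont] continuous_intros) auto
  have intL: "integrable lborel (\<lambda>x. indicator R x * L)"
    by (intro integrable_indicator_continuous R continuous_intros)
  have AE: "AE x in lborel. ((\<lambda>s. f ((x + t *\<^sub>R e) + s *\<^sub>R e)) has_field_derivative
      line_deriv f e (x + t *\<^sub>R e)) (at 0)"
    using AE_lborel_translate[OF AE_line_derivative[OF lip e], of "t *\<^sub>R e"] by (simp add: add.commute)
  have gm: "g t \<in> borel_measurable lborel" unfolding g_def by measurable
  define u where "u s x = indicator R x * ((f ((x + t *\<^sub>R e) + s *\<^sub>R e) - f (x + t *\<^sub>R e)) / s)" for s x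
  have ubound: "norm (u s x) \<le> indicator R x * L" for s x
    unfolding u_def using lipschitz_quotient_le[OF lip e, of "x + t *\<^sub>R e" s] by (simp add: indicator_def)
  have um: "u s \<in> borel_measurable lborel" for s unfolding u_def by measurable
  have ulim: "AE x in lborel. (\<lambda>i. u (X i) x) \<longlonglongrightarrow> g t x"
    if X: "\<forall>i. X i \<in> UNIV - {0}" "X \<longlonglongrightarrow> 0" for X
    using AE
  proof eventually_elim
    fix x assume "((\<lambda>s. f ((x + t *\<^sub>R e) + s *\<^sub>R e)) has_field_derivative line_deriv f e (x + t *\<^sub>R e)) (at 0)"
    then have "((\<lambda>h. (f ((x + t *\<^sub>R e) + h *\<^sub>R e) - f (x + t *\<^sub>R e)) / h) \<longlongrightarrow> line_deriv f e (x + t *\<^sub>R e)) (at 0)"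
      unfolding has_field_derivative_iff by simp
    then have "(\<lambda>i. (f ((x + t *\<^sub>R e) + X i *\<^sub>R e) - f (x + t *\<^sub>R e)) / X i) \<longlonglongrightarrow> line_deriv f e (x + t *\<^sub>R e)"
      using X unfolding tendsto_at_iff_sequentially comp_def by blast
    then show "(\<lambda>i. u (X i) x) \<longlonglongrightarrow> g t x" unfolding u_def g_def by (intro tendsto_intros)
  qed
  show "integrable lborel (g t)"
  proof (rule integrable_dominated_convergence[where s = "\<lambda>i. u (1 / real (Suc i))", OF gm um intL])
    show "AE x in lborel. (\<lambda>i. u (1 / real (Suc i)) x) \<longlonglongrightarrow> g t x"
      by (rule ulim) (use LIMSEQ_Suc[OF lim_1_over_n] in auto)
    show "AE x in lborel. norm (u (1 / real (Suc i)) x) \<le> indicator R x * L" for i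
      using ubound by auto
  qed
  show "(?F has_field_derivative (\<integral>x. g t x \<partial>lborel)) (at t)"
    unfolding DERIV_def tendsto_at_iff_sequentially comp_def
  proof (intro allI impI)
    fix X :: "nat \<Rightarrow> real" assume X: "\<forall>i. X i \<in> UNIV - {0}" "X \<longlonglongrightarrow> 0"
    have "(\<lambda>i. \<integral>x. u (X i) x \<partial>lborel) \<longlonglongrightarrow> (\<integral>x. g t x \<partial>lborel)"
      by (rule integral_dominated_convergence[where s = "\<lambda>i. u (X i)", OF gm um intL ulim[OF X]])
        (use ubound in auto)
    moreover have "(\<integral>x. u s x \<partial>lborel) = (?F (t + s) - ?F t) / s" for s
    proof -
      have "(\<integral>x. u s x \<partial>lborel)
          = (\<integral>x. (indicator R x * f (x + (t + s) *\<^sub>R e) - indicator R x * f (x + t *\<^sub>R e)) / s \<partial>lborel)"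
        unfolding u_def by (intro Bochner_Integration.integral_cong refl) (simp add: algebra_simps diff_divide_distrib)
      also have "\<dots> = (?F (t + s) - ?F t) / s" using int by simp
      finally show ?thesis .
    qed
    ultimately show "(\<lambda>i. (?F (t + X i) - ?F t) / X i) \<longlonglongrightarrow> (\<integral>x. g t x \<partial>lborel)" by simp
  qed
qed

text \<open>Mean value inequality in the translation parameter. All translates of \<open>R\<close>
  up to \<open>h\<close> stay inside \<open>S\<close>, so one integral over \<open>S\<close> bounds
  the derivative for every \<open>t\<close>.\<close>

lemma translated_integral_diff_le:
  fixes f :: "'a::euclidean_space \<Rightarrow> real"
  assumes lip: "L-lipschitz_on UNIV f" and e: "norm e = 1" and R: "compact R" and h: "0 \<le> h"
    and S: "S \<in> sets borel" "\<And>x t. x \<in> R \<Longrightarrow> 0 \<le> t \<Longrightarrow> t \<le> h \<Longrightarrow> x + t *\<^sub>R e \<in> S"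
    and J: "(\<integral>\<^sup>+x\<in>S. ennreal \<bar>line_deriv f e x\<bar> \<partial>lborel) \<le> ennreal J" "0 \<le> J"
  shows "\<bar>(\<integral>x. indicator R x * f (x + h *\<^sub>R e) \<partial>lborel) - (\<integral>x. indicator R x * f x \<partial>lborel)\<bar> \<le> J * h"
proof -
  have [measurable]: "line_deriv f e \<in> borel_measurable borel" "R \<in> sets borel" "S \<in> sets borel"
    using lipschitz_on_continuous_on[OF lip] R S by (auto intro: line_deriv_measurable borel_compact)
  let ?F = "\<lambda>t. \<integral>x. indicator R x * f (x + t *\<^sub>R e) \<partial>lborel"
  let ?F' = "\<lambda>t. \<integral>x. indicator R x * line_deriv f e (x + t *\<^sub>R e) \<partial>lborel"
  have bd: "norm (?F' t) \<le> J" if t: "t \<in> {0..h}" for t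
  proof -
    have "ennreal (norm (?F' t)) \<le> (\<integral>\<^sup>+x. norm (indicator R x * line_deriv f e (x + t *\<^sub>R e)) \<partial>lborel)"
      by (rule integral_norm_bound_ennreal[OF translated_integral_has_derivative(2)[OF lip e R]])
    also have "\<dots> \<le> (\<integral>\<^sup>+x. ennreal \<bar>line_deriv f e (x + t *\<^sub>R e)\<bar> * indicator S (x + t *\<^sub>R e) \<partial>lborel)"
      using S(2) t by (intro nn_integral_mono) (auto simp: indicator_def)
    also have "\<dots> = (\<integral>\<^sup>+x\<in>S. ennreal \<bar>line_deriv f e x\<bar> \<partial>lborel)"
      by (rule lborel_nn_integral_translate[of "\<lambda>x. ennreal \<bar>line_deriv f e x\<bar> * indicator S x"]) measurable
    also note J(1)
    finally show ?thesis using J(2) by simp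
  qed
  have "norm (?F h - ?F 0) \<le> J * norm (h - 0)"
  proof (rule field_differentiable_bound[of "{0..h}" ?F ?F' J h 0])
    fix t assume "t \<in> {0..h}"
    show "(?F has_field_derivative ?F' t) (at t within {0..h})"
      using translated_integral_has_derivative(1)[OF lip e R] by (rule DERIV_subset) simp
  qed (use h bd in auto)
  then show ?thesis using h by simp
qed


lemma avg_eq_lborel:
  assumes "continuous_on UNIV f" "R \<in> sets borel"
  shows "avg R f = (\<integral>x. indicator R x * f x \<partial>lborel) / measure lborel R"
proof -
  have "(\<lambda>x. indicator R x *\<^sub>R f x) \<in> borel_measurable lborel"
    using assms borel_measurable_continuous_onI[OF assms(1)] by measurable
  then show ?thesis
    using assms(2) unfolding avg_def set_lebesgue_integral_def by (simp add: integral_completion)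
qed

lemma content_cbox_vec:
  fixes \<alpha> \<beta> :: "real ^ 'n"
  assumes "\<And>j. \<alpha> $ j \<le> \<beta> $ j"
  shows "measure lborel (cbox \<alpha> \<beta>) = (\<Prod>j\<in>UNIV. \<beta> $ j - \<alpha> $ j)"
  using assms by (intro content_cbox_cart) (auto simp: interval_ne_empty_cart)

text \<open>The upper half is the lower one shifted by \<open>d\<close> in direction
  \<open>i\<close>, and the average over the box is the mean of the averages over the halves. Hence
  each of these deviates from it by half their difference, which
  \<open>translated_integral_diff_le\<close> controls.\<close>

lemma avg_half_box:
  fixes f :: "real ^ 'n \<Rightarrow> real" and \<alpha> \<beta> :: "real ^ 'n"
  assumes lip: "L-lipschitz_on UNIV f" and less: "\<And>j. \<alpha> $ j < \<beta> $ j"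
    and J: "(\<integral>\<^sup>+x\<in>cbox \<alpha> \<beta>. ennreal \<bar>line_deriv f (axis i 1) x\<bar> \<partial>lborel) \<le> ennreal J" "0 \<le> J"
  defines "d \<equiv> (\<beta> $ i - \<alpha> $ i) / 2"
  defines "lo \<equiv> cbox \<alpha> (\<chi> j. if j = i then \<alpha> $ i + d else \<beta> $ j)"
    and "hi \<equiv> cbox (\<chi> j. if j = i then \<alpha> $ i + d else \<alpha> $ j) \<beta>"
  shows "\<bar>avg lo f - avg (cbox \<alpha> \<beta>) f\<bar> \<le> J * d / measure lborel lo"
    and "\<bar>avg hi f - avg (cbox \<alpha> \<beta>) f\<bar> \<le> J * d / measure lborel hi"
    and "measure lborel lo > 0" "measure lborel hi = measure lborel lo"
proof -
  let ?R = "cbox \<alpha> \<beta>" and ?e = "axis i 1 :: real ^ 'n"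
  have d: "0 < d" "\<alpha> $ i + d + d = \<beta> $ i" using less[of i] by (simp_all add: d_def)
  have cont: "continuous_on UNIV f" using lip by (rule lipschitz_on_continuous_on)
  define P where "P = (\<Prod>j\<in>UNIV - {i}. \<beta> $ j - \<alpha> $ j)"
  have "P > 0" unfolding P_def using less by (intro prod_pos) auto
  have le: "\<alpha> $ j \<le> \<beta> $ j" for j using less[of j] by simp
  have mR: "measure lborel ?R = (2 * d) * P"
    unfolding P_def using le
    by (subst content_cbox_vec) (auto simp: prod.remove[of UNIV i] d_def)
  have mlo: "measure lborel lo = d * P"
    unfolding lo_def P_def using le d
    by (subst content_cbox_vec) (auto simp: prod.remove[of UNIV i] intro!: prod.cong)
  have mhi: "measure lborel hi = d * P"
    unfolding hi_def P_def using le d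
    by (subst content_cbox_vec) (auto simp: prod.remove[of UNIV i] intro!: prod.cong)
  show lopos: "measure lborel lo > 0" and eqm: "measure lborel hi = measure lborel lo"
    using mlo mhi d \<open>P > 0\<close> by auto
  define I where "I S = (\<integral>x. indicator S x * f x \<partial>lborel)" for S :: "(real ^ 'n) set"
  have intS: "integrable lborel (\<lambda>x. indicator (cbox u v) x * f x)" for u v
    by (intro integrable_indicator_continuous cont compact_cbox)
  \<comment> \<open>The closed halves overlap in this hyperplane.\<close>
  have null: "AE x in lborel. x $ i \<noteq> \<alpha> $ i + d"
  proof -
    have "negligible {x :: real ^ 'n. x $ i = \<alpha> $ i + d}"
      using negligible_standard_hyperplane[of ?e "\<alpha> $ i + d"] by (simp add: cart_eq_inner_axis axis_in_Basis_iff inner_commute)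
    then have "AE x in lebesgue. x \<notin> {x :: real ^ 'n. x $ i = \<alpha> $ i + d}"
      unfolding negligible_iff_null_sets by (rule AE_not_in)
    then show ?thesis by (simp add: AE_completion_iff)
  qed
  have split: "indicator ?R x * f x = indicator lo x * f x + indicator hi x * f x"
    if "x $ i \<noteq> \<alpha> $ i + d" for x
  proof (cases "x \<in> ?R")
    case True
    then have "(x \<in> lo) = (x $ i < \<alpha> $ i + d)" "(x \<in> hi) = (x $ i > \<alpha> $ i + d)"
      using that unfolding lo_def hi_def mem_box_cart by (force split: if_splits)+
    with True that show ?thesis by (auto simp: indicator_def)
  next
    case False
    have "lo \<subseteq> ?R" "hi \<subseteq> ?R"
      unfolding lo_def hi_def using d le by (auto simp: mem_box_cart split: if_splits) (smt (verit))+
    with False show ?thesis by (auto simp: indicator_def)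
  qed
  have "I ?R = (\<integral>x. indicator lo x * f x + indicator hi x * f x \<partial>lborel)"
    unfolding I_def
  proof (rule integral_cong_AE)
    show "AE x in lborel. indicator ?R x * f x = indicator lo x * f x + indicator hi x * f x"
      using null by eventually_elim (rule split)
    show "(\<lambda>x. indicator ?R x * f x) \<in> borel_measurable lborel"
      "(\<lambda>x. indicator lo x * f x + indicator hi x * f x) \<in> borel_measurable lborel"
      unfolding lo_def hi_def
      by (rule borel_measurable_integrable, intro Bochner_Integration.integrable_add intS)+
  qed
  also have "\<dots> = I lo + I hi"
    unfolding I_def lo_def hi_def by (intro Bochner_Integration.integral_add intS)
  finally have IR: "I ?R = I lo + I hi" .
  have hi_lo: "indicator hi (x + d *\<^sub>R ?e) = (indicator lo x :: real)" for x
  proof -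
    have "(x + d *\<^sub>R ?e \<in> hi) = (x \<in> lo)"
      unfolding lo_def hi_def mem_box_cart using d
      by (intro all_cong1) (auto simp: axis_def)
    then show ?thesis by (simp add: indicator_def)
  qed
  have "I hi = (\<integral>x. indicator hi (x + d *\<^sub>R ?e) * f (x + d *\<^sub>R ?e) \<partial>lborel)"
    unfolding I_def
    by (subst lborel_integral_translate[of "\<lambda>x. indicator hi x * f x"])
       (use borel_measurable_integrable[OF intS] in \<open>auto simp: hi_def\<close>)
  then have Ihi: "I hi = (\<integral>x. indicator lo x * f (x + d *\<^sub>R ?e) \<partial>lborel)"
    unfolding hi_lo .
  have "\<bar>I hi - I lo\<bar> \<le> J * d"
    unfolding Ihi unfolding I_def
  proof (rule translated_integral_diff_le[OF lip _ _ _ _ _ J])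
    show "x + t *\<^sub>R ?e \<in> ?R" if "x \<in> lo" "0 \<le> t" "t \<le> d" for x t
      unfolding mem_box_cart
    proof
      fix j
      show "\<alpha> $ j \<le> (x + t *\<^sub>R ?e) $ j \<and> (x + t *\<^sub>R ?e) $ j \<le> \<beta> $ j"
        using that d unfolding lo_def mem_box_cart
        by (cases "j = i") (auto simp: axis_def dest!: spec[of _ j])
    qed
  qed (use d in \<open>auto simp: lo_def norm_axis_1\<close>)
  then have diff: "\<bar>I hi - I lo\<bar> / (2 * (d * P)) \<le> J * d / (d * P)"
    using d \<open>P > 0\<close> by (simp add: field_simps)
  have avgS: "avg (cbox u v) f = I (cbox u v) / measure lborel (cbox u v)" for u v
    unfolding I_def by (rule avg_eq_lborel[OF cont]) simp
  have "avg lo f - avg ?R f = (I lo - I hi) / (2 * (d * P))"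
    using d \<open>P > 0\<close> mlo mR IR avgS unfolding lo_def by (simp add: field_simps)
  then show "\<bar>avg lo f - avg ?R f\<bar> \<le> J * d / measure lborel lo"
    using diff d \<open>P > 0\<close> mlo by (simp add: abs_divide abs_minus_commute abs_mult)
  have "avg hi f - avg ?R f = (I hi - I lo) / (2 * (d * P))"
    using d \<open>P > 0\<close> mhi mR IR avgS unfolding hi_def by (simp add: field_simps)
  then show "\<bar>avg hi f - avg ?R f\<bar> \<le> J * d / measure lborel hi"
    using diff d \<open>P > 0\<close> mhi by (simp add: abs_divide abs_mult)
qed

text \<open>Each of the \<open>CARD('n)\<close> halvings costs at most \<open>J * (s / 2)\<close>
  divided by the volume of the box it produces, and that volume is at least the volume of the final
  cube.\<close>

lemma avg_subcube_le:
  fixes f :: "real ^ 'n \<Rightarrow> real" and a a' :: "real ^ 'n"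
  assumes lip: "L-lipschitz_on UNIV f" and s: "0 < s"
    and a': "\<And>j. a' $ j = a $ j \<or> a' $ j = a $ j + s / 2"
    and J: "\<And>i. (\<integral>\<^sup>+x\<in>cube a s. ennreal \<bar>line_deriv f (axis i 1) x\<bar> \<partial>lborel) \<le> ennreal J" "0 \<le> J"
  shows "\<bar>avg (cube a' (s / 2)) f - avg (cube a s) f\<bar>
    \<le> real CARD('n) * (J * (s / 2) / (s / 2) ^ CARD('n))"
proof -
  \<comment> \<open>Shrink the cube one coordinate at a time: the sides in \<open>T\<close> are already halved.\<close>
  define A :: "'n set \<Rightarrow> real ^ 'n" where "A T = (\<chi> j. if j \<in> T then a' $ j else a $ j)" for T
  define B :: "'n set \<Rightarrow> real ^ 'n" where "B T = (\<chi> j. if j \<in> T then a' $ j + s / 2 else a $ j + s)" for T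
  define K where "K = J * (s / 2) / (s / 2) ^ CARD('n)"
  have less: "A T $ j < B T $ j" for T j using s by (simp add: A_def B_def)
  have vol: "(s / 2) ^ CARD('n) \<le> measure lborel (cbox (A T) (B T))" for T
  proof -
    have "(s / 2) ^ CARD('n) = (\<Prod>j\<in>(UNIV::'n set). s / 2)" by simp
    also have "\<dots> \<le> (\<Prod>j\<in>UNIV. B T $ j - A T $ j)"
      using s by (intro prod_mono) (auto simp: A_def B_def)
    also have "\<dots> = measure lborel (cbox (A T) (B T))"
      using less by (intro content_cbox_vec[symmetric] less_imp_le)
    finally show ?thesis .
  qed
  have sub: "cbox (A T) (B T) \<subseteq> cube a s" for T
  proof
    fix x assume x: "x \<in> cbox (A T) (B T)"
    have "a $ j \<le> x $ j \<and> x $ j \<le> a $ j + s" for j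
      using x a'[of j] s unfolding mem_box_cart A_def B_def by (auto dest!: spec[of _ j] split: if_splits)
    then show "x \<in> cube a s" by (simp add: cube_def mem_box_cart)
  qed
  have JT: "(\<integral>\<^sup>+x\<in>cbox (A T) (B T). ennreal \<bar>line_deriv f (axis i 1) x\<bar> \<partial>lborel) \<le> ennreal J" for T i
    using sub[of T] by (intro order_trans[OF nn_integral_mono J(1)[of i]]) (auto simp: indicator_def)
  have "\<bar>avg (cbox (A T) (B T)) f - avg (cube a s) f\<bar> \<le> real (card T) * K" if "finite T" for T
    using that
  proof (induction T rule: finite_induct)
    case empty
    have "cbox (A {}) (B {}) = cube a s"
      unfolding cube_def A_def B_def by (rule arg_cong2[where f = cbox]) (auto simp: vec_eq_iff)
    then show ?case by simp
  next
    case (insert i T)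
    define d where "d = (B T $ i - A T $ i) / 2"
    have d: "d = s / 2" using insert by (simp add: d_def A_def B_def)
    define lo hi where "lo = cbox (A T) (\<chi> j. if j = i then A T $ i + d else B T $ j)"
      and "hi = cbox (\<chi> j. if j = i then A T $ i + d else A T $ j) (B T)"
    note half = avg_half_box[OF lip less[of T] JT[of i T] J(2), folded d_def, folded lo_def hi_def]
    have "cbox (A (insert i T)) (B (insert i T)) = lo \<or> cbox (A (insert i T)) (B (insert i T)) = hi"
      using a'[of i]
    proof
      assume "a' $ i = a $ i"
      then have "cbox (A (insert i T)) (B (insert i T)) = lo"
        unfolding lo_def using insert(2) d
        by (intro arg_cong2[where f = cbox]) (auto simp: vec_eq_iff A_def B_def)
      then show ?thesis ..
    next
      assume "a' $ i = a $ i + s / 2"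
      then have "cbox (A (insert i T)) (B (insert i T)) = hi"
        unfolding hi_def using insert(2) d
        by (intro arg_cong2[where f = cbox]) (auto simp: vec_eq_iff A_def B_def)
      then show ?thesis ..
    qed
    then have "\<bar>avg (cbox (A (insert i T)) (B (insert i T))) f - avg (cbox (A T) (B T)) f\<bar>
        \<le> J * d / measure lborel (cbox (A (insert i T)) (B (insert i T)))"
      using half by auto
    also have "\<dots> \<le> K"
    proof -
      have pos: "0 < (s / 2) ^ CARD('n)" using s by simp
      then have "0 < measure lborel (cbox (A (insert i T)) (B (insert i T)))"
        using vol[of "insert i T"] by linarith
      with vol[of "insert i T"] pos show ?thesis
        unfolding d K_def using J(2) s by (intro divide_left_mono mult_pos_pos mult_nonneg_nonneg) linarith+
    qed
    finally have "\<bar>avg (cbox (A (insert i T)) (B (insert i T))) f - avg (cube a s) f\<bar>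
        \<le> K + real (card T) * K"
      using insert.IH by linarith
    then show ?case using insert(1,2) by (simp add: algebra_simps)
  qed
  from this[of UNIV]
  have "\<bar>avg (cbox (A UNIV) (B UNIV)) f - avg (cube a s) f\<bar> \<le> real CARD('n) * K" by simp
  moreover have "cbox (A UNIV) (B UNIV) = cube a' (s / 2)"
    unfolding cube_def A_def B_def by (rule arg_cong2[where f = cbox]) (auto simp: vec_eq_iff)
  ultimately show ?thesis unfolding K_def by simp
qed


section \<open>Dyadic cubes\<close>

text \<open>
  The cells are half-open, so that those of one generation partition the space; the cubes are their
  closures.
\<close>

definition dindex :: "real ^ 'n \<Rightarrow> real \<Rightarrow> nat \<Rightarrow> real ^ 'n \<Rightarrow> 'n \<Rightarrow> int" where
  "dindex a l k x = (\<lambda>i. \<lfloor>(x $ i - a $ i) * 2 ^ k / l\<rfloor>)"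

definition dcorner :: "real ^ 'n \<Rightarrow> real \<Rightarrow> nat \<Rightarrow> ('n \<Rightarrow> int) \<Rightarrow> real ^ 'n" where
  "dcorner a l k z = (\<chi> i. a $ i + of_int (z i) * (l / 2 ^ k))"

abbreviation dcube :: "real ^ 'n \<Rightarrow> real \<Rightarrow> nat \<Rightarrow> real ^ 'n \<Rightarrow> (real ^ 'n) set" where
  "dcube a l k x \<equiv> cube (dcorner a l k (dindex a l k x)) (l / 2 ^ k)"

definition dcell :: "real ^ 'n \<Rightarrow> real \<Rightarrow> nat \<Rightarrow> ('n \<Rightarrow> int) \<Rightarrow> (real ^ 'n) set" where
  "dcell a l k z = {x. dindex a l k x = z}"

lemma mem_cube: "x \<in> cube a l \<longleftrightarrow> (\<forall>i. a $ i \<le> x $ i \<and> x $ i \<le> a $ i + l)"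
  by (simp add: cube_def mem_box_cart)

lemma dindex_eq_iff:
  assumes "0 < l"
  shows "dindex a l k x i = c \<longleftrightarrow>
    a $ i + of_int c * (l / 2 ^ k) \<le> x $ i \<and> x $ i < a $ i + of_int c * (l / 2 ^ k) + l / 2 ^ k"
  using assms unfolding dindex_def floor_eq_iff by (auto simp: field_simps)

lemma dcell_eq:
  assumes "0 < l"
  shows "dcell a l k z = {x. \<forall>i. dcorner a l k z $ i \<le> x $ i \<and> x $ i < dcorner a l k z $ i + l / 2 ^ k}"
  unfolding dcell_def fun_eq_iff dindex_eq_iff[OF assms] dcorner_def by simp

lemma dcell_borel: "0 < l \<Longrightarrow> dcell a l k z \<in> sets borel"
  unfolding dcell_eq by measurable

lemma dindex_Suc:
  "dindex a l (Suc k) x i = 2 * dindex a l k x i \<or> dindex a l (Suc k) x i = 2 * dindex a l k x i + 1"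
proof -
  have "(x $ i - a $ i) * 2 ^ Suc k / l = 2 * ((x $ i - a $ i) * 2 ^ k / l)" by simp
  then show ?thesis unfolding dindex_def by linarith
qed

text \<open>The index of a parent is the index of the child \<open>div 2\<close>, so a cell
  determines all coarser cells that contain it.\<close>

lemma dindex_nested:
  assumes "dindex a l k x = dindex a l k y" "j \<le> k"
  shows "dindex a l j x = dindex a l j y"
  using assms(2,1)
proof (induction rule: dec_induct)
  case (step m)
  have "dindex a l m x i = dindex a l m y i" for i
  proof -
    have "dindex a l m x i = dindex a l (Suc m) x i div 2" for x
      using dindex_Suc[of a l m x i] by auto
    with step.prems show ?thesis by simp
  qed
  then show ?case using step.IH by blast
qed auto

lemma dcell_subset_dcube:
  assumes "0 < l"
  shows "dcell a l k z \<subseteq> cube (dcorner a l k z) (l / 2 ^ k)"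
  unfolding dcell_eq[OF assms] by (clarsimp simp: mem_cube) (meson less_imp_le)

lemma mem_dcube: "0 < l \<Longrightarrow> x \<in> dcube a l k x"
  using dcell_subset_dcube[of l a k "dindex a l k x"] by (auto simp: dcell_def)

lemma negligible_cube_diff_dcell:
  assumes "0 < l"
  shows "negligible (cube (dcorner a l k z) (l / 2 ^ k) - dcell a l k z)"
proof (rule negligible_subset[OF negligible_frontier_interval])
  show "cube (dcorner a l k z) (l / 2 ^ k) - dcell a l k z
    \<subseteq> cbox (dcorner a l k z) (dcorner a l k z + (\<chi> i. l / 2 ^ k)) - box (dcorner a l k z) (dcorner a l k z + (\<chi> i. l / 2 ^ k))"
    unfolding dcell_eq[OF assms] cube_def by (auto simp: mem_box_cart intro: less_imp_le)
qed

text \<open>Mediates between the disjoint cells, used for decompositions, and the closed cubes, for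
  which the Muckenhoupt conditions are stated.\<close>

lemma nn_integral_dcell_eq_cube:
  assumes "0 < l"
  shows "(\<integral>\<^sup>+x\<in>dcell a l k z. h x \<partial>lebesgue) = (\<integral>\<^sup>+x\<in>cube (dcorner a l k z) (l / 2 ^ k). h x \<partial>lebesgue)"
proof (rule nn_integral_cong_AE)
  have "AE x in lebesgue. x \<notin> cube (dcorner a l k z) (l / 2 ^ k) - dcell a l k z"
    using negligible_cube_diff_dcell[OF assms] unfolding negligible_iff_null_sets by (rule AE_not_in)
  then show "AE x in lebesgue. h x * indicator (dcell a l k z) x = h x * indicator (cube (dcorner a l k z) (l / 2 ^ k)) x"
    by eventually_elim (use dcell_subset_dcube[OF assms, of a k z] in \<open>auto simp: indicator_def\<close>)
qed

lemma dcube_Suc_corner: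
  shows "dcorner a l (Suc k) (dindex a l (Suc k) x) $ i = dcorner a l k (dindex a l k x) $ i \<or>
    dcorner a l (Suc k) (dindex a l (Suc k) x) $ i = dcorner a l k (dindex a l k x) $ i + (l / 2 ^ k) / 2"
  using dindex_Suc[of a l k x i] by (auto simp: dcorner_def field_simps)

lemma cube_half_subset:
  assumes "\<And>i. a' $ i = a $ i \<or> a' $ i = a $ i + s / 2" "0 < s"
  shows "cube a' (s / 2) \<subseteq> cube a s"
proof
  fix x assume x: "x \<in> cube a' (s / 2)"
  have "a $ i \<le> x $ i \<and> x $ i \<le> a $ i + s" for i
    using x assms(1)[of i] assms(2) unfolding mem_cube by (auto dest!: spec[of _ i])
  then show "x \<in> cube a s" by (simp add: mem_cube)
qed

lemma dcube_Suc_subset: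
  assumes "0 < l"
  shows "dcube a l (Suc k) x \<subseteq> dcube a l k x"
  using cube_half_subset[of "dcorner a l (Suc k) (dindex a l (Suc k) x)" "dcorner a l k (dindex a l k x)" "l / 2 ^ k"]
    dcube_Suc_corner[of a l k x] assms by (simp add: mult.commute)

lemma dcube_0:
  assumes "x \<in> dcell a l 0 (\<lambda>_. 0)"
  shows "dcube a l 0 x = cube a l"
proof -
  have "dcorner a l 0 (dindex a l 0 x) = a"
    using assms by (simp add: dcell_def dcorner_def vec_eq_iff)
  then show ?thesis by simp
qed

lemma dcube_subset:
  assumes "x \<in> dcell a l 0 (\<lambda>_. 0)" "0 < l"
  shows "dcube a l k x \<subseteq> cube a l"
proof (induction k)
  case 0 show ?case using dcube_0[OF assms(1)] by simp
next
  case (Suc k) then show ?case using dcube_Suc_subset[OF assms(2), of a k x] by blast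
qed

lemma measure_cube:
  assumes "0 \<le> l"
  shows "measure lborel (cube (a :: real ^ 'n) l) = l ^ CARD('n)"
  unfolding cube_def using assms by (subst content_cbox_vec) auto

lemma dist_cube_le:
  assumes "x \<in> cube (a :: real ^ 'n) s" "y \<in> cube a s"
  shows "norm (x - y) \<le> real CARD('n) * s"
proof -
  have "norm (x - y) \<le> (\<Sum>i\<in>UNIV. \<bar>(x - y) $ i\<bar>)" by (rule norm_le_l1_cart)
  also have "\<dots> \<le> (\<Sum>i\<in>(UNIV :: 'n set). s)"
  proof (rule sum_mono)
    fix i :: 'n
    show "\<bar>(x - y) $ i\<bar> \<le> s" using assms unfolding mem_cube by (auto dest!: spec[of _ i] simp: abs_le_iff)
  qed
  finally show ?thesis by simp
qed

text \<open>Averages over shrinking cubes thus converge to \<open>f x\<close> at every point of the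
  dyadic cell, so that the telescoping has no exceptional points there.\<close>

lemma avg_cube_near:
  fixes f :: "real ^ 'n \<Rightarrow> real"
  assumes lip: "L-lipschitz_on UNIV f" and x: "x \<in> cube a s" and s: "0 < s"
  shows "\<bar>avg (cube a s) f - f x\<bar> \<le> L * (real CARD('n) * s)"
proof -
  have cont: "continuous_on UNIV f" using lip by (rule lipschitz_on_continuous_on)
  let ?Q = "cube a s" and ?D = "L * (real CARD('n) * s)"
  have cQ: "compact ?Q" by (simp add: cube_def)
  have V: "measure lborel ?Q = s ^ CARD('n)" using s by (simp add: measure_cube)
  then have Vpos: "measure lborel ?Q > 0" using s by simp
  have int: "integrable lborel (\<lambda>y. indicator ?Q y * f y)"
    by (intro integrable_indicator_continuous cQ cont)
  have intc: "integrable lborel (\<lambda>y. indicator ?Q y * c)" for c :: real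
    by (intro integrable_indicator_continuous cQ continuous_intros)
  have cst: "(\<integral>y. indicator ?Q y * c \<partial>lborel) = measure lborel ?Q * c" for c :: real
    by simp
  have L0: "0 \<le> L" using lip by (rule lipschitz_on_nonneg)
  have bd: "\<bar>f y - f x\<bar> \<le> ?D" if "y \<in> ?Q" for y
  proof -
    have "\<bar>f y - f x\<bar> \<le> L * norm (y - x)" using lipschitz_onD[OF lip, of y x] by (simp add: dist_norm)
    also have "\<dots> \<le> ?D" by (intro mult_left_mono dist_cube_le[OF that x] L0)
    finally show ?thesis .
  qed
  have bd': "f y \<le> f x + ?D" "f x - ?D \<le> f y" if "y \<in> ?Q" for y
    using bd[OF that] by linarith+
  have "(\<integral>y. indicator ?Q y * f y \<partial>lborel) \<le> (\<integral>y. indicator ?Q y * (f x + ?D) \<partial>lborel)"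
    by (intro integral_mono int intc) (use bd' in \<open>auto simp: indicator_def\<close>)
  moreover have "(\<integral>y. indicator ?Q y * (f x - ?D) \<partial>lborel) \<le> (\<integral>y. indicator ?Q y * f y \<partial>lborel)"
    by (intro integral_mono int intc) (use bd' in \<open>auto simp: indicator_def\<close>)
  ultimately have "avg ?Q f \<le> f x + ?D" "f x - ?D \<le> avg ?Q f"
    unfolding cst using Vpos cQ
    by (auto simp: avg_eq_lborel[OF cont] borel_compact pos_divide_le_eq pos_le_divide_eq mult.commute)
  then show ?thesis by linarith
qed

text \<open>\<open>c k\<close> bounds the averages of the partial derivatives over the cube of
  generation \<open>k\<close>. The factor \<open>2 ^ CARD('n)\<close> arises because
  \<open>avg_subcube_le\<close> divides by the volume of the child, while \<open>c k\<close> is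
  normalised by that of the parent.\<close>

lemma avg_oscillation_le:
  fixes f :: "real ^ 'n \<Rightarrow> real"
  assumes lip: "L-lipschitz_on UNIV f" and l: "0 < l" and x: "x \<in> dcell a l 0 (\<lambda>_. 0)"
    and c: "\<And>k i. (\<integral>\<^sup>+x\<in>dcube a l k x. ennreal \<bar>line_deriv f (axis i 1) x\<bar> \<partial>lborel)
        \<le> ennreal (c k * (l / 2 ^ k) ^ CARD('n))" "\<And>k. 0 \<le> c k"
    and B: "\<And>N. (\<Sum>k<N. c k / 2 ^ k) \<le> B"
  shows "\<bar>f x - avg (cube a l) f\<bar> \<le> real CARD('n) * 2 ^ CARD('n) * l * B"
proof -
  let ?n = "CARD('n)"
  let ?C = "real ?n * 2 ^ ?n * l"
  define s where "s k = l / 2 ^ k" for k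
  have s: "0 < s k" "s (Suc k) = s k / 2" for k using l by (auto simp: s_def)
  have step: "\<bar>avg (dcube a l (Suc k) x) f - avg (dcube a l k x) f\<bar> \<le> ?C * (c k / 2 ^ k)" for k
  proof -
    have "\<bar>avg (cube (dcorner a l (Suc k) (dindex a l (Suc k) x)) (s k / 2)) f
        - avg (cube (dcorner a l k (dindex a l k x)) (s k)) f\<bar>
      \<le> real ?n * (c k * s k ^ ?n * (s k / 2) / (s k / 2) ^ ?n)"
      by (rule avg_subcube_le[OF lip s(1)])
        (use dcube_Suc_corner[of a l k x] c s(1)[of k] in \<open>auto simp: s_def\<close>)
    also have "\<dots> = real ?n * (c k * (s k / 2) * 2 ^ ?n)"
      using s(1)[of k] by (simp add: power_divide)
    also have "\<dots> = ?C * (c k / 2 ^ k) / 2" by (simp add: s_def)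
    also have "\<dots> \<le> ?C * (c k / 2 ^ k)"
    proof -
      have half: "X / 2 \<le> X" if "0 \<le> X" for X :: real using that by simp
      show ?thesis by (rule half) (use l c(2)[of k] in simp)
    qed
    finally show ?thesis by (simp add: s_def mult.commute)
  qed
  have sum: "\<bar>avg (dcube a l N x) f - avg (cube a l) f\<bar> \<le> ?C * (\<Sum>k<N. c k / 2 ^ k)" for N
  proof (induction N)
    case 0 show ?case using dcube_0[OF x] by simp
  next
    case (Suc N) then show ?case using step[of N] by (simp add: distrib_left)
  qed
  have "(\<lambda>N. L * (real ?n * s N)) \<longlonglongrightarrow> L * (real ?n * (l * 0))"
    unfolding s_def divide_inverse
    by (intro tendsto_intros LIMSEQ_inverse_realpow_zero) auto
  then have lim: "(\<lambda>N. L * (real ?n * s N) + ?C * B) \<longlonglongrightarrow> 0 + ?C * B"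
    by (intro tendsto_intros) simp
  have "\<bar>f x - avg (cube a l) f\<bar> \<le> L * (real ?n * s N) + ?C * B" for N
  proof -
    have "?C * (\<Sum>k<N. c k / 2 ^ k) \<le> ?C * B" using B[of N] l by (intro mult_left_mono) auto
    moreover have "\<bar>avg (dcube a l N x) f - f x\<bar> \<le> L * (real ?n * s N)"
      using avg_cube_near[OF lip mem_dcube[OF l, of x a N]] l by (simp add: s_def)
    ultimately show ?thesis using sum[of N] by linarith
  qed
  then have "\<bar>f x - avg (cube a l) f\<bar> \<le> 0 + ?C * B"
    by (intro tendsto_lowerbound[OF lim]) auto
  then show ?thesis by simp
qed

text \<open>Every bad point lies in a unique maximal bad cell. These cells are disjoint and make up
  \<open>E\<close>, so the inequality defining badness can be summed over them, with constant 1.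
  Badness is a comparison with a product, not a quotient, so cubes where \<open>h1\<close> has
  integral 0 need no convention.\<close>

lemma dyadic_maximal_weak_type:
  fixes h1 h2 :: "real ^ 'n \<Rightarrow> ennreal" and a :: "real ^ 'n" and t :: ennreal
  assumes l: "0 < l" and [measurable]: "h1 \<in> borel_measurable lebesgue" "h2 \<in> borel_measurable lebesgue"
  defines "E \<equiv> {x \<in> dcell a l 0 (\<lambda>_. 0). \<exists>k.
      t * (\<integral>\<^sup>+y\<in>dcube a l k x. h1 y \<partial>lebesgue) < (\<integral>\<^sup>+y\<in>dcube a l k x. h2 y \<partial>lebesgue)}"
  shows "E \<in> sets lebesgue"
    and "t * (\<integral>\<^sup>+y\<in>E. h1 y \<partial>lebesgue) \<le> (\<integral>\<^sup>+y\<in>cube a l. h2 y \<partial>lebesgue)"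
proof -
  define P where "P k z \<longleftrightarrow> t * (\<integral>\<^sup>+y\<in>cube (dcorner a l k z) (l / 2 ^ k). h1 y \<partial>lebesgue)
      < (\<integral>\<^sup>+y\<in>cube (dcorner a l k z) (l / 2 ^ k). h2 y \<partial>lebesgue)" for k z
  \<comment> \<open>\<open>F x k\<close>: the maximal bad cube containing \<open>x\<close> is the one of generation \<open>k\<close>.\<close>
  define F where "F x k \<longleftrightarrow> x \<in> dcell a l 0 (\<lambda>_. 0) \<and> P k (dindex a l k x) \<and> (\<forall>j<k. \<not> P j (dindex a l j x))" for x k
  \<comment> \<open>Coarser indices are determined by the finer one, so a whole cell shares the same
    maximal bad generation.\<close>
  have F_dep: "F y k" if "F x k" "dindex a l k x = dindex a l k y" for x y k
  proof -
    have "dindex a l j x = dindex a l j y" if "j \<le> k" for j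
      by (rule dindex_nested[OF \<open>dindex a l k x = dindex a l k y\<close> that])
    with that(1) show ?thesis unfolding F_def dcell_def by auto
  qed
  have F_uniq: "k = k'" if "F x k" "F x k'" for x k k'
    using that unfolding F_def by (meson linorder_neqE_nat)
  have E_F: "x \<in> E \<longleftrightarrow> (\<exists>k. F x k)" for x
  proof
    assume "x \<in> E"
    then have "x \<in> dcell a l 0 (\<lambda>_. 0)" "\<exists>k. P k (dindex a l k x)" by (auto simp: E_def P_def)
    then have "F x (LEAST k. P k (dindex a l k x))"
      unfolding F_def by (metis (mono_tags, lifting) LeastI_ex not_less_Least)
    then show "\<exists>k. F x k" ..
  qed (auto simp: E_def F_def P_def)
  define Z where "Z = {(k, z). \<exists>x. F x k \<and> z = dindex a l k x}"
  define D where "D i = dcell a l (fst i) (snd i)" for i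
  have "countable Z" by simp
  have DF: "F y (fst i)" if "i \<in> Z" "y \<in> D i" for y i
  proof -
    from \<open>i \<in> Z\<close> obtain x where "F x (fst i)" "snd i = dindex a l (fst i) x" by (auto simp: Z_def)
    moreover have "dindex a l (fst i) y = snd i" using that(2) by (simp add: D_def dcell_def)
    ultimately show ?thesis using F_dep[of x "fst i" y] by simp
  qed
  have E_eq: "E = (\<Union>i\<in>Z. D i)"
  proof (intro set_eqI iffI)
    fix x assume "x \<in> E"
    then obtain k where "F x k" unfolding E_F ..
    then have "(k, dindex a l k x) \<in> Z" by (auto simp: Z_def)
    moreover have "x \<in> D (k, dindex a l k x)" by (simp add: D_def dcell_def)
    ultimately show "x \<in> (\<Union>i\<in>Z. D i)" by blast
  next
    fix y assume "y \<in> (\<Union>i\<in>Z. D i)"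
    then obtain i where i: "i \<in> Z" "y \<in> D i" by blast
    then show "y \<in> E" unfolding E_F using DF by blast
  qed
  have disj: "disjoint_family_on D Z"
    unfolding disjoint_family_on_def
  proof (intro ballI impI)
    fix i j assume ij: "i \<in> Z" "j \<in> Z" "i \<noteq> j"
    show "D i \<inter> D j = {}"
    proof (rule ccontr)
      assume "D i \<inter> D j \<noteq> {}"
      then obtain y where yD: "y \<in> D i" "y \<in> D j" by blast
      then have y: "dindex a l (fst i) y = snd i" "dindex a l (fst j) y = snd j"
        by (auto simp: D_def dcell_def)
      have "fst i = fst j" using DF[OF ij(1) yD(1)] DF[OF ij(2) yD(2)] by (rule F_uniq)
      with y have "i = j" by (simp add: prod_eq_iff)
      with ij show False by simp
    qed
  qed
  have Dm: "D i \<in> sets lebesgue" for i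
    unfolding D_def by (intro sets_completionI_sets) (simp add: dcell_borel[OF l])
  show Em: "E \<in> sets lebesgue"
    unfolding E_eq using \<open>countable Z\<close> Dm by (intro sets.countable_UN'') auto
  have sum: "(\<integral>\<^sup>+y\<in>E. h y \<partial>lebesgue) = (\<integral>\<^sup>+i. (\<integral>\<^sup>+y\<in>D i. h y \<partial>lebesgue) \<partial>count_space Z)"
    if [measurable]: "h \<in> borel_measurable lebesgue" for h :: "real ^ 'n \<Rightarrow> ennreal"
  proof -
    have "(\<integral>\<^sup>+y\<in>E. h y \<partial>lebesgue) = emeasure (density lebesgue h) E"
      using Em by (simp add: emeasure_density)
    also have "\<dots> = (\<integral>\<^sup>+i. emeasure (density lebesgue h) (D i) \<partial>count_space Z)"
      unfolding E_eq by (intro emeasure_UN_countable \<open>countable Z\<close> disj) (use Dm in auto)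
    finally show ?thesis using Dm by (simp add: emeasure_density)
  qed
  have "t * (\<integral>\<^sup>+y\<in>E. h1 y \<partial>lebesgue) = (\<integral>\<^sup>+i. t * (\<integral>\<^sup>+y\<in>D i. h1 y \<partial>lebesgue) \<partial>count_space Z)"
    by (simp add: sum nn_integral_cmult)
  also have "\<dots> \<le> (\<integral>\<^sup>+i. (\<integral>\<^sup>+y\<in>D i. h2 y \<partial>lebesgue) \<partial>count_space Z)"
  proof (rule nn_integral_mono)
    fix i assume "i \<in> space (count_space Z)"
    then have "P (fst i) (snd i)" by (auto simp: Z_def F_def)
    then show "t * (\<integral>\<^sup>+y\<in>D i. h1 y \<partial>lebesgue) \<le> (\<integral>\<^sup>+y\<in>D i. h2 y \<partial>lebesgue)"
      unfolding P_def D_def by (simp add: nn_integral_dcell_eq_cube[OF l] less_imp_le)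
  qed
  also have "\<dots> = (\<integral>\<^sup>+y\<in>E. h2 y \<partial>lebesgue)" by (simp add: sum)
  also have "\<dots> \<le> (\<integral>\<^sup>+y\<in>cube a l. h2 y \<partial>lebesgue)"
  proof -
    have "E \<subseteq> cube a l"
      unfolding E_def using dcube_subset[OF _ l, of _ a 0] mem_dcube[OF l] by blast
    then show ?thesis by (intro nn_integral_mono) (auto simp: indicator_def)
  qed
  finally show "t * (\<integral>\<^sup>+y\<in>E. h1 y \<partial>lebesgue) \<le> (\<integral>\<^sup>+y\<in>cube a l. h2 y \<partial>lebesgue)" .
qed


section \<open>The weak type inequality\<close>

text \<open>After scaling by the balance point, the terms are at most
  \<open>y k powr (\<sigma> - 1)\<close> and at most \<open>1 / y k\<close>, where \<open>y\<close>
  doubles at each step. Up to the balance point they are dominated by a growing geometric series,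
  beyond it by one of ratio 1/2. The latter contributes the 2, the former the fraction, in which
  \<open>\<sigma>\<close> may be replaced by its lower bound \<open>\<sigma>0\<close>.\<close>

lemma sum_min_geometric_le:
  fixes u v \<sigma> \<sigma>0 :: real
  assumes u: "0 < u" and v: "0 < v" and \<sigma>: "1 < \<sigma>0" "\<sigma>0 \<le> \<sigma>"
  shows "(\<Sum>k<N. min u (v * 2 powr (\<sigma> * real k)) / 2 ^ k)
    \<le> (2 + 1 / (1 - 2 powr (1 - \<sigma>0))) * (u powr (1 - 1 / \<sigma>) * v powr (1 / \<sigma>))"
proof -
  \<comment> \<open>The two arguments of the minimum agree when \<open>2 ^ k = \<tau>\<close>.\<close>
  define \<tau> where "\<tau> = (u / v) powr (1 / \<sigma>)"
  define y where "y k = 2 ^ k / \<tau>" for k :: nat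
  have \<tau>: "0 < \<tau>" using u v by (simp add: \<tau>_def)
  have ypos: "0 < y k" for k using \<tau> by (simp add: y_def)
  have ySuc: "y (Suc k) = 2 * y k" for k by (simp add: y_def)
  have ypowr: "v * 2 powr (\<sigma> * real k) = u * y k powr \<sigma>" for k
  proof -
    have "y k powr \<sigma> = (2 ^ k) powr \<sigma> / \<tau> powr \<sigma>"
      unfolding y_def using \<tau> by (simp add: powr_divide)
    also have "(2 ^ k) powr \<sigma> = (2 :: real) powr (\<sigma> * real k)"
      by (simp add: powr_powr mult.commute flip: powr_realpow)
    also have "\<tau> powr \<sigma> = u / v" unfolding \<tau>_def using u v \<sigma> by (simp add: powr_powr)
    finally show ?thesis using u v by (simp add: field_simps)
  qed
  define \<rho> where "\<rho> = \<sigma> - 1"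
  have \<rho>: "0 < \<rho>" using \<sigma> by (simp add: \<rho>_def)
  have small: "2 powr (1 - \<sigma>) < (1 :: real)" "2 powr (1 - \<sigma>0) < (1 :: real)"
    using \<sigma> powr_less_mono[of "1 - \<sigma>" 0 "2 :: real"] powr_less_mono[of "1 - \<sigma>0" 0 "2 :: real"] by auto
  define D where "D = 1 / (1 - 2 powr (- \<rho>))"
  have D: "0 < D" "D * 2 powr (- \<rho>) + 1 = D"
  proof -
    have "1 / (1 - r) * r + 1 = 1 / (1 - r)" if "r < 1" for r :: real
      using that by (simp add: divide_simps)
    moreover have "2 powr (- \<rho>) < (1 :: real)" using small by (simp add: \<rho>_def)
    ultimately show "0 < D" "D * 2 powr (- \<rho>) + 1 = D" unfolding D_def by auto
  qed
  define b where "b k = min 1 (y k powr \<sigma>) / y k" for k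
  have b1: "b k \<le> 1 / y k" for k unfolding b_def using ypos[of k] by (intro divide_right_mono) auto
  have b2: "b k \<le> y k powr \<rho>" for k
  proof -
    have "b k \<le> y k powr \<sigma> / y k" unfolding b_def using ypos[of k] by (intro divide_right_mono) auto
    also have "\<dots> = y k powr \<rho>" using ypos[of k] by (simp add: \<rho>_def powr_diff)
    finally show ?thesis .
  qed
  \<comment> \<open>If \<open>y N\<close> is at most 2, all terms so far have \<open>y k\<close> at
    most 1, and the bound is a full geometric series ending at \<open>y N / 2\<close>. Afterwards,
    \<open>2 / y N\<close> is the sum of all \<open>1 / y k\<close> still to come, held back from
    the total \<open>D + 2\<close>.\<close>
  have inv: "(y N \<le> 2 \<longrightarrow> (\<Sum>k<N. b k) \<le> D * (y N / 2) powr \<rho>) \<and>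
      (2 < y N \<longrightarrow> (\<Sum>k<N. b k) \<le> D + 2 - 2 / y N)" for N
  proof (induction N)
    case 0
    have "0 \<le> D + 2 - 2 / y 0" if "2 < y 0"
    proof -
      have "2 / y 0 \<le> 1" using that by simp
      with D(1) show ?thesis by linarith
    qed
    then show ?case using D(1) by simp
  next
    case (Suc N)
    let ?S = "\<Sum>k<N. b k"
    consider "y N \<le> 1" | "1 < y N" "y N \<le> 2" | "2 < y N" by linarith
    then show ?case
    proof cases
      case 1
      have "?S + b N \<le> D * (y N / 2) powr \<rho> + y N powr \<rho>" using Suc b2[of N] 1 by auto
      also have "(y N / 2) powr \<rho> = y N powr \<rho> * 2 powr (- \<rho>)"
        using ypos[of N] by (simp add: powr_divide powr_minus_divide)
      also have "D * (y N powr \<rho> * 2 powr (- \<rho>)) + y N powr \<rho> = (D * 2 powr (- \<rho>) + 1) * y N powr \<rho>"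
        by (simp add: algebra_simps)
      finally have "?S + b N \<le> D * y N powr \<rho>" unfolding D(2) .
      with 1 show ?thesis by (simp add: ySuc)
    next
      case 2
      have "(y N / 2) powr \<rho> \<le> 1 powr \<rho>" using 2 \<rho> by (intro powr_mono2) auto
      then have "D * (y N / 2) powr \<rho> \<le> D" using D(1) by simp
      moreover have "1 / y N < 1" using 2 by simp
      moreover have "?S \<le> D * (y N / 2) powr \<rho>" using Suc 2 by simp
      ultimately have "?S + b N \<le> D + 2 - 1 / y N" using b1[of N] by linarith
      with 2 show ?thesis by (simp add: ySuc)
    next
      case 3
      then have "?S + b N \<le> D + 2 - 2 / y N + 1 / y N" using Suc b1[of N] by auto
      also have "\<dots> = D + 2 - 1 / y N" using ypos[of N] by (simp add: field_simps)
      finally show ?thesis using 3 by (simp add: ySuc)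
    qed
  qed
  have "(\<Sum>k<N. b k) \<le> D + 2"
  proof (cases "y N \<le> 2")
    case True
    have "(y N / 2) powr \<rho> \<le> 1 powr \<rho>" using True \<rho> ypos[of N] by (intro powr_mono2) auto
    then have "D * (y N / 2) powr \<rho> \<le> D" using D(1) by simp
    with inv[of N] True show ?thesis by linarith
  next
    case False
    then have "0 \<le> 2 / y N" using ypos[of N] by simp
    with inv[of N] False show ?thesis by linarith
  qed
  also have "D \<le> 1 / (1 - 2 powr (1 - \<sigma>0))"
  proof -
    have "2 powr (- \<rho>) \<le> (2 :: real) powr (1 - \<sigma>0)" using \<sigma> by (intro powr_mono) (auto simp: \<rho>_def)
    then show ?thesis unfolding D_def using small by (intro divide_left_mono mult_pos_pos) (auto simp: \<rho>_def)
  qed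
  finally have S: "(\<Sum>k<N. b k) \<le> 2 + 1 / (1 - 2 powr (1 - \<sigma>0))" by simp
  have "min u (v * 2 powr (\<sigma> * real k)) / 2 ^ k = (u / \<tau>) * b k" for k
  proof -
    have "min u (v * 2 powr (\<sigma> * real k)) = u * min 1 (y k powr \<sigma>)"
      unfolding ypowr using u by (simp add: min_def)
    moreover have "2 ^ k = \<tau> * y k" using \<tau> by (simp add: y_def)
    ultimately show ?thesis by (simp add: b_def)
  qed
  then have "(\<Sum>k<N. min u (v * 2 powr (\<sigma> * real k)) / 2 ^ k) = (u / \<tau>) * (\<Sum>k<N. b k)"
    by (simp add: sum_distrib_left)
  also have "\<dots> \<le> (u / \<tau>) * (2 + 1 / (1 - 2 powr (1 - \<sigma>0)))"
    using S u \<tau> by (intro mult_left_mono) auto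
  also have "u / \<tau> = u powr (1 - 1 / \<sigma>) * v powr (1 / \<sigma>)"
    unfolding \<tau>_def using u v by (simp add: powr_divide powr_diff)
  finally show ?thesis by (simp add: mult.commute)
qed

lemma ennreal_le_divideI:
  assumes "ennreal c * X \<le> ennreal b" "0 < c" "0 \<le> b"
  shows "X \<le> ennreal (b / c)"
proof (cases X)
  case (real r)
  then have "c * r \<le> b" using assms by (simp flip: ennreal_mult)
  with real assms show ?thesis by (simp add: pos_le_divide_eq mult.commute)
next
  case top
  with assms show ?thesis by (simp add: ennreal_mult_top top_unique)
qed

lemma nn_set_integral_mono_set:
  assumes "S \<subseteq> T"
  shows "(\<integral>\<^sup>+x\<in>S. h x \<partial>M) \<le> (\<integral>\<^sup>+x\<in>T. h x \<partial>M)"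
  using assms by (intro nn_integral_mono) (auto simp: indicator_def)

text \<open>The factor in front comes from \<open>avg_oscillation_le\<close>, the bracket from
  \<open>sum_min_geometric_le\<close> with \<open>\<sigma>0 = n / p\<close>, which is what keeps
  \<open>q\<close> out of the constant.\<close>

definition geom_const :: "'n::finite itself \<Rightarrow> real \<Rightarrow> real" where
  "geom_const _ p = real CARD('n) * 2 ^ CARD('n) * (2 + 1 / (1 - 2 powr (1 - real CARD('n) / p)))"

text \<open>The weight enters only through \<open>doubling\<close>, for the A_q condition, and
  \<open>holder\<close>, for the A_p condition, and \<open>g\<close> is any almost everywhere bound
  on the partial derivatives. So the lemma also applies to clamped functions, with \<open>g\<close>
  cut off outside a shell.\<close>

lemma weak_type:
  fixes f g w :: "real ^ 'n \<Rightarrow> real" and a :: "real ^ 'n"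
  assumes lip: "L-lipschitz_on UNIV f" and l: "0 < l"
    and p: "1 \<le> p" "p < real CARD('n)" and q: "1 \<le> q"
    and pw: "1 / p - 1 / pw = 1 / (real CARD('n) * q)"
    and w[measurable]: "w \<in> borel_measurable lebesgue" and g[measurable]: "g \<in> borel_measurable lebesgue"
    and gd: "AE x in lborel. \<forall>i. \<bar>line_deriv f (axis i 1) x\<bar> \<le> g x"
    and W: "(\<integral>\<^sup>+x\<in>cube a l. ennreal (w x) \<partial>lebesgue) = ennreal W" "0 < W"
    and I: "(\<integral>\<^sup>+x\<in>cube a l. ennreal (g x powr p * w x) \<partial>lebesgue) = ennreal I" "0 \<le> I"
    and A: "0 < A" and K: "0 < K"
    and doubling: "\<And>a' s. 0 < s \<Longrightarrow> cube a' s \<subseteq> cube a l \<Longrightarrow>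
      ennreal (W * (s / l) powr (real CARD('n) * q)) \<le> ennreal A * (\<integral>\<^sup>+x\<in>cube a' s. ennreal (w x) \<partial>lebesgue)"
    and holder: "\<And>a' s m i. 0 < s \<Longrightarrow> cube a' s \<subseteq> cube a l \<Longrightarrow> 0 < m \<Longrightarrow> 0 \<le> i \<Longrightarrow>
      (\<integral>\<^sup>+x\<in>cube a' s. ennreal (w x) \<partial>lebesgue) = ennreal m \<Longrightarrow>
      (\<integral>\<^sup>+x\<in>cube a' s. ennreal (g x powr p * w x) \<partial>lebesgue) = ennreal i \<Longrightarrow>
      (\<integral>\<^sup>+x\<in>cube a' s. ennreal (g x) \<partial>lebesgue) \<le> ennreal (K * (i / m) powr (1 / p) * s ^ CARD('n))"
    and t: "0 < t"
  shows "(\<integral>\<^sup>+x\<in>{x\<in>cube a l. t < \<bar>f x - avg (cube a l) f\<bar>}. ennreal (w x) \<partial>lebesgue)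
    \<le> ennreal (W * (geom_const TYPE('n) p * l * K * A powr (1 / (real CARD('n) * q)) * (I / W) powr (1 / p) / t) powr pw)"
proof -
  let ?n = "real CARD('n)"
  define \<sigma> where "\<sigma> = ?n * q / p"
  define H where "H = dcell a l 0 (\<lambda>_. 0)"
  have nq: "p < ?n * q" using p q by (smt (verit) mult_le_cancel_left1)
  have \<sigma>: "1 < ?n / p" "?n / p \<le> \<sigma>" using p q by (auto simp: \<sigma>_def field_simps)
  define C1 where "C1 = 2 + 1 / (1 - 2 powr (1 - ?n / p))"
  have "2 powr (1 - ?n / p) < (1 :: real)" using \<sigma> powr_less_mono[of "1 - ?n / p" 0 "2 :: real"] by auto
  then have C1: "0 < C1" by (simp add: C1_def add_pos_pos)
  define M where "M = ?n * 2 ^ CARD('n) * l * (K * C1)"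
  have M: "0 < M" using l K C1 by (simp add: M_def)
  define mk where "mk x k = enn2real (\<integral>\<^sup>+y\<in>dcube a l k x. ennreal (w y) \<partial>lebesgue)" for x k
  define ik where "ik x k = enn2real (\<integral>\<^sup>+y\<in>dcube a l k x. ennreal (g y powr p * w y) \<partial>lebesgue)" for x k
  have sub: "dcube a l k x \<subseteq> cube a l" if "x \<in> H" for x k
    using dcube_subset[OF _ l] that by (simp add: H_def)
  have mk: "(\<integral>\<^sup>+y\<in>dcube a l k x. ennreal (w y) \<partial>lebesgue) = ennreal (mk x k)"
    and ik: "(\<integral>\<^sup>+y\<in>dcube a l k x. ennreal (g y powr p * w y) \<partial>lebesgue) = ennreal (ik x k)"
    and ikI: "ik x k \<le> I" if "x \<in> H" for x k
  proof -
    note le = nn_set_integral_mono_set[OF sub[OF that], of lebesgue _ k]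
    show "(\<integral>\<^sup>+y\<in>dcube a l k x. ennreal (w y) \<partial>lebesgue) = ennreal (mk x k)"
      using le[of "\<lambda>y. ennreal (w y)"] W unfolding mk_def by (simp add: le_less_trans less_top)
    show ik: "(\<integral>\<^sup>+y\<in>dcube a l k x. ennreal (g y powr p * w y) \<partial>lebesgue) = ennreal (ik x k)"
      using le[of "\<lambda>y. ennreal (g y powr p * w y)"] I unfolding ik_def by (simp add: le_less_trans less_top)
    show "ik x k \<le> I"
      using le[of "\<lambda>y. ennreal (g y powr p * w y)"] I ik by simp
  qed
  have ik0: "0 \<le> ik x k" for x k by (simp add: ik_def)
  have dbl: "W * 2 powr (- (?n * q) * real k) \<le> A * mk x k" if "x \<in> H" for x k
  proof -
    have "ennreal (W * ((l / 2 ^ k) / l) powr (?n * q)) \<le> ennreal A * ennreal (mk x k)"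
      unfolding mk[OF that, symmetric] by (rule doubling[OF _ sub[OF that]]) (use l in simp)
    also have "\<dots> = ennreal (A * mk x k)" using A by (simp add: ennreal_mult mk_def)
    finally have "W * ((l / 2 ^ k) / l) powr (?n * q) \<le> A * mk x k"
      using A by (subst (asm) ennreal_le_iff) (auto simp: mk_def)
    moreover have "((l / 2 ^ k) / l) powr (?n * q) = 2 powr (- (?n * q) * real k)"
    proof -
      have "(l / 2 ^ k) / l = 2 powr (- real k)" using l by (simp add: powr_minus_divide powr_realpow)
      then show ?thesis by (simp add: powr_powr mult.commute)
    qed
    ultimately show ?thesis by simp
  qed
  have mpos: "0 < mk x k" if "x \<in> H" for x k
  proof -
    have "0 < W * 2 powr (- (?n * q) * real k)" using W by simp
    with dbl[OF that, of k] have "0 < A * mk x k" by linarith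
    with A show ?thesis by (simp add: zero_less_mult_iff)
  qed
  have lderiv: "(\<integral>\<^sup>+y\<in>dcube a l k x. ennreal \<bar>line_deriv f (axis i 1) y\<bar> \<partial>lborel)
      \<le> ennreal (K * (ik x k / mk x k) powr (1 / p) * (l / 2 ^ k) ^ CARD('n))" if "x \<in> H" for x k i
  proof -
    have "(\<integral>\<^sup>+y\<in>dcube a l k x. ennreal \<bar>line_deriv f (axis i 1) y\<bar> \<partial>lborel)
        \<le> (\<integral>\<^sup>+y\<in>dcube a l k x. ennreal (g y) \<partial>lborel)"
      using gd by (intro nn_integral_mono_AE) (auto elim!: eventually_mono simp: indicator_def intro!: ennreal_leI)
    also have "\<dots> = (\<integral>\<^sup>+y\<in>dcube a l k x. ennreal (g y) \<partial>lebesgue)"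
      by (simp add: nn_integral_completion)
    also have "\<dots> \<le> ennreal (K * (ik x k / mk x k) powr (1 / p) * (l / 2 ^ k) ^ CARD('n))"
      by (rule holder[OF _ sub[OF that] mpos[OF that] ik0 mk[OF that] ik[OF that]]) (use l in simp)
    finally show ?thesis .
  qed
  have nullH: "AE x in lebesgue. x \<in> cube a l \<longrightarrow> x \<in> H"
  proof -
    have "dcorner a l 0 (\<lambda>_. 0) = a" by (simp add: dcorner_def vec_eq_iff)
    then have "negligible (cube a l - H)"
      using negligible_cube_diff_dcell[OF l, of a 0 "\<lambda>_. 0"] by (simp add: H_def)
    then have "AE x in lebesgue. x \<notin> cube a l - H"
      unfolding negligible_iff_null_sets by (rule AE_not_in)
    then show ?thesis by eventually_elim auto
  qed
  have pw0: "1 / pw > 0"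
  proof -
    have "1 / (?n * q) < 1 / p" using nq p by (intro divide_strict_left_mono) auto
    with pw show ?thesis by linarith
  qed
  then have pwpos: "0 < pw" by simp
  show ?thesis
  \<comment> \<open>For \<open>I = 0\<close> the level \<open>\<kappa>\<close> of the other case
    would degenerate, since \<open>V\<close> would be 0. Here all bounds on the averages vanish, so
    \<open>f\<close> equals its average on \<open>H\<close>.\<close>
  proof (cases "I = 0")
    case True
    have "\<bar>f x - avg (cube a l) f\<bar> \<le> 0" if "x \<in> H" for x
    proof -
      have "ik x k = 0" for k using ikI[OF that, of k] ik0[of x k] True by simp
      then have "\<bar>f x - avg (cube a l) f\<bar> \<le> ?n * 2 ^ CARD('n) * l * 0"
        using that lderiv[OF that] p
        by (intro avg_oscillation_le[OF lip l, where c = "\<lambda>_. 0"]) (auto simp: H_def)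
      then show ?thesis by simp
    qed
    then have z: "x \<notin> {x \<in> cube a l. t < \<bar>f x - avg (cube a l) f\<bar>}" if "x \<in> H" for x
      using that t by force
    have "(\<integral>\<^sup>+x\<in>{x\<in>cube a l. t < \<bar>f x - avg (cube a l) f\<bar>}. ennreal (w x) \<partial>lebesgue)
      = (\<integral>\<^sup>+x. 0 \<partial>(lebesgue :: (real ^ 'n) measure))"
    proof (rule nn_integral_cong_AE)
      show "AE x in lebesgue. ennreal (w x) * indicator {x\<in>cube a l. t < \<bar>f x - avg (cube a l) f\<bar>} x = 0"
        using nullH
      proof eventually_elim
        fix x assume "x \<in> cube a l \<longrightarrow> x \<in> H"
        then have "x \<notin> {x\<in>cube a l. t < \<bar>f x - avg (cube a l) f\<bar>}" using z by blast
        then show "ennreal (w x) * indicator {x\<in>cube a l. t < \<bar>f x - avg (cube a l) f\<bar>} x = 0" by simp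
      qed
    qed
    then show ?thesis by simp
  next
    case False
    then have Ipos: "0 < I" using I by simp
    \<comment> \<open>The bound at generation 0: a weighted mean over generation \<open>k\<close>
      has numerator at most \<open>I\<close> and, by \<open>dbl\<close>, denominator at least
      \<open>W * 2 powr (- n * q * k) / A\<close>.\<close>
    define v where "v = (A * I / W) powr (1 / p)"
    have v: "0 < v" using A Ipos W by (simp add: v_def)
    define V where "V = v powr (1 / \<sigma>)"
    have V: "0 < V" using v by (simp add: V_def)
    \<comment> \<open>The level for which the bound on the oscillation off the exceptional set is exactly \<open>t\<close>.\<close>
    define \<kappa> where "\<kappa> = (t / (M * V)) powr pw"
    have \<kappa>: "0 < \<kappa>" using t M V by (simp add: \<kappa>_def)
    define u where "u = \<kappa> powr (1 / p)"
    have u: "0 < u" using \<kappa> by (simp add: u_def)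
    define E where "E = {x \<in> H. \<exists>k. ennreal \<kappa> * (\<integral>\<^sup>+y\<in>dcube a l k x. ennreal (w y) \<partial>lebesgue)
        < (\<integral>\<^sup>+y\<in>dcube a l k x. ennreal (g y powr p * w y) \<partial>lebesgue)}"
    \<comment> \<open>Here the definition of \<open>pw\<close> enters: it turns the power of
      \<open>u\<close> in the summed bound into \<open>\<kappa> powr (1 / pw)\<close>, so that
      \<open>\<kappa>\<close> can be solved for.\<close>
    have expo: "1 - 1 / \<sigma> = p / pw"
    proof -
      have "1 / \<sigma> = p * (1 / (?n * q))" by (simp add: \<sigma>_def)
      also have "\<dots> = 1 - p / pw" unfolding pw[symmetric] using p by (simp add: field_simps)
      finally show ?thesis by simp
    qed
    have ut: "M * (u powr (1 - 1 / \<sigma>) * V) = t"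
    proof -
      have "u powr (1 - 1 / \<sigma>) = \<kappa> powr (1 / pw)"
        unfolding expo u_def using p by (simp add: powr_powr)
      also have "\<dots> = t / (M * V)" unfolding \<kappa>_def using pwpos t M V by (simp add: powr_powr)
      finally show ?thesis using M V by simp
    qed
    have good: "\<bar>f x - avg (cube a l) f\<bar> \<le> t" if "x \<in> H" "x \<notin> E" for x
    proof -
      define c where "c k = K * min u (v * 2 powr (\<sigma> * real k))" for k
      have ck: "K * (ik x k / mk x k) powr (1 / p) \<le> c k" for k
      proof -
        have "\<not> ennreal \<kappa> * ennreal (mk x k) < ennreal (ik x k)"
          using that mk[OF that(1)] ik[OF that(1)] by (auto simp: E_def)
        then have "ennreal (ik x k) \<le> ennreal (\<kappa> * mk x k)"
          using \<kappa> by (simp add: not_less ennreal_mult mk_def)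
        then have "ik x k \<le> \<kappa> * mk x k"
          using \<kappa> by (subst (asm) ennreal_le_iff) (auto simp: mk_def)
        then have le1: "ik x k / mk x k \<le> \<kappa>"
          using mpos[OF that(1), of k] by (simp add: pos_divide_le_eq)
        have lb: "W * 2 powr (- (?n * q) * real k) / A \<le> mk x k"
          using dbl[OF that(1), of k] A by (simp add: pos_divide_le_eq mult.commute)
        have "ik x k / mk x k \<le> I / (W * 2 powr (- (?n * q) * real k) / A)"
          using ikI[OF that(1)] ik0 lb W A I(2) by (intro frac_le) auto
        also have "\<dots> = (A * I / W) * 2 powr (?n * q * real k)"
          using W A by (simp add: powr_minus field_simps)
        finally have le2: "ik x k / mk x k \<le> (A * I / W) * 2 powr (?n * q * real k)" .
        have "(ik x k / mk x k) powr (1 / p) \<le> u"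
          unfolding u_def using le1 p ik0[of x k] mpos[OF that(1), of k] by (intro powr_mono2) auto
        moreover have "(ik x k / mk x k) powr (1 / p) \<le> v * 2 powr (\<sigma> * real k)"
        proof -
          have "(ik x k / mk x k) powr (1 / p) \<le> ((A * I / W) * 2 powr (?n * q * real k)) powr (1 / p)"
            using le2 p ik0[of x k] mpos[OF that(1), of k] by (intro powr_mono2) auto
          also have "\<dots> = v * 2 powr (\<sigma> * real k)"
            unfolding v_def \<sigma>_def using A Ipos W by (subst powr_mult) (auto simp: powr_powr)
          finally show ?thesis .
        qed
        ultimately show ?thesis unfolding c_def using K by simp
      qed
      have c0: "0 \<le> c k" for k unfolding c_def using K u v by simp
      have "(\<Sum>k<N. c k / 2 ^ k) \<le> K * C1 * (u powr (1 - 1 / \<sigma>) * V)" for N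
      proof -
        have "(\<Sum>k<N. c k / 2 ^ k) = K * (\<Sum>k<N. min u (v * 2 powr (\<sigma> * real k)) / 2 ^ k)"
          by (simp add: c_def sum_distrib_left)
        also have "\<dots> \<le> K * (C1 * (u powr (1 - 1 / \<sigma>) * V))"
          unfolding C1_def V_def using K by (intro mult_left_mono sum_min_geometric_le u v \<sigma>) auto
        finally show ?thesis by (simp add: mult.assoc)
      qed
      then have "\<bar>f x - avg (cube a l) f\<bar> \<le> ?n * 2 ^ CARD('n) * l * (K * C1 * (u powr (1 - 1 / \<sigma>) * V))"
        using that(1) c0 order_trans[OF lderiv[OF that(1)] ennreal_leI[OF mult_right_mono[OF ck]]] l
        by (intro avg_oscillation_le[OF lip l, where c = c]) (auto simp: H_def)
      also have "\<dots> = t" unfolding ut[symmetric] M_def by (simp only: mult.assoc)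
      finally show ?thesis .
    qed
    have Em: "E \<in> sets lebesgue"
      and Emax: "ennreal \<kappa> * (\<integral>\<^sup>+y\<in>E. ennreal (w y) \<partial>lebesgue) \<le> (\<integral>\<^sup>+y\<in>cube a l. ennreal (g y powr p * w y) \<partial>lebesgue)"
      unfolding E_def H_def by (rule dyadic_maximal_weak_type[OF l]; measurable)+
    have "(\<integral>\<^sup>+x\<in>{x\<in>cube a l. t < \<bar>f x - avg (cube a l) f\<bar>}. ennreal (w x) \<partial>lebesgue)
        \<le> (\<integral>\<^sup>+y\<in>E. ennreal (w y) \<partial>lebesgue)"
    proof (rule nn_integral_mono_AE)
      show "AE x in lebesgue. ennreal (w x) * indicator {x\<in>cube a l. t < \<bar>f x - avg (cube a l) f\<bar>} x
          \<le> ennreal (w x) * indicator E x"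
        using nullH
      proof eventually_elim
        fix x assume x: "x \<in> cube a l \<longrightarrow> x \<in> H"
        have "x \<in> E" if "x \<in> {x\<in>cube a l. t < \<bar>f x - avg (cube a l) f\<bar>}"
        proof (rule ccontr)
          assume "x \<notin> E"
          with good[of x] x that show False by simp
        qed
        then show "ennreal (w x) * indicator {x\<in>cube a l. t < \<bar>f x - avg (cube a l) f\<bar>} x
            \<le> ennreal (w x) * indicator E x"
          by (auto simp: indicator_def)
      qed
    qed
    also have "\<dots> \<le> ennreal (I / \<kappa>)"
      using Emax \<kappa> I by (intro ennreal_le_divideI) auto
    also have "I / \<kappa> = W * (geom_const TYPE('n) p * l * K * A powr (1 / (?n * q)) * (I / W) powr (1 / p) / t) powr pw"
    proof -
      define r where "r = I / W"
      have r: "0 < r" using Ipos W by (simp add: r_def)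
      have V_eq: "V = A powr (1 / (?n * q)) * r powr (1 / (?n * q))"
      proof -
        have "V = (A * r) powr (1 / p * (1 / \<sigma>))" by (simp add: V_def v_def r_def powr_powr)
        also have "1 / p * (1 / \<sigma>) = 1 / (?n * q)" using p by (simp add: \<sigma>_def)
        finally show ?thesis using A r by (simp add: powr_mult)
      qed
      have G_M: "geom_const TYPE('n) p * l * K = M"
        by (simp add: geom_const_def M_def C1_def mult_ac)
      \<comment> \<open>Of the exponent \<open>1 / p\<close>, the part \<open>1 / (n * q)\<close> is
        absorbed by \<open>V\<close>; the part \<open>1 / pw\<close> turns into \<open>r\<close>
        itself under the power \<open>pw\<close>.\<close>
      have "r powr (1 / p) = r powr (1 / (?n * q)) * r powr (1 / pw)"
        unfolding pw[symmetric] by (simp flip: powr_add)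
      then have "geom_const TYPE('n) p * l * K * A powr (1 / (?n * q)) * r powr (1 / p) / t
          = r powr (1 / pw) / (t / (M * V))"
        unfolding G_M V_eq by simp
      also have "\<dots> powr pw = (r powr (1 / pw)) powr pw / \<kappa>"
        unfolding \<kappa>_def using t M V by (subst powr_divide) auto
      also have "(r powr (1 / pw)) powr pw = r" using r pwpos by (simp add: powr_powr)
      finally show ?thesis using W by (simp add: r_def)
    qed
    finally show ?thesis .
  qed
qed


section \<open>Truncation\<close>

text \<open>Clamping the deviation from \<open>c\<close> rather than the value treats both signs at
  once.\<close>

definition clamp_dev :: "real \<Rightarrow> real \<Rightarrow> real \<Rightarrow> real \<Rightarrow> real" where
  "clamp_dev c s t y = min (max \<bar>y - c\<bar> s) t"

lemma clamp_dev_lipschitz: "\<bar>clamp_dev c s t y - clamp_dev c s t z\<bar> \<le> \<bar>y - z\<bar>"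
  unfolding clamp_dev_def by linarith

lemma clamp_dev_lipschitz_on:
  assumes "L-lipschitz_on UNIV f"
  shows "L-lipschitz_on UNIV (\<lambda>x. clamp_dev c s t (f x))"
proof (rule lipschitz_onI)
  fix x y
  show "dist (clamp_dev c s t (f x)) (clamp_dev c s t (f y)) \<le> L * dist x y"
    using clamp_dev_lipschitz[of c s t "f x" "f y"] lipschitz_onD[OF assms, of x y]
    unfolding dist_real_def by simp
qed (use assms in \<open>rule lipschitz_on_nonneg\<close>)

lemma line_derivative_clamp_dev_le:
  fixes f :: "'a::real_normed_vector \<Rightarrow> real"
  assumes D: "((\<lambda>r. f (x + r *\<^sub>R e)) has_field_derivative D) (at 0)"
    and D': "((\<lambda>r. clamp_dev c s t (f (x + r *\<^sub>R e))) has_field_derivative D') (at 0)"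
  shows "\<bar>D'\<bar> \<le> \<bar>D\<bar>"
proof (rule tendsto_le[of "at (0::real)"])
  show "((\<lambda>h. \<bar>(f (x + h *\<^sub>R e) - f x) / h\<bar>) \<longlongrightarrow> \<bar>D\<bar>) (at 0)"
    using D unfolding DERIV_def by (intro tendsto_rabs) simp
  show "((\<lambda>h. \<bar>(clamp_dev c s t (f (x + h *\<^sub>R e)) - clamp_dev c s t (f x)) / h\<bar>) \<longlongrightarrow> \<bar>D'\<bar>) (at 0)"
    using D' unfolding DERIV_def by (intro tendsto_rabs) simp
  show "\<forall>\<^sub>F h in at 0. \<bar>(clamp_dev c s t (f (x + h *\<^sub>R e)) - clamp_dev c s t (f x)) / h\<bar>
      \<le> \<bar>(f (x + h *\<^sub>R e) - f x) / h\<bar>"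
    unfolding abs_divide by (intro always_eventually allI divide_right_mono clamp_dev_lipschitz) auto
qed simp

text \<open>Where the clamp is active, the clamped function attains a global extremum.\<close>

lemma line_derivative_clamp_dev_eq_0:
  fixes f :: "'a::real_normed_vector \<Rightarrow> real"
  assumes D': "((\<lambda>r. clamp_dev c s t (f (x + r *\<^sub>R e))) has_field_derivative D') (at 0)"
    and "s \<le> t" and "\<bar>f x - c\<bar> \<le> s \<or> t \<le> \<bar>f x - c\<bar>"
  shows "D' = 0"
  using assms(3)
proof
  assume "\<bar>f x - c\<bar> \<le> s"
  then show ?thesis
    using \<open>s \<le> t\<close> by (intro DERIV_local_min[OF D', of 1]) (auto simp: clamp_dev_def)
next
  assume "t \<le> \<bar>f x - c\<bar>"
  then show ?thesis
    using \<open>s \<le> t\<close> by (intro DERIV_local_max[OF D', of 1]) (auto simp: clamp_dev_def)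
qed

text \<open>The derivative vanishes on the two boundary levels as well, as they are extremal for the
  clamp. So the condition is strict on both sides, and shells between consecutive levels are
  disjoint.\<close>

lemma AE_line_deriv_clamp_dev_le:
  fixes f g :: "real ^ 'n \<Rightarrow> real"
  assumes lip: "L-lipschitz_on UNIV f" and "s \<le> t"
    and gd: "AE x in lborel. \<forall>i. \<bar>line_deriv f (axis i 1) x\<bar> \<le> g x"
  shows "AE x in lborel. \<forall>i. \<bar>line_deriv (\<lambda>x. clamp_dev c s t (f x)) (axis i 1) x\<bar>
      \<le> (if s < \<bar>f x - c\<bar> \<and> \<bar>f x - c\<bar> < t then g x else 0)"
proof -
  let ?h = "\<lambda>x. clamp_dev c s t (f x)"
  have 1: "AE x in lborel. \<forall>i. ((\<lambda>r. f (x + r *\<^sub>R axis i 1)) has_field_derivative line_deriv f (axis i 1) x) (at 0)"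
    unfolding AE_all_countable by (intro allI AE_line_derivative[OF lip]) (simp add: norm_axis_1)
  have 2: "AE x in lborel. \<forall>i. ((\<lambda>r. ?h (x + r *\<^sub>R axis i 1)) has_field_derivative line_deriv ?h (axis i 1) x) (at 0)"
    unfolding AE_all_countable
    by (intro allI AE_line_derivative[OF clamp_dev_lipschitz_on[OF lip]]) (simp add: norm_axis_1)
  show ?thesis
    using 1 2 gd
  proof eventually_elim
    case (elim x)
    show ?case
    proof
      fix i
      have "\<bar>line_deriv ?h (axis i 1) x\<bar> \<le> \<bar>line_deriv f (axis i 1) x\<bar>"
        using line_derivative_clamp_dev_le elim by blast
      also have "\<dots> \<le> g x" using elim by blast
      finally have le: "\<bar>line_deriv ?h (axis i 1) x\<bar> \<le> g x" .
      have "line_deriv ?h (axis i 1) x = 0" if "\<not> (s < \<bar>f x - c\<bar> \<and> \<bar>f x - c\<bar> < t)"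
        using line_derivative_clamp_dev_eq_0[of c s t f x "axis i 1" "line_deriv ?h (axis i 1) x"] elim that \<open>s \<le> t\<close>
        by (auto simp: not_less)
      with le show "\<bar>line_deriv ?h (axis i 1) x\<bar>
          \<le> (if s < \<bar>f x - c\<bar> \<and> \<bar>f x - c\<bar> < t then g x else 0)" by simp
    qed
  qed
qed

lemma ennreal_eq_0_if_le_all:
  assumes "\<And>\<delta>. 0 < \<delta> \<Longrightarrow> X \<le> ennreal \<delta>"
  shows "X = 0"
proof (cases X)
  case (real r)
  show ?thesis
  proof (rule ccontr)
    assume "X \<noteq> 0"
    then have "0 < r" using real by (auto simp: ennreal_eq_0_iff)
    then show False using assms[of "r / 2"] real by simp
  qed
qed (use assms[of 1] in \<open>simp add: top_unique\<close>)

text \<open>\<open>holder\<close> is assumed for every \<open>u\<close> because it is applied to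
  \<open>g\<close> cut off to each shell. The shell integrals \<open>J k\<close> appear with the
  power \<open>pw / p > 1\<close>, and such powers add up to at most the same power of the
  total.\<close>

lemma strong_type:
  fixes f g w :: "real ^ 'n \<Rightarrow> real" and a :: "real ^ 'n"
  assumes lip: "L-lipschitz_on UNIV f" and l: "0 < l"
    and p: "1 \<le> p" "p < real CARD('n)" and q: "1 \<le> q"
    and pw: "1 / p - 1 / pw = 1 / (real CARD('n) * q)"
    and w[measurable]: "w \<in> borel_measurable lebesgue" and w0: "\<And>x. 0 \<le> w x"
    and g[measurable]: "g \<in> borel_measurable lebesgue" and g0: "\<And>x. 0 \<le> g x"
    and gd: "AE x in lborel. \<forall>i. \<bar>line_deriv f (axis i 1) x\<bar> \<le> g x"
    and W: "(\<integral>\<^sup>+x\<in>cube a l. ennreal (w x) \<partial>lebesgue) = ennreal W" "0 < W"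
    and I: "(\<integral>\<^sup>+x\<in>cube a l. ennreal (g x powr p * w x) \<partial>lebesgue) = ennreal I" "0 \<le> I"
    and A: "0 < A" and K: "0 < K"
    and doubling: "\<And>a' s. 0 < s \<Longrightarrow> cube a' s \<subseteq> cube a l \<Longrightarrow>
      ennreal (W * (s / l) powr (real CARD('n) * q)) \<le> ennreal A * (\<integral>\<^sup>+x\<in>cube a' s. ennreal (w x) \<partial>lebesgue)"
    and holder: "\<And>u a' s m i. u \<in> borel_measurable lebesgue \<Longrightarrow> (\<And>x. 0 \<le> u x) \<Longrightarrow>
      0 < s \<Longrightarrow> cube a' s \<subseteq> cube a l \<Longrightarrow> 0 < m \<Longrightarrow> 0 \<le> i \<Longrightarrow>
      (\<integral>\<^sup>+x\<in>cube a' s. ennreal (w x) \<partial>lebesgue) = ennreal m \<Longrightarrow>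
      (\<integral>\<^sup>+x\<in>cube a' s. ennreal (u x powr p * w x) \<partial>lebesgue) = ennreal i \<Longrightarrow>
      (\<integral>\<^sup>+x\<in>cube a' s. ennreal (u x) \<partial>lebesgue) \<le> ennreal (K * (i / m) powr (1 / p) * s ^ CARD('n))"
  defines "B \<equiv> geom_const TYPE('n) p * l * K * A powr (1 / (real CARD('n) * q))"
  shows "(\<integral>\<^sup>+x\<in>cube a l. ennreal (\<bar>f x - avg (cube a l) f\<bar> powr pw * w x) \<partial>lebesgue)
    \<le> ennreal (W * (16 * B * (I / W) powr (1 / p)) powr pw)"
proof -
  let ?n = "real CARD('n)"
  let ?Q = "cube a l"
  define c where "c = avg ?Q f"
  define F where "F x = \<bar>f x - c\<bar>" for x
  have fm: "f \<in> borel_measurable borel"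
    using lipschitz_on_continuous_on[OF lip] by (rule borel_measurable_continuous_onI)
  then have [measurable]: "f \<in> borel_measurable lebesgue"
    by (intro measurable_completion) simp
  have [measurable]: "F \<in> borel_measurable lebesgue" unfolding F_def by measurable
  have Qb: "?Q \<in> sets borel" by (simp add: cube_def)
  then have [measurable]: "?Q \<in> sets lebesgue" by (intro sets_completionI_sets) simp
  have nq: "p < ?n * q" using p q by (smt (verit) mult_le_cancel_left1)
  have pw_gt: "p < pw"
  proof -
    have "1 / (?n * q) < 1 / p" using nq p by (intro divide_strict_left_mono) auto
    then have "0 < 1 / pw" using pw by linarith
    moreover have "0 < 1 / (?n * q)" using nq p by simp
    then have "1 / pw < 1 / p" using pw by linarith
    ultimately show ?thesis using p by (simp add: field_simps)
  qed
  have pw1: "1 < pw" using pw_gt p by simp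
  have "2 powr (1 - ?n / p) < (1 :: real)"
    using p powr_less_mono[of "1 - ?n / p" 0 "2 :: real"] by auto
  then have B: "0 < B"
    unfolding B_def geom_const_def using l K A by (intro mult_pos_pos add_pos_pos) auto
  define \<nu> where "\<nu> S = (\<integral>\<^sup>+x\<in>S. ennreal (w x) \<partial>lebesgue)" for S
  have \<nu>_mono: "\<nu> S \<le> \<nu> T" if "S \<subseteq> T" for S T
    unfolding \<nu>_def by (rule nn_set_integral_mono_set[OF that])
  define G where "G = (I / W) powr (1 / p)"
  define g' where "g' s t x = (if s < F x \<and> F x < t then g x else 0)" for s t x
  define Ik where "Ik s t = enn2real (\<integral>\<^sup>+x\<in>?Q. ennreal (g' s t x powr p * w x) \<partial>lebesgue)" for s t
  have g'm[measurable]: "g' s t \<in> borel_measurable lebesgue" for s t unfolding g'_def by measurable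
  have Ik: "(\<integral>\<^sup>+x\<in>?Q. ennreal (g' s t x powr p * w x) \<partial>lebesgue) = ennreal (Ik s t)" for s t
  proof -
    have "(\<integral>\<^sup>+x\<in>?Q. ennreal (g' s t x powr p * w x) \<partial>lebesgue) \<le> ennreal I"
      unfolding I(1)[symmetric] by (intro nn_integral_mono) (auto simp: g'_def indicator_def w0 intro!: ennreal_leI)
    then show ?thesis unfolding Ik_def by (simp add: le_less_trans less_top)
  qed
  have Ik0: "0 \<le> Ik s t" for s t by (simp add: Ik_def)
  \<comment> \<open>The average \<open>b\<close> of the clamped function lies on one side of the
    midpoint of \<open>s\<close> and \<open>t\<close>. On one of the two sets the function is
    constant at the opposite end, at distance at least \<open>(t - s) / 2\<close> from
    \<open>b\<close>; the 3 leaves room for strictness.\<close>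
  have level: "min (\<nu> {x\<in>?Q. t \<le> F x}) (\<nu> {x\<in>?Q. F x \<le> s})
      \<le> ennreal (W * (3 * B * (Ik s t / W) powr (1 / p) / (t - s)) powr pw)" if st: "s < t" for s t
  proof -
    define h where "h x = clamp_dev c s t (f x)" for x
    define b where "b = avg ?Q h"
    let ?S = "{x\<in>?Q. (t - s) / 3 < \<bar>h x - b\<bar>}"
    have lips: "L-lipschitz_on UNIV h" unfolding h_def by (rule clamp_dev_lipschitz_on[OF lip])
    have gdh: "AE x in lborel. \<forall>i. \<bar>line_deriv h (axis i 1) x\<bar> \<le> g' s t x"
      using AE_line_deriv_clamp_dev_le[OF lip less_imp_le[OF st] gd, of c] unfolding h_def[abs_def] g'_def F_def .
    have "\<nu> ?S \<le> ennreal (W * (B * (Ik s t / W) powr (1 / p) / ((t - s) / 3)) powr pw)"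
      unfolding \<nu>_def b_def B_def
      by (rule weak_type[OF lips l p q pw w g'm gdh W Ik Ik0 A K doubling holder[OF g'm]])
        (use st g0 in \<open>auto simp: g'_def\<close>)
    moreover have "min (\<nu> {x\<in>?Q. t \<le> F x}) (\<nu> {x\<in>?Q. F x \<le> s}) \<le> \<nu> ?S"
    proof (cases "(s + t) / 2 \<le> b")
      case True
      have "{x\<in>?Q. F x \<le> s} \<subseteq> ?S"
        using True st by (auto simp: h_def clamp_dev_def F_def)
      then show ?thesis using \<nu>_mono by (meson min.coboundedI2)
    next
      case False
      have "{x\<in>?Q. t \<le> F x} \<subseteq> ?S"
        using False st by (auto simp: h_def clamp_dev_def F_def)
      then show ?thesis using \<nu>_mono by (meson min.coboundedI1)
    qed
    ultimately show ?thesis by (simp add: mult_ac)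
  qed
  \<comment> \<open>The lower bound on \<open>t0\<close> makes the weak inequality give the set
    above \<open>t0\<close> at most half of the weight. Otherwise \<open>t0\<close> stays free: if
    \<open>I = 0\<close>, it is sent to 0.\<close>
  have main: "(\<integral>\<^sup>+x\<in>?Q. ennreal (F x powr pw * w x) \<partial>lebesgue)
      \<le> ennreal (W * ((2 * t0) powr pw + (12 * B * G) powr pw))"
    if t0: "0 < t0" "2 * B * G \<le> t0" for t0
  proof -
    define \<tau> where "\<tau> k = 2 ^ k * t0" for k :: nat
    have \<tau>: "0 < \<tau> k" "\<tau> (Suc k) = 2 * \<tau> k" "t0 \<le> \<tau> k" for k using t0 by (auto simp: \<tau>_def)
    have \<nu>Q: "\<nu> ?Q = ennreal W" unfolding \<nu>_def by (rule W)
    have half: "\<nu> {x\<in>?Q. t0 < F x} \<le> ennreal (W / 2)"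
    proof -
      have "\<nu> {x\<in>?Q. t0 < F x} \<le> ennreal (W * (B * G / t0) powr pw)"
        unfolding \<nu>_def F_def c_def B_def G_def
        by (rule weak_type[OF lip l p q pw w g gd W I A K doubling holder[OF g g0] t0(1)])
      also have "(B * G / t0) powr pw \<le> (1 / 2) powr pw"
        using t0 B pw1 by (intro powr_mono2) (auto simp: G_def pos_divide_le_eq)
      also have "(1 / 2) powr pw \<le> (1 / 2 :: real) powr 1" using pw1 by (intro powr_mono') auto
      finally show ?thesis using W by (simp add: ennreal_leI mult_left_mono)
    qed
    have half': "ennreal (W / 2) \<le> \<nu> {x\<in>?Q. F x \<le> t0}"
    proof -
      have "\<nu> ?Q = \<nu> {x\<in>?Q. t0 < F x} + \<nu> {x\<in>?Q. F x \<le> t0}"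
      proof -
        have [measurable]: "{x\<in>?Q. t0 < F x} \<in> sets lebesgue" "{x\<in>?Q. F x \<le> t0} \<in> sets lebesgue" by measurable
        have "\<nu> {x\<in>?Q. t0 < F x} + \<nu> {x\<in>?Q. F x \<le> t0}
          = (\<integral>\<^sup>+x. ennreal (w x) * indicator {x\<in>?Q. t0 < F x} x + ennreal (w x) * indicator {x\<in>?Q. F x \<le> t0} x \<partial>lebesgue)"
          unfolding \<nu>_def by (rule nn_integral_add[symmetric]) measurable
        also have "\<dots> = \<nu> ?Q" unfolding \<nu>_def by (intro nn_integral_cong) (auto simp: indicator_def)
        finally show ?thesis by simp
      qed
      also have "\<dots> \<le> ennreal (W / 2) + \<nu> {x\<in>?Q. F x \<le> t0}"
        using half by (rule add_right_mono)
      finally have "ennreal W \<le> ennreal (W / 2) + \<nu> {x\<in>?Q. F x \<le> t0}"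
        unfolding \<nu>Q .
      moreover have "ennreal W = ennreal (W / 2) + ennreal (W / 2)"
        using W by (simp flip: ennreal_plus)
      ultimately show ?thesis by (simp add: ennreal_add_left_cancel_le)
    qed
    define J where "J k = Ik (\<tau> k) (\<tau> (Suc k))" for k
    \<comment> \<open>The set where \<open>F\<close> is at most \<open>t0\<close> carries at least
      half of the weight, so in \<open>level\<close> the minimum is attained by the upper
      set.\<close>
    have lev: "\<nu> {x\<in>?Q. \<tau> (Suc k) \<le> F x} \<le> ennreal (W * (3 * B * (J k / W) powr (1 / p) / \<tau> k) powr pw)" for k
    proof -
      have "\<nu> {x\<in>?Q. \<tau> (Suc k) \<le> F x} \<le> \<nu> {x\<in>?Q. t0 < F x}"
        using \<tau>(1,2)[of k] \<tau>(3)[of k] by (intro \<nu>_mono) auto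
      also have "\<dots> \<le> \<nu> {x\<in>?Q. F x \<le> t0}" using half half' by (rule order_trans)
      also have "\<dots> \<le> \<nu> {x\<in>?Q. F x \<le> \<tau> k}"
        using \<tau>(3)[of k] by (intro \<nu>_mono) auto
      finally show ?thesis
        using level[of "\<tau> k" "\<tau> (Suc k)"] \<tau>(1,2)[of k] unfolding J_def by (simp add: min_absorb1)
    qed
    have J0: "0 \<le> J k" for k by (simp add: J_def Ik0)
    have JI: "(\<Sum>k. ennreal (J k)) \<le> ennreal I"
    proof -
      let ?D = "density lebesgue (\<lambda>x. ennreal (g x powr p * w x))"
      let ?A = "\<lambda>k. {x\<in>?Q. \<tau> k < F x \<and> F x < \<tau> (Suc k)}"
      have Am: "?A k \<in> sets lebesgue" for k by measurable
      have "ennreal (J k) = emeasure ?D (?A k)" for k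
        unfolding J_def Ik[symmetric] using p Am
        by (subst emeasure_density) (auto intro!: nn_integral_cong simp: g'_def indicator_def)
      then have "(\<Sum>k. ennreal (J k)) = (\<Sum>k. emeasure ?D (?A k))" by simp
      also have "\<dots> = emeasure ?D (\<Union>k. ?A k)"
      proof (rule suminf_emeasure)
        have "mono \<tau>" unfolding \<tau>_def using t0 by (auto intro!: monoI power_increasing)
        then have "\<tau> (Suc i) \<le> \<tau> j" if "i < j" for i j using that by (meson Suc_leI monoD)
        then show "disjoint_family ?A"
          unfolding disjoint_family_on_def by (auto simp: neq_iff) (smt (verit))+
      qed (use Am in auto)
      also have "\<dots> \<le> emeasure ?D ?Q" by (intro emeasure_mono) auto
      also have "\<dots> = ennreal I" by (simp add: emeasure_density I)
      finally show ?thesis .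
    qed
    have JkI: "J k \<le> I" for k
    proof -
      have "ennreal (J k) \<le> (\<Sum>k. ennreal (J k))"
        using sum_le_suminf[of "\<lambda>k. ennreal (J k)" "{k}"] by simp
      also note JI
      finally show ?thesis using I by simp
    qed
    \<comment> \<open>One factor \<open>J k / W\<close> is kept for the summation; the remaining
      power is positive because \<open>pw > p\<close>, and there \<open>J k\<close> is replaced by
      the total \<open>I\<close>.\<close>
    have Jpow: "(J k / W) powr (pw / p) \<le> J k / W * (I / W) powr (pw / p - 1)" for k
    proof (cases "J k = 0")
      case False
      then have pos: "0 < J k / W" using J0[of k] W by simp
      have "(J k / W) powr (pw / p) = J k / W * (J k / W) powr (pw / p - 1)"
        using powr_add[of "J k / W" 1 "pw / p - 1"] J0[of k] W by simp
      moreover have "(J k / W) powr (pw / p - 1) \<le> (I / W) powr (pw / p - 1)"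
        using JkI[of k] W pos p pw_gt by (intro powr_mono2) (auto intro: divide_right_mono)
      ultimately show ?thesis using pos by (metis less_imp_le mult_left_mono)
    qed simp
    \<comment> \<open>12 = 4 * 3: the 3 comes from \<open>level\<close>; the 4 from estimating
      \<open>F\<close> by \<open>\<tau> (Suc (Suc k))\<close> on a shell whose weight is estimated
      with the gap \<open>\<tau> k\<close>.\<close>
    define R where "R = W * (12 * B) powr pw * (I / W) powr (pw / p - 1) / W"
    have R0: "0 \<le> R" using W by (simp add: R_def)
    have shell: "ennreal (\<tau> (Suc (Suc k)) powr pw) * \<nu> {x\<in>?Q. \<tau> (Suc k) \<le> F x} \<le> ennreal R * ennreal (J k)" for k
    proof -
      have "ennreal (\<tau> (Suc (Suc k)) powr pw) * \<nu> {x\<in>?Q. \<tau> (Suc k) \<le> F x}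
          \<le> ennreal (\<tau> (Suc (Suc k)) powr pw) * ennreal (W * (3 * B * (J k / W) powr (1 / p) / \<tau> k) powr pw)"
        using lev by (rule mult_left_mono) simp
      also have "\<dots> = ennreal (\<tau> (Suc (Suc k)) powr pw * (W * (3 * B * (J k / W) powr (1 / p) / \<tau> k) powr pw))"
        using W by (simp add: ennreal_mult)
      also have "\<tau> (Suc (Suc k)) powr pw * (W * (3 * B * (J k / W) powr (1 / p) / \<tau> k) powr pw)
          = W * (4 * \<tau> k * (3 * B * (J k / W) powr (1 / p) / \<tau> k)) powr pw"
        using \<tau>(1)[of k] B powr_mult[of 4 3 pw] by (simp add: \<tau>(2) powr_mult powr_divide)
      also have "4 * \<tau> k * (3 * B * (J k / W) powr (1 / p) / \<tau> k) = 12 * B * (J k / W) powr (1 / p)"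
        using \<tau>(1)[of k] by simp
      also have "W * (12 * B * (J k / W) powr (1 / p)) powr pw = W * (12 * B) powr pw * (J k / W) powr (pw / p)"
        using B by (subst powr_mult) (auto simp: powr_powr)
      also have "\<dots> \<le> W * (12 * B) powr pw * (J k / W * (I / W) powr (pw / p - 1))"
        using Jpow W by (intro mult_left_mono) auto
      also have "\<dots> = R * J k" by (simp add: R_def)
      also have "ennreal (R * J k) = ennreal R * ennreal (J k)" using R0 J0 by (simp add: ennreal_mult)
      finally show ?thesis by (simp add: ennreal_leI)
    qed
    have [measurable]: "{x\<in>?Q. \<tau> (Suc k) \<le> F x} \<in> sets lebesgue" for k by measurable
    \<comment> \<open>A value above \<open>2 * t0 = \<tau> 1\<close> lies between
      \<open>\<tau> (Suc k)\<close> and \<open>\<tau> (Suc (Suc k))\<close> for some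
      \<open>k\<close>, and that single summand suffices.\<close>
    have pt: "ennreal (F x powr pw * w x) * indicator ?Q x
        \<le> ennreal ((2 * t0) powr pw) * (ennreal (w x) * indicator ?Q x)
          + (\<Sum>k. ennreal (\<tau> (Suc (Suc k)) powr pw) * (ennreal (w x) * indicator {x\<in>?Q. \<tau> (Suc k) \<le> F x} x))" for x
    proof (cases "x \<in> ?Q")
      case True
      have F0: "0 \<le> F x" by (simp add: F_def)
      show ?thesis
      proof (cases "F x \<le> 2 * t0")
        case True
        then have "F x powr pw * w x \<le> (2 * t0) powr pw * w x"
          using w0 F0 pw1 by (intro mult_right_mono powr_mono2) auto
        then have "ennreal (F x powr pw * w x) \<le> ennreal ((2 * t0) powr pw) * ennreal (w x)"
          using w0 by (simp add: ennreal_leI flip: ennreal_mult)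
        then show ?thesis using \<open>x \<in> ?Q\<close> by (simp add: add_increasing2)
      next
        case False
        obtain m0 where "F x < \<tau> m0"
        proof -
          obtain m0 where "F x / t0 < 2 ^ m0" using real_arch_pow[of 2 "F x / t0"] by auto
          then show ?thesis using that t0 by (simp add: \<tau>_def pos_divide_less_eq)
        qed
        define m where "m = (LEAST m. F x < \<tau> m)"
        have m: "F x < \<tau> m" unfolding m_def using \<open>F x < \<tau> m0\<close> by (rule LeastI)
        have "m \<noteq> 0"
        proof
          assume "m = 0"
          with m have "F x < t0" by (simp add: \<tau>_def)
          with False t0 show False by linarith
        qed
        moreover have "m \<noteq> 1"
        proof
          assume "m = 1"
          with m False show False by (simp add: \<tau>_def)
        qed
        ultimately obtain k where k: "m = Suc (Suc k)" by (metis One_nat_def not0_implies_Suc)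
        have "\<not> F x < \<tau> (Suc k)" using not_less_Least[of "Suc k" "\<lambda>m. F x < \<tau> m"] k by (simp add: m_def)
        then have mem: "x \<in> {x\<in>?Q. \<tau> (Suc k) \<le> F x}" using \<open>x \<in> ?Q\<close> by simp
        have "F x powr pw * w x \<le> \<tau> (Suc (Suc k)) powr pw * w x"
          using w0 F0 pw1 m k by (intro mult_right_mono powr_mono2) auto
        then have "ennreal (F x powr pw * w x)
            \<le> ennreal (\<tau> (Suc (Suc k)) powr pw) * (ennreal (w x) * indicator {x\<in>?Q. \<tau> (Suc k) \<le> F x} x)"
          using w0 mem by (simp add: ennreal_leI flip: ennreal_mult)
        also have "\<dots> \<le> (\<Sum>k. ennreal (\<tau> (Suc (Suc k)) powr pw) * (ennreal (w x) * indicator {x\<in>?Q. \<tau> (Suc k) \<le> F x} x))"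
          using sum_le_suminf[of "\<lambda>k. ennreal (\<tau> (Suc (Suc k)) powr pw) * (ennreal (w x) * indicator {x\<in>?Q. \<tau> (Suc k) \<le> F x} x)" "{k}"]
          by simp
        finally show ?thesis using \<open>x \<in> ?Q\<close> by (simp add: add_increasing)
      qed
    qed simp
    have "(\<integral>\<^sup>+x\<in>?Q. ennreal (F x powr pw * w x) \<partial>lebesgue)
      \<le> (\<integral>\<^sup>+x. ennreal ((2 * t0) powr pw) * (ennreal (w x) * indicator ?Q x)
          + (\<Sum>k. ennreal (\<tau> (Suc (Suc k)) powr pw) * (ennreal (w x) * indicator {x\<in>?Q. \<tau> (Suc k) \<le> F x} x)) \<partial>lebesgue)"
      by (intro nn_integral_mono pt)
    also have "\<dots> = ennreal ((2 * t0) powr pw) * \<nu> ?Q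
        + (\<Sum>k. ennreal (\<tau> (Suc (Suc k)) powr pw) * \<nu> {x\<in>?Q. \<tau> (Suc k) \<le> F x})"
      unfolding \<nu>_def by (simp add: nn_integral_add nn_integral_suminf nn_integral_cmult)
    also have "\<dots> \<le> ennreal ((2 * t0) powr pw) * ennreal W + (\<Sum>k. ennreal R * ennreal (J k))"
      unfolding \<nu>Q by (intro add_left_mono suminf_le shell) auto
    also have "(\<Sum>k. ennreal R * ennreal (J k)) = ennreal R * (\<Sum>k. ennreal (J k))"
      by simp
    also have "\<dots> \<le> ennreal R * ennreal I" using JI by (rule mult_left_mono) simp
    also have "ennreal ((2 * t0) powr pw) * ennreal W + ennreal R * ennreal I
        = ennreal ((2 * t0) powr pw * W + R * I)"
      using W I R0 by (simp add: ennreal_mult)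
    also have "R * I = W * (12 * B * G) powr pw"
    proof (cases "I = 0")
      case True then show ?thesis using pw1 by (simp add: G_def)
    next
      case False
      then have "0 < I / W" using I W by simp
      then have "(12 * B * G) powr pw = (12 * B) powr pw * (I / W) powr (pw / p)"
        unfolding G_def using B by (subst powr_mult) (auto simp: powr_powr)
      also have "(I / W) powr (pw / p) = (I / W) powr (pw / p - 1) * (I / W)"
        using I W powr_add[of "I / W" "pw / p - 1" 1] by simp
      finally show ?thesis using W by (simp add: R_def)
    qed
    finally show ?thesis by (simp add: algebra_simps add_left_mono)
  qed
  show ?thesis
  proof (cases "I = 0")
    case True
    then have G0: "G = 0" by (simp add: G_def)
    have "(\<integral>\<^sup>+x\<in>?Q. ennreal (F x powr pw * w x) \<partial>lebesgue) = 0"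
    proof (rule ennreal_eq_0_if_le_all)
      fix \<delta> :: real assume \<delta>: "0 < \<delta>"
      \<comment> \<open>Since \<open>G = 0\<close>, every positive \<open>t0\<close> is admissible;
        this choice makes the first term of \<open>main\<close> equal to
        \<open>\<delta>\<close>.\<close>
      have "W * (2 * ((\<delta> / W) powr (1 / pw) / 2)) powr pw = \<delta>"
        using \<delta> W pw1 by (simp add: powr_powr)
      then show "(\<integral>\<^sup>+x\<in>?Q. ennreal (F x powr pw * w x) \<partial>lebesgue) \<le> ennreal \<delta>"
        using main[of "(\<delta> / W) powr (1 / pw) / 2"] \<delta> W G0 pw1 by simp
    qed
    then show ?thesis by (simp add: F_def c_def)
  next
    case False
    then have G: "0 < G" using I W by (simp add: G_def)
    have "(\<integral>\<^sup>+x\<in>?Q. ennreal (F x powr pw * w x) \<partial>lebesgue)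
        \<le> ennreal (W * ((4 * (B * G)) powr pw + (12 * (B * G)) powr pw))"
      using main[of "2 * B * G"] B G by (simp add: mult.assoc)
    \<comment> \<open>Superadditivity of the power \<open>pw > 1\<close>. The 4 is
      \<open>2 * t0\<close> for \<open>t0 = 2 * B * G\<close>, and 4 + 12 gives the final
      16.\<close>
    also have "(4 * (B * G)) powr pw + (12 * (B * G)) powr pw \<le> (16 * (B * G)) powr pw"
    proof -
      let ?x = "16 * (B * G)"
      have x: "0 < ?x" using B G by simp
      have frac: "(r * ?x) powr pw \<le> r * ?x powr pw" if "0 < r" "r \<le> 1" for r
      proof -
        have "r powr pw \<le> r powr 1" using that pw1 by (intro powr_mono') auto
        moreover have "(r * ?x) powr pw = r powr pw * ?x powr pw" by (rule powr_mult)
        ultimately show ?thesis using that by (simp add: mult_right_mono)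
      qed
      have "(4 * (B * G)) powr pw \<le> 1/4 * ?x powr pw" using frac[of "1/4"] by simp
      moreover have "(12 * (B * G)) powr pw \<le> 3/4 * ?x powr pw" using frac[of "3/4"] by simp
      ultimately show ?thesis by linarith
    qed
    finally show ?thesis using W by (simp add: F_def c_def G_def mult.assoc ennreal_leI mult_left_mono)
  qed
qed


section \<open>Muckenhoupt weights\<close>

lemma epowr_ennreal:
  assumes "0 \<le> r" "0 < b"
  shows "ennreal r epowr b = ennreal (r powr b)"
  using assms by (auto simp: epowr_def)

lemma epowr_top: "0 < b \<Longrightarrow> top epowr b = top"
  by (simp add: epowr_def)

text \<open>Exhaustion by balls, since \<open>weight\<close> provides integrability only on compact
  sets.\<close>

lemma weight_measurable:
  fixes w :: "real ^ 'n \<Rightarrow> real"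
  assumes "weight w"
  shows "w \<in> borel_measurable lebesgue"
proof (rule borel_measurable_LIMSEQ_real)
  fix k :: nat
  have "set_integrable lebesgue (cball 0 (real k)) w" using assms by (auto simp: weight_def)
  then show "(\<lambda>x. indicator (cball 0 (real k)) x *\<^sub>R w x) \<in> borel_measurable lebesgue"
    unfolding set_integrable_def by (rule borel_measurable_integrable)
next
  fix x :: "real ^ 'n"
  obtain k0 :: nat where k0: "norm x \<le> real k0" using real_arch_simple by blast
  have "\<forall>\<^sub>F k in sequentially. indicator (cball 0 (real k)) x *\<^sub>R w x = w x"
    using eventually_ge_at_top[of k0] by eventually_elim (use k0 in \<open>auto simp: indicator_def\<close>)
  then show "(\<lambda>k. indicator (cball 0 (real k)) x *\<^sub>R w x) \<longlonglongrightarrow> w x"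
    by (rule tendsto_eventually)
qed

lemma emeasure_cube:
  assumes "0 \<le> s"
  shows "emeasure lebesgue (cube (a :: real ^ 'n) s) = ennreal (s ^ CARD('n))"
proof -
  have "emeasure lborel (cube a s) = ennreal (measure lborel (cube a s))"
    using emeasure_lborel_cbox_finite[of a "a + (\<chi> i. s)"]
    unfolding cube_def by (intro emeasure_eq_ennreal_measure) auto
  moreover have "cube a s \<in> sets lborel" by (simp add: cube_def)
  ultimately show ?thesis using assms by (simp add: measure_cube)
qed

lemma cube_measurable [measurable]: "cube a s \<in> sets lebesgue"
  by (simp add: cube_def)

text \<open>Young's inequality for the factors \<open>u * v powr (1 / q) * \<theta>\<close> and
  \<open>v powr (- (1 / q)) / \<theta>\<close>. Choosing \<open>\<theta>\<close> after integration
  turns the sum into the product of Hoelder's inequality.\<close>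

lemma young_weighted:
  fixes u v q \<theta> :: real
  assumes q: "1 < q" and \<theta>: "0 < \<theta>" and v: "0 < v" and u: "0 \<le> u"
  shows "u \<le> \<theta> powr q / q * (u powr q * v) + \<theta> powr (- (q / (q - 1))) * ((q - 1) / q) * v powr (1 - q / (q - 1))"
proof -
  define q' where "q' = q / (q - 1)"
  have q': "1 < q'" "1 / q + 1 / q' = 1" "1 / q' = (q - 1) / q" using q by (auto simp: q'_def field_simps)
  have "u = (u * v powr (1 / q) * \<theta>) * (v powr (- (1 / q)) / \<theta>)"
    using \<theta> v by (simp add: powr_minus)
  also have "\<dots> \<le> (u * v powr (1 / q) * \<theta>) powr q / q + (v powr (- (1 / q)) / \<theta>) powr q' / q'"
    using \<theta> v u q q' by (intro Youngs_inequality) auto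
  also have "(u * v powr (1 / q) * \<theta>) powr q = \<theta> powr q * (u powr q * v)"
    using q v by (simp add: powr_mult powr_powr)
  also have "(v powr (- (1 / q)) / \<theta>) powr q' = \<theta> powr (- q') * v powr (1 - q')"
  proof -
    have e: "- (1 / q) * q' = 1 - q'" using q by (simp add: q'_def field_simps)
    have "(v powr (- (1 / q)) / \<theta>) powr q' = (v powr (- (1 / q))) powr q' / \<theta> powr q'"
      by (rule powr_divide)
    also have "(v powr (- (1 / q))) powr q' = v powr (1 - q')" by (simp only: powr_powr e)
    finally show ?thesis by (simp only: powr_minus_divide times_divide_eq_left mult_1)
  qed
  finally show ?thesis
    unfolding q'_def[symmetric] divide_inverse[of _ q'] using q'(3) by (simp add: field_simps)
qed

text \<open>For \<open>q > 1\<close> this is Hoelder's inequality for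
  \<open>u * w powr (1 / q)\<close> and \<open>w powr (- (1 / q))\<close>, where the A_q condition
  bounds the integral from the second factor. For \<open>q = 1\<close> the condition says that
  almost everywhere on the cube \<open>w\<close> is at least its average divided by
  \<open>A\<close>.\<close>

lemma Aq_holder:
  fixes w u :: "real ^ 'n \<Rightarrow> real"
  assumes w: "weight w" and q: "1 \<le> q" and A: "Aq_const q w = ennreal A" "0 \<le> A"
    and s: "0 < s"
    and u[measurable]: "u \<in> borel_measurable lebesgue" and u0: "\<And>x. 0 \<le> u x"
    and m: "(\<integral>\<^sup>+x\<in>cube a s. ennreal (w x) \<partial>lebesgue) = ennreal m" "0 < m"
    and i: "(\<integral>\<^sup>+x\<in>cube a s. ennreal (u x powr q * w x) \<partial>lebesgue) = ennreal i" "0 \<le> i"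
  shows "(\<integral>\<^sup>+x\<in>cube a s. ennreal (u x) \<partial>lebesgue) \<le> ennreal (A powr (1 / q) * (i / m) powr (1 / q) * s ^ CARD('n))"
proof -
  let ?Q = "cube a s"
  define V where "V = s ^ CARD('n)"
  have V: "0 < V" "emeasure lebesgue ?Q = ennreal V" using s emeasure_cube[of s a] by (simp_all add: V_def)
  have wm[measurable]: "w \<in> borel_measurable lebesgue" by (rule weight_measurable[OF w])
  have w0: "0 \<le> w x" for x using w by (simp add: weight_def)
  have Qc: "?Q \<in> cubes" using s by (auto simp: cubes_def)
  have ew: "eavg ?Q (\<lambda>x. ennreal (w x)) = ennreal (m / V)"
    unfolding eavg_def m V(2) using m V by (simp add: divide_ennreal)
  show ?thesis
  proof (cases "q = 1")
    case True
    define e where "e = esssup (restrict_space lebesgue ?Q) (\<lambda>x. inverse (ennreal (w x)))"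
    have "eavg ?Q (\<lambda>x. ennreal (w x)) * e \<le> ennreal A"
      unfolding A(1)[symmetric] Aq_const_def e_def using True by (auto intro!: SUP_upper2[OF Qc])
    then have "e \<le> ennreal (A / (m / V))"
      unfolding ew using m V A by (intro ennreal_le_divideI) auto
    moreover have "AE x in restrict_space lebesgue ?Q. inverse (ennreal (w x)) \<le> e"
      unfolding e_def by (rule esssup_AE)
    then have "AE x in lebesgue. x \<in> ?Q \<longrightarrow> inverse (ennreal (w x)) \<le> e"
      by (subst (asm) AE_restrict_space_iff) auto
    ultimately have AE: "AE x in lebesgue. x \<in> ?Q \<longrightarrow> inverse (ennreal (w x)) \<le> ennreal (A / (m / V))"
      by (auto elim!: eventually_mono intro: order_trans)
    have pt: "u x \<le> A / (m / V) * (u x powr q * w x)" if "inverse (ennreal (w x)) \<le> ennreal (A / (m / V))" for x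
    proof -
      have "w x \<noteq> 0"
      proof
        assume "w x = 0"
        with that show False by (simp add: top_unique)
      qed
      then have wx: "0 < w x" using w0[of x] by simp
      then have "inverse (w x) \<le> A / (m / V)"
        using that m V A by (simp add: inverse_ennreal)
      then have "1 \<le> A / (m / V) * w x" using wx by (simp add: field_simps)
      then have "u x * 1 \<le> u x * (A / (m / V) * w x)" using u0 by (intro mult_left_mono)
      then show ?thesis using True u0[of x] by (simp add: mult_ac)
    qed
    have "(\<integral>\<^sup>+x\<in>?Q. ennreal (u x) \<partial>lebesgue)
        \<le> (\<integral>\<^sup>+x. ennreal (A / (m / V)) * (ennreal (u x powr q * w x) * indicator ?Q x) \<partial>lebesgue)"
    proof (rule nn_integral_mono_AE)
      show "AE x in lebesgue. ennreal (u x) * indicator ?Q x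
          \<le> ennreal (A / (m / V)) * (ennreal (u x powr q * w x) * indicator ?Q x)"
        using AE
      proof eventually_elim
        fix x assume x: "x \<in> ?Q \<longrightarrow> inverse (ennreal (w x)) \<le> ennreal (A / (m / V))"
        show "ennreal (u x) * indicator ?Q x \<le> ennreal (A / (m / V)) * (ennreal (u x powr q * w x) * indicator ?Q x)"
        proof (cases "x \<in> ?Q")
          case True
          with x have "ennreal (u x) \<le> ennreal (A / (m / V) * (u x powr q * w x))"
            by (intro ennreal_leI pt) simp
          also have "\<dots> = ennreal (A / (m / V)) * ennreal (u x powr q * w x)"
            using A m V w0[of x] by (intro ennreal_mult) auto
          finally show ?thesis using True by simp
        qed simp
      qed
    qed
    also have "\<dots> = ennreal (A / (m / V)) * ennreal i" using i by (subst nn_integral_cmult) auto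
    also have "\<dots> = ennreal (A * (i / m) * V)" using A m V i by (simp flip: ennreal_mult add: field_simps)
    finally show ?thesis using True A i m by (simp add: V_def)
  next
    case False
    with q have q: "1 < q" by simp
    define r where "r = 1 - q / (q - 1)"
    have r: "r < 0" using q by (simp add: r_def field_simps)
    define Y where "Y = (\<integral>\<^sup>+x\<in>?Q. ennreal (w x) epowr r \<partial>lebesgue)"
    have em[measurable]: "(\<lambda>x. ennreal (w x) epowr r) \<in> borel_measurable lebesgue"
      unfolding epowr_def by measurable
    have "ennreal (m / V) * (eavg ?Q (\<lambda>x. ennreal (w x) epowr r)) epowr (q - 1) \<le> ennreal A"
      unfolding A(1)[symmetric] Aq_const_def ew[symmetric] r_def using q by (auto intro!: SUP_upper2[OF Qc])
    then have le: "(Y / ennreal V) epowr (q - 1) \<le> ennreal (A / (m / V))"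
      unfolding eavg_def V(2) Y_def using m V A by (intro ennreal_le_divideI) auto
    \<comment> \<open>The average of \<open>w\<close> is positive, so an infinite dual integral
      would make the A_q constant infinite. Finiteness of \<open>Y\<close> then makes
      \<open>w\<close> positive almost everywhere on the cube, as \<open>epowr\<close> with a
      negative exponent is infinite at 0.\<close>
    have "Y \<noteq> top"
    proof
      assume "Y = top"
      then have "Y / ennreal V = top" using V by (simp add: ennreal_top_divide)
      with le q show False by (simp add: epowr_top top_unique)
    qed
    then obtain y where y: "Y = ennreal y" "0 \<le> y" by (cases Y) auto
    have wpos: "AE x in lebesgue. x \<in> ?Q \<longrightarrow> 0 < w x"
    proof -
      have "AE x in lebesgue. ennreal (w x) epowr r * indicator ?Q x \<noteq> \<infinity>"
        by (rule nn_integral_PInf_AE) (use \<open>Y \<noteq> top\<close> in \<open>auto simp: Y_def\<close>)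
      then show ?thesis
      proof eventually_elim
        fix x assume *: "ennreal (w x) epowr r * indicator ?Q x \<noteq> \<infinity>"
        show "x \<in> ?Q \<longrightarrow> 0 < w x"
          using * w0[of x] r by (auto simp: epowr_def less_le)
      qed
    qed
    \<comment> \<open>Positivity of \<open>y\<close> is needed for the choice of
      \<open>\<theta>\<close>; it holds because the dual weight of a finite \<open>w\<close> is
      never 0.\<close>
    have "y \<noteq> 0"
    proof
      assume "y = 0"
      then have "(\<integral>\<^sup>+x\<in>?Q. ennreal (w x) epowr r \<partial>lebesgue) = 0" using y by (simp add: Y_def)
      then have "AE x in lebesgue. ennreal (w x) epowr r * indicator ?Q x = 0"
        by (rule nn_integral_0_iff_AE[THEN iffD1, rotated]) measurable
      then have "AE x in lebesgue. x \<notin> ?Q"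
        using wpos
      proof eventually_elim
        fix x assume "ennreal (w x) epowr r * indicator ?Q x = 0" "x \<in> ?Q \<longrightarrow> 0 < w x"
        then show "x \<notin> ?Q" by (auto simp: epowr_def split: if_splits)
      qed
      then have "?Q \<in> null_sets lebesgue" by (subst AE_iff_null_sets) auto
      then show False using V by (auto simp: null_sets_def)
    qed
    with y have ypos: "0 < y" by simp
    have yle: "(y / V) powr (q - 1) \<le> A / (m / V)"
      using le V q m A unfolding y(1) by (simp add: divide_ennreal y epowr_ennreal)
    have young: "(\<integral>\<^sup>+x\<in>?Q. ennreal (u x) \<partial>lebesgue)
        \<le> ennreal (\<theta> powr q / q * i + \<theta> powr (- (q / (q - 1))) * ((q - 1) / q) * y)" if \<theta>: "0 < \<theta>" for \<theta>
    proof -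
      let ?a = "\<theta> powr q / q" and ?b = "\<theta> powr (- (q / (q - 1))) * ((q - 1) / q)"
      have ab: "0 \<le> ?a" "0 \<le> ?b" using q by auto
      have lincomb: "ennreal (\<alpha> * x + \<beta> * x') = ennreal \<alpha> * ennreal x + ennreal \<beta> * ennreal x'"
        if "0 \<le> \<alpha>" "0 \<le> \<beta>" "0 \<le> x" "0 \<le> x'" for \<alpha> \<beta> x x' :: real
        using that by (simp add: ennreal_mult)
      have "(\<integral>\<^sup>+x\<in>?Q. ennreal (u x) \<partial>lebesgue)
          \<le> (\<integral>\<^sup>+x. ennreal ?a * (ennreal (u x powr q * w x) * indicator ?Q x)
              + ennreal ?b * (ennreal (w x) epowr r * indicator ?Q x) \<partial>lebesgue)"
      proof (rule nn_integral_mono_AE)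
        show "AE x in lebesgue. ennreal (u x) * indicator ?Q x \<le> ennreal ?a * (ennreal (u x powr q * w x) * indicator ?Q x)
              + ennreal ?b * (ennreal (w x) epowr r * indicator ?Q x)"
          using wpos
        proof eventually_elim
          fix x assume x: "x \<in> ?Q \<longrightarrow> 0 < w x"
          show "ennreal (u x) * indicator ?Q x \<le> ennreal ?a * (ennreal (u x powr q * w x) * indicator ?Q x)
              + ennreal ?b * (ennreal (w x) epowr r * indicator ?Q x)"
          proof (cases "x \<in> ?Q")
            case True
            with x have wx: "0 < w x" by simp
            have "ennreal (u x) \<le> ennreal (?a * (u x powr q * w x) + ?b * w x powr r)"
              unfolding r_def by (intro ennreal_leI young_weighted q \<theta> wx u0)
            also have "\<dots> = ennreal ?a * ennreal (u x powr q * w x) + ennreal ?b * ennreal (w x powr r)"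
              by (rule lincomb) (use ab w0[of x] in auto)
            also have "ennreal (w x powr r) = ennreal (w x) epowr r"
              using wx r by (simp add: epowr_def)
            finally show ?thesis using True by simp
          qed simp
        qed
      qed
      also have "\<dots> = ennreal ?a * ennreal i + ennreal ?b * Y"
        unfolding Y_def i(1)[symmetric] by (simp add: nn_integral_add nn_integral_cmult)
      also have "\<dots> = ennreal (?a * i + ?b * y)"
        unfolding y(1) by (rule lincomb[symmetric]) (use ab i y in auto)
      finally show ?thesis .
    qed
    show ?thesis
    \<comment> \<open>For \<open>i = 0\<close> the optimal \<open>\<theta>\<close> would be
      infinite; instead, \<open>u\<close> vanishes almost everywhere on the cube because
      \<open>w\<close> is positive there.\<close>
    proof (cases "i = 0")
      case True
      have "(\<integral>\<^sup>+x\<in>?Q. ennreal (u x powr q * w x) \<partial>lebesgue) = 0" using i True by simp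
      then have "AE x in lebesgue. ennreal (u x powr q * w x) * indicator ?Q x = 0"
        by (rule nn_integral_0_iff_AE[THEN iffD1, rotated]) measurable
      then have "AE x in lebesgue. ennreal (u x) * indicator ?Q x = 0"
        using wpos
      proof eventually_elim
        fix x assume *: "ennreal (u x powr q * w x) * indicator ?Q x = 0" and x: "x \<in> ?Q \<longrightarrow> 0 < w x"
        show "ennreal (u x) * indicator ?Q x = 0"
        proof (cases "x \<in> ?Q")
          case True
          then have wx: "0 < w x" and "ennreal (u x powr q * w x) = 0" using * x by auto
          then have "u x powr q * w x \<le> 0" by (simp add: ennreal_eq_0_iff)
          then have "u x powr q \<le> 0" using wx by (simp add: mult_le_0_iff)
          then show ?thesis by (simp add: not_less)
        qed simp
      qed
      then have "(\<integral>\<^sup>+x\<in>?Q. ennreal (u x) \<partial>lebesgue) = 0"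
        by (subst nn_integral_0_iff_AE) auto
      then show ?thesis by simp
    next
      case False
      then have ipos: "0 < i" using i by simp
      \<comment> \<open>The value that makes the two terms in \<open>young\<close> proportional to the same quantity \<open>X\<close>.\<close>
      define \<theta> where "\<theta> = (y / i) powr ((q - 1) / (q * q))"
      have \<theta>: "0 < \<theta>" using ypos ipos by (simp add: \<theta>_def)
      define X where "X = i powr (1 / q) * y powr ((q - 1) / q)"
      have t1: "\<theta> powr q * i = X"
      proof -
        have "\<theta> powr q = (y / i) powr ((q - 1) / q)" unfolding \<theta>_def using q by (simp add: powr_powr)
        also have "\<dots> = y powr ((q - 1) / q) / i powr ((q - 1) / q)" using ypos ipos by (simp add: powr_divide)
        finally have "\<theta> powr q * i = y powr ((q - 1) / q) * (i powr 1 / i powr ((q - 1) / q))" using ipos by simp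
        also have "i powr 1 / i powr ((q - 1) / q) = i powr (1 - (q - 1) / q)" by (rule powr_diff[symmetric])
        also have "1 - (q - 1) / q = 1 / q" using q by (simp add: field_simps)
        finally show ?thesis by (simp add: X_def mult.commute)
      qed
      have t2: "\<theta> powr (- (q / (q - 1))) * y = X"
      proof -
        have e: "(q - 1) / (q * q) * - (q / (q - 1)) = - (1 / q)" using q by (simp add: field_simps)
        have "\<theta> powr (- (q / (q - 1))) = (y / i) powr (- (1 / q))" unfolding \<theta>_def powr_powr e ..
        also have "\<dots> = i powr (1 / q) / y powr (1 / q)" using ypos ipos by (simp add: powr_minus powr_divide)
        finally have "\<theta> powr (- (q / (q - 1))) * y = i powr (1 / q) * (y powr 1 / y powr (1 / q))" using ypos by simp
        also have "y powr 1 / y powr (1 / q) = y powr (1 - 1 / q)" by (rule powr_diff[symmetric])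
        also have "1 - 1 / q = (q - 1) / q" using q by (simp add: field_simps)
        finally show ?thesis by (simp add: X_def)
      qed
      have "\<theta> powr q / q * i + \<theta> powr (- (q / (q - 1))) * ((q - 1) / q) * y
          = (\<theta> powr q * i) / q + ((q - 1) / q) * (\<theta> powr (- (q / (q - 1))) * y)" by simp
      also have "\<dots> = X" unfolding t1 t2 using q by (simp add: field_simps)
      finally have "(\<integral>\<^sup>+x\<in>?Q. ennreal (u x) \<partial>lebesgue) \<le> ennreal X" using young[OF \<theta>] by simp
      also have "X \<le> A powr (1 / q) * (i / m) powr (1 / q) * V"
      proof -
        have "y powr ((q - 1) / q) = V powr ((q - 1) / q) * ((y / V) powr (q - 1)) powr (1 / q)"
          using V ypos by (simp add: powr_powr powr_divide)
        also have "\<dots> \<le> V powr ((q - 1) / q) * (A / (m / V)) powr (1 / q)"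
          using yle q by (intro mult_left_mono powr_mono2) auto
        also have "(A / (m / V)) powr (1 / q) = A powr (1 / q) / m powr (1 / q) * V powr (1 / q)"
          using A m V by (simp add: powr_mult powr_divide)
        also have "V powr ((q - 1) / q) * (A powr (1 / q) / m powr (1 / q) * V powr (1 / q))
            = A powr (1 / q) / m powr (1 / q) * (V powr ((q - 1) / q) * V powr (1 / q))" by simp
        also have "V powr ((q - 1) / q) * V powr (1 / q) = V powr ((q - 1) / q + 1 / q)" by (simp add: powr_add)
        also have "(q - 1) / q + 1 / q = 1" using q by (simp add: field_simps)
        finally have "X \<le> i powr (1 / q) * (A powr (1 / q) / m powr (1 / q) * V powr 1)"
          unfolding X_def by (intro mult_left_mono) auto
        then show ?thesis using V ipos m by (simp add: powr_divide mult_ac)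
      qed
      finally show ?thesis unfolding V_def by (simp add: ennreal_leI)
    qed
  qed
qed


section \<open>The gradient in terms of line derivatives\<close>

lemma AE_gradient_eq:
  fixes f :: "real ^ 'n \<Rightarrow> real"
  assumes lip: "L-lipschitz_on UNIV f"
  shows "AE x in lborel. gradient f x = (\<chi> i. line_deriv f (axis i 1) x) \<and> (\<forall>i. \<bar>line_deriv f (axis i 1) x\<bar> \<le> L)"
proof -
  have "AE x in lborel. \<forall>i. ((\<lambda>r. f (x + r *\<^sub>R axis i 1)) has_field_derivative line_deriv f (axis i 1) x) (at 0)"
    unfolding AE_all_countable by (intro allI AE_line_derivative[OF lip]) (simp add: norm_axis_1)
  then show ?thesis
  proof eventually_elim
    case (elim x)
    have "gradient f x = (\<chi> i. line_deriv f (axis i 1) x)"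
      unfolding gradient_def using elim by (simp add: vec_eq_iff DERIV_imp_deriv)
    moreover have "\<bar>line_deriv f (axis i 1) x\<bar> \<le> L" for i
      using elim by (intro line_derivative_bound[OF lip, of "axis i 1" x]) (auto simp: norm_axis_1)
    ultimately show ?case by blast
  qed
qed

lemma gradient_norm_measurable:
  fixes f :: "real ^ 'n \<Rightarrow> real"
  assumes lip: "L-lipschitz_on UNIV f"
  shows "(\<lambda>x. norm (gradient f x)) \<in> borel_measurable lebesgue"
proof (rule measurable_lebesgue_AE_cong)
  have [measurable]: "line_deriv f (axis i 1) \<in> borel_measurable borel" for i :: 'n
    using lipschitz_on_continuous_on[OF lip] by (rule line_deriv_measurable)
  show "(\<lambda>x. norm (\<chi> i. line_deriv f (axis i 1) x)) \<in> borel_measurable lborel"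
    unfolding norm_vec_def L2_set_def by simp
  show "AE x in lborel. norm (gradient f x) = norm (\<chi> i. line_deriv f (axis i 1) x)"
    using AE_gradient_eq[OF lip] by eventually_elim simp
qed

lemma AE_line_deriv_le_gradient:
  fixes f :: "real ^ 'n \<Rightarrow> real"
  assumes lip: "L-lipschitz_on UNIV f"
  shows "AE x in lborel. \<forall>i. \<bar>line_deriv f (axis i 1) x\<bar> \<le> norm (gradient f x)"
  using AE_gradient_eq[OF lip]
proof eventually_elim
  case (elim x)
  have "\<bar>line_deriv f (axis i 1) x\<bar> \<le> norm (gradient f x)" for i
    using component_le_norm_cart[of "gradient f x" i] elim by simp
  then show ?case by blast
qed

lemma AE_gradient_norm_le:
  fixes f :: "real ^ 'n \<Rightarrow> real"
  assumes lip: "L-lipschitz_on UNIV f"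
  shows "AE x in lebesgue. norm (gradient f x) \<le> real CARD('n) * L"
proof -
  have "AE x in lborel. norm (gradient f x) \<le> real CARD('n) * L"
    using AE_gradient_eq[OF lip]
  proof eventually_elim
    case (elim x)
    have "norm (gradient f x) \<le> (\<Sum>i\<in>UNIV. \<bar>gradient f x $ i\<bar>)" by (rule norm_le_l1_cart)
    also have "\<dots> \<le> (\<Sum>i\<in>(UNIV :: 'n set). L)" using elim by (intro sum_mono) simp
    finally show ?case by simp
  qed
  then show ?thesis by (rule AE_completion)
qed

section \<open>Weights of cubes\<close>

lemma wmeas_finite:
  fixes w :: "real ^ 'n \<Rightarrow> real"
  assumes w: "weight w"
  shows "(\<integral>\<^sup>+x\<in>cube a l. ennreal (w x) \<partial>lebesgue) < \<infinity>"
proof -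
  have "set_integrable lebesgue (cube a l) w"
    using w by (simp add: weight_def cube_def)
  then have "(\<integral>\<^sup>+x. ennreal (norm (indicator (cube a l) x *\<^sub>R w x)) \<partial>lebesgue) < \<infinity>"
    unfolding set_integrable_def integrable_iff_bounded by blast
  moreover have "ennreal (norm (indicator (cube a l) x *\<^sub>R w x)) = ennreal (w x) * indicator (cube a l) x" for x
    using w by (auto simp: weight_def indicator_def)
  ultimately show ?thesis by simp
qed

text \<open>\<open>Aq_holder\<close> tested with the constant function 1.\<close>

lemma Aq_const_ge_1:
  fixes w :: "real ^ 'n \<Rightarrow> real"
  assumes w: "weight w" and q: "1 \<le> q" and A: "Aq_const q w = ennreal A" "0 \<le> A" and s: "0 < s"
    and m: "(\<integral>\<^sup>+x\<in>cube a s. ennreal (w x) \<partial>lebesgue) = ennreal m" "0 < m"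
  shows "1 \<le> A"
proof -
  have "(\<integral>\<^sup>+x\<in>cube a s. ennreal 1 \<partial>lebesgue) \<le> ennreal (A powr (1 / q) * (m / m) powr (1 / q) * s ^ CARD('n))"
    by (rule Aq_holder[OF w q A s _ _ m]) (use m in auto)
  then have "s ^ CARD('n) \<le> A powr (1 / q) * s ^ CARD('n)"
    using s m emeasure_cube[of s a] by simp
  then have "1 \<le> A powr (1 / q)" using s by simp
  show ?thesis
  proof (rule ccontr)
    assume "\<not> 1 \<le> A"
    then have "A powr (1 / q) < 1 powr (1 / q)" using A q by (intro powr_less_mono2) auto
    with \<open>1 \<le> A powr (1 / q)\<close> show False by simp
  qed
qed

text \<open>\<open>Aq_holder\<close> on the large cube, tested with the indicator of the small
  one.\<close>

lemma Aq_doubling: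
  fixes w :: "real ^ 'n \<Rightarrow> real"
  assumes w: "weight w" and q: "1 \<le> q" and A: "Aq_const q w = ennreal A" "0 \<le> A" and l: "0 < l"
    and W: "(\<integral>\<^sup>+x\<in>cube a l. ennreal (w x) \<partial>lebesgue) = ennreal W" "0 < W"
    and s: "0 < s" and sub: "cube a' s \<subseteq> cube a l"
  shows "ennreal (W * (s / l) powr (real CARD('n) * q)) \<le> ennreal A * (\<integral>\<^sup>+x\<in>cube a' s. ennreal (w x) \<partial>lebesgue)"
proof -
  let ?u = "indicator (cube a' s) :: real ^ 'n \<Rightarrow> real"
  obtain m where m: "(\<integral>\<^sup>+x\<in>cube a' s. ennreal (w x) \<partial>lebesgue) = ennreal m" "0 \<le> m"
    using wmeas_finite[OF w, of a' s] by (cases "\<integral>\<^sup>+x\<in>cube a' s. ennreal (w x) \<partial>lebesgue") auto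
  have "(\<integral>\<^sup>+x\<in>cube a l. ennreal (?u x powr q * w x) \<partial>lebesgue) = (\<integral>\<^sup>+x\<in>cube a' s. ennreal (w x) \<partial>lebesgue)"
    using sub by (intro nn_integral_cong) (auto simp: indicator_def)
  then have "(\<integral>\<^sup>+x\<in>cube a l. ennreal (?u x) \<partial>lebesgue) \<le> ennreal (A powr (1 / q) * (m / W) powr (1 / q) * l ^ CARD('n))"
    using m by (intro Aq_holder[OF w q A l _ _ W]) auto
  moreover have "(\<integral>\<^sup>+x\<in>cube a l. ennreal (?u x) \<partial>lebesgue) = (\<integral>\<^sup>+x. indicator (cube a' s) x \<partial>lebesgue)"
    using sub by (intro nn_integral_cong) (auto simp: indicator_def)
  ultimately have "ennreal (s ^ CARD('n)) \<le> ennreal (A powr (1 / q) * (m / W) powr (1 / q) * l ^ CARD('n))"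
    using s emeasure_cube[of s a'] by simp
  then have "s ^ CARD('n) \<le> A powr (1 / q) * (m / W) powr (1 / q) * l ^ CARD('n)"
    using l by (subst (asm) ennreal_le_iff) auto
  then have "(s / l) ^ CARD('n) \<le> A powr (1 / q) * (m / W) powr (1 / q)"
    using l by (simp add: power_divide pos_divide_le_eq)
  also have "\<dots> = (A * (m / W)) powr (1 / q)" by (rule powr_mult[symmetric])
  finally have "((s / l) ^ CARD('n)) powr q \<le> ((A * (m / W)) powr (1 / q)) powr q"
    using s l q by (intro powr_mono2) auto
  also have "((A * (m / W)) powr (1 / q)) powr q = A * (m / W)"
    using A m W q by (simp add: powr_powr)
  also have "((s / l) ^ CARD('n)) powr q = (s / l) powr (real CARD('n) * q)"
    using s l by (simp add: powr_powr flip: powr_realpow)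
  finally have "W * (s / l) powr (real CARD('n) * q) \<le> A * m"
    using W by (simp add: field_simps)
  then have "ennreal (W * (s / l) powr (real CARD('n) * q)) \<le> ennreal (A * m)" by (rule ennreal_leI)
  then show ?thesis unfolding m(1) using A m by (simp add: ennreal_mult)
qed

lemma geom_const_pos:
  assumes "1 \<le> p" "p < real CARD('n::finite)"
  shows "0 < geom_const TYPE('n) p"
proof -
  have "2 powr (1 - real CARD('n) / p) < (1 :: real)"
    using assms powr_less_mono[of "1 - real CARD('n) / p" 0 "2 :: real"] by auto
  then show ?thesis unfolding geom_const_def by (intro mult_pos_pos add_pos_pos) auto
qed

text \<open>\<open>strong_type\<close> gives the estimate when the cube has positive weight and the
  A_p constant is finite. The rest is about \<open>ennreal\<close> conventions: for weight 0 the
  left-hand side is \<open>0 / 0 = 0\<close>, and an infinite A_p constant is treated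
  separately.\<close>

lemma weighted_poincare_sobolev:
  fixes f w :: "real ^ 'n \<Rightarrow> real" and a :: "real ^ 'n"
  assumes p: "1 \<le> p" "p < real CARD('n)" and q: "1 \<le> q" "q \<le> p"
    and w: "w \<in> Aq q" and pw: "1 / p - 1 / pw = 1 / (real CARD('n) * q)"
    and lip: "L-lipschitz_on UNIV f" and l: "0 < l"
  shows "((\<integral>\<^sup>+x\<in>cube a l. ennreal (\<bar>f x - avg (cube a l) f\<bar> powr pw * w x) \<partial>lebesgue) / wmeas w (cube a l)) epowr (1 / pw)
      \<le> ennreal (16 * geom_const TYPE('n) p) * Aq_const q w epowr (1 / (real CARD('n) * q)) * Aq_const p w epowr (2 / p)
        * ennreal l
        * ((\<integral>\<^sup>+x\<in>cube a l. ennreal (norm (gradient f x) powr p * w x) \<partial>lebesgue) / wmeas w (cube a l)) epowr (1 / p)"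
    (is "(?X / _) epowr _ \<le> ennreal ?C * _ * _ * _ * (?I / _) epowr _")
proof -
  let ?n = "real CARD('n)" and ?Q = "cube a l"
  have wt: "weight w" using w by (simp add: Aq_def)
  have wm[measurable]: "w \<in> borel_measurable lebesgue" by (rule weight_measurable[OF wt])
  have w0: "0 \<le> w x" for x using wt by (simp add: weight_def)
  define g where "g x = norm (gradient f x)" for x
  have gm[measurable]: "g \<in> borel_measurable lebesgue"
    unfolding g_def by (rule gradient_norm_measurable[OF lip])
  have g0: "0 \<le> g x" for x by (simp add: g_def)
  have gd: "AE x in lborel. \<forall>i. \<bar>line_deriv f (axis i 1) x\<bar> \<le> g x"
    unfolding g_def by (rule AE_line_deriv_le_gradient[OF lip])
  have nq: "p < ?n * q" using p q by (smt (verit) mult_le_cancel_left1)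
  have pwpos: "0 < 1 / pw"
  proof -
    have "1 / (?n * q) < 1 / p" using nq p by (intro divide_strict_left_mono) auto
    with pw show ?thesis by linarith
  qed
  obtain W where W: "wmeas w ?Q = ennreal W" "0 \<le> W"
    using wmeas_finite[OF wt, of a l] unfolding wmeas_def
    by (cases "\<integral>\<^sup>+x\<in>?Q. ennreal (w x) \<partial>lebesgue") auto
  have Wi: "(\<integral>\<^sup>+x\<in>?Q. ennreal (w x) \<partial>lebesgue) = ennreal W" using W(1) by (simp add: wmeas_def)
  \<comment> \<open>The gradient of a Lipschitz function is bounded almost everywhere and
    \<open>w\<close> is integrable on the cube.\<close>
  have pow_int_fin: "(\<integral>\<^sup>+x\<in>?Q. ennreal (g x powr b * w x) \<partial>lebesgue) \<noteq> top" if "0 \<le> b" for b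
  proof -
    define M where "M = ?n * L"
    have "(\<integral>\<^sup>+x\<in>?Q. ennreal (g x powr b * w x) \<partial>lebesgue)
        \<le> (\<integral>\<^sup>+x. ennreal (M powr b) * (ennreal (w x) * indicator ?Q x) \<partial>lebesgue)"
    proof (rule nn_integral_mono_AE)
      show "AE x in lebesgue. ennreal (g x powr b * w x) * indicator ?Q x \<le> ennreal (M powr b) * (ennreal (w x) * indicator ?Q x)"
        using AE_gradient_norm_le[OF lip]
      proof eventually_elim
        case (elim x)
        then have "g x powr b * w x \<le> M powr b * w x"
          unfolding M_def g_def using that w0 by (intro mult_right_mono powr_mono2) auto
        then have "ennreal (g x powr b * w x) \<le> ennreal (M powr b) * ennreal (w x)"
          using w0 by (simp add: ennreal_leI flip: ennreal_mult)
        then show ?case by (simp add: indicator_def)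
      qed
    qed
    also have "\<dots> = ennreal (M powr b) * ennreal W" unfolding Wi[symmetric] by (rule nn_integral_cmult) measurable
    also have "\<dots> < top" by (simp add: ennreal_mult_less_top)
    finally show ?thesis by simp
  qed
  obtain I where I: "(\<integral>\<^sup>+x\<in>?Q. ennreal (g x powr p * w x) \<partial>lebesgue) = ennreal I" "0 \<le> I"
    using pow_int_fin[of p] p by (cases "\<integral>\<^sup>+x\<in>?Q. ennreal (g x powr p * w x) \<partial>lebesgue") auto
  obtain A where A: "Aq_const q w = ennreal A" "0 \<le> A"
    using w by (cases "Aq_const q w") (auto simp: Aq_def)
  \<comment> \<open>The exponent \<open>b\<close> is arbitrary because \<open>powr\<close> vanishes
    exactly at base 0. So vanishing may be established with an exponent other than
    \<open>pw\<close>.\<close>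
  have zero_AE: "?X = 0" if "AE x in lebesgue. x \<in> ?Q \<longrightarrow> \<bar>f x - avg ?Q f\<bar> powr b * w x = 0" for b
  proof -
    have "?X = (\<integral>\<^sup>+x. 0 \<partial>(lebesgue :: (real ^ 'n) measure))"
    proof (rule nn_integral_cong_AE)
      show "AE x in lebesgue. ennreal (\<bar>f x - avg ?Q f\<bar> powr pw * w x) * indicator ?Q x = 0"
        using that by eventually_elim (auto simp: indicator_def)
    qed
    then show ?thesis by simp
  qed
  have fm: "f \<in> borel_measurable lebesgue"
    using borel_measurable_continuous_onI[OF lipschitz_on_continuous_on[OF lip]]
    by (intro measurable_completion) simp
  have LHS0: ?thesis if "?X = 0"
    using that pwpos by (simp add: epowr_def)
  show ?thesis
  proof (cases "W = 0")
    case True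
    have "(\<integral>\<^sup>+x\<in>?Q. ennreal (w x) \<partial>lebesgue) = 0" using Wi True by simp
    then have "AE x in lebesgue. ennreal (w x) * indicator ?Q x = 0"
      by (rule nn_integral_0_iff_AE[THEN iffD1, rotated]) measurable
    then have "AE x in lebesgue. x \<in> ?Q \<longrightarrow> \<bar>f x - avg ?Q f\<bar> powr 1 * w x = 0"
    proof eventually_elim
      case (elim x) then show ?case using w0[of x] by (auto simp: indicator_def ennreal_eq_0_iff)
    qed
    then show ?thesis using LHS0 zero_AE by blast
  next
    case False
    then have Wpos: "0 < W" using W by simp
    have A1: "1 \<le> A" by (rule Aq_const_ge_1[OF wt q(1) A l Wi Wpos])
    then have Apos: "0 < A" by simp
    note dbl = Aq_doubling[OF wt q(1) A l Wi Wpos]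
    have gc: "0 < geom_const TYPE('n) p" by (rule geom_const_pos[OF p])
    show ?thesis
    proof (cases "Aq_const p w")
      case (real Ap)
      have Ap1: "1 \<le> Ap" by (rule Aq_const_ge_1[OF wt p(1) real(2,1) l Wi Wpos])
      define K where "K = Ap powr (1 / p)"
      have K: "0 < K" using Ap1 by (simp add: K_def)
      define B where "B = geom_const TYPE('n) p * l * K * A powr (1 / (?n * q))"
      have B: "0 < B" unfolding B_def using gc l K Apos by simp
      have "?X \<le> ennreal (W * (16 * B * (I / W) powr (1 / p)) powr pw)"
        unfolding B_def
        by (rule strong_type[OF lip l p q(1) pw wm w0 gm g0 gd Wi Wpos I Apos K dbl])
           (simp_all add: K_def Aq_holder[OF wt p(1) real(2,1)])
      then have "?X / wmeas w ?Q \<le> ennreal (W * (16 * B * (I / W) powr (1 / p)) powr pw) / ennreal W"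
        unfolding W(1) by (rule divide_right_mono_ennreal)
      also have "\<dots> = ennreal ((16 * B * (I / W) powr (1 / p)) powr pw)"
        using Wpos by (simp add: divide_ennreal)
      finally have Xle: "?X / wmeas w ?Q \<le> ennreal ((16 * B * (I / W) powr (1 / p)) powr pw)" .
      obtain \<xi> where \<xi>: "?X / wmeas w ?Q = ennreal \<xi>" "0 \<le> \<xi>"
        using Xle by (cases "?X / wmeas w ?Q") (auto simp: top_unique)
      have "\<xi> \<le> (16 * B * (I / W) powr (1 / p)) powr pw" using Xle unfolding \<xi>(1) by simp
      then have "\<xi> powr (1 / pw) \<le> ((16 * B * (I / W) powr (1 / p)) powr pw) powr (1 / pw)"
        using \<xi> pwpos by (intro powr_mono2) auto
      also have "\<dots> = 16 * B * (I / W) powr (1 / p)"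
        using pwpos B by (simp add: powr_powr)
      also have "\<dots> = ?C * A powr (1 / (?n * q)) * K * l * (I / W) powr (1 / p)"
        by (simp add: B_def)
      also have "\<dots> \<le> ?C * A powr (1 / (?n * q)) * Ap powr (2 / p) * l * (I / W) powr (1 / p)"
      proof -
        \<comment> \<open>The argument produces the exponent \<open>1 / p\<close>; as the A_p
          constant is at least 1, it may be raised to \<open>2 / p\<close>.\<close>
        have "K \<le> Ap powr (2 / p)" unfolding K_def using Ap1 p by (intro powr_mono divide_right_mono) auto
        then show ?thesis using gc l by (intro mult_right_mono mult_left_mono) auto
      qed
      finally have "ennreal (\<xi> powr (1 / pw))
          \<le> ennreal (?C * A powr (1 / (?n * q)) * Ap powr (2 / p) * l * (I / W) powr (1 / p))"
        by (rule ennreal_leI)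
      also have "\<dots> = ennreal ?C * ennreal (A powr (1 / (?n * q))) * ennreal (Ap powr (2 / p)) * ennreal l * ennreal ((I / W) powr (1 / p))"
        using gc l by (simp add: ennreal_mult)
      finally have fin: "ennreal (\<xi> powr (1 / pw))
          \<le> ennreal ?C * ennreal (A powr (1 / (?n * q))) * ennreal (Ap powr (2 / p)) * ennreal l * ennreal ((I / W) powr (1 / p))" .
      have IW: "?I / wmeas w ?Q = ennreal (I / W)"
        unfolding W(1) using I Wpos by (simp add: g_def divide_ennreal)
      have nqpos: "0 < 1 / (?n * q)" using nq p by simp
      show ?thesis
        unfolding \<xi>(1) IW A(1) real(2)
        using fin \<xi> pwpos I Wpos A nqpos real(1) p by (simp add: epowr_ennreal)
    next
      case top
      \<comment> \<open>For positive \<open>I\<close> the right-hand side is infinite. For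
        \<open>I = 0\<close> it is a product of infinity and 0, hence 0, and the left-hand side must
        be shown to vanish.\<close>
      show ?thesis
      proof (cases "I = 0")
        case True
        have "(\<integral>\<^sup>+x\<in>?Q. ennreal (g x powr p * w x) \<partial>lebesgue) = 0" using I True by simp
        then have AEp: "AE x in lebesgue. ennreal (g x powr p * w x) * indicator ?Q x = 0"
          by (rule nn_integral_0_iff_AE[THEN iffD1, rotated]) measurable
        have Iq: "(\<integral>\<^sup>+x\<in>?Q. ennreal (g x powr q * w x) \<partial>lebesgue) = ennreal 0"
        proof -
          have "(\<integral>\<^sup>+x\<in>?Q. ennreal (g x powr q * w x) \<partial>lebesgue) = (\<integral>\<^sup>+x. 0 \<partial>(lebesgue :: (real ^ 'n) measure))"
          proof (rule nn_integral_cong_AE)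
            show "AE x in lebesgue. ennreal (g x powr q * w x) * indicator ?Q x = 0"
              using AEp
            proof eventually_elim
              case (elim x)
              then have "x \<notin> ?Q \<or> g x = 0 \<or> w x = 0"
                using w0[of x] g0[of x] by (auto simp: indicator_def ennreal_eq_0_iff mult_le_0_iff split: if_splits)
              then show ?case by auto
            qed
          qed
          then show ?thesis by simp
        qed
        \<comment> \<open>No \<open>A\<^sub>p\<close> bound is available, but the \<open>A\<^sub>q\<close> bound is: use the case \<open>p = q\<close> of the strong inequality.\<close>
        define pw' where "pw' = 1 / (1 / q - 1 / (?n * q))"
        have pw': "1 / q - 1 / pw' = 1 / (?n * q)" by (simp add: pw'_def)
        have "(\<integral>\<^sup>+x\<in>?Q. ennreal (\<bar>f x - avg ?Q f\<bar> powr pw' * w x) \<partial>lebesgue)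
            \<le> ennreal (W * (16 * (geom_const TYPE('n) q * l * A powr (1 / q) * A powr (1 / (?n * q))) * (0 / W) powr (1 / q)) powr pw')"
          by (rule strong_type[OF lip l q(1) _ q(1) pw' wm w0 gm g0 gd Wi Wpos Iq _ Apos _ dbl])
             (use p q Apos in \<open>simp_all add: Aq_holder[OF wt q(1) A]\<close>)
        then have "(\<integral>\<^sup>+x\<in>?Q. ennreal (\<bar>f x - avg ?Q f\<bar> powr pw' * w x) \<partial>lebesgue) = 0" by simp
        then have "AE x in lebesgue. ennreal (\<bar>f x - avg ?Q f\<bar> powr pw' * w x) * indicator ?Q x = 0"
          by (rule nn_integral_0_iff_AE[THEN iffD1, rotated]) (use fm in measurable)
        then have "AE x in lebesgue. x \<in> ?Q \<longrightarrow> \<bar>f x - avg ?Q f\<bar> powr pw' * w x = 0"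
        proof eventually_elim
          case (elim x)
          have "0 \<le> \<bar>f x - avg ?Q f\<bar> powr pw' * w x" using w0 by simp
          with elim show ?case by (auto simp: indicator_def ennreal_eq_0_iff)
        qed
        then show ?thesis using LHS0 zero_AE by blast
      next
        case False
        then have Ipos: "0 < I" using I by simp
        have IW: "?I / wmeas w ?Q = ennreal (I / W)"
          unfolding W(1) using I Wpos by (simp add: g_def divide_ennreal)
        have nqpos: "0 < 1 / (?n * q)" using nq p by simp
        have "ennreal ?C * Aq_const q w epowr (1 / (?n * q)) * Aq_const p w epowr (2 / p) * ennreal l
            * (?I / wmeas w ?Q) epowr (1 / p) = top"
          unfolding IW A(1) top using gc A Apos nqpos p l Ipos Wpos
          by (simp add: epowr_ennreal epowr_top ennreal_mult_eq_top_iff ennreal_eq_0_iff not_le)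
        then show ?thesis by simp
      qed
    qed
  qed
qed

theorem corollary1p15:
  fixes p :: real
  assumes "1 \<le> p" and "p < real CARD('n::finite)"
  shows "\<exists>C::real. C > 0 \<and> (\<forall>(q::real) (pw::real) (w :: real ^ 'n \<Rightarrow> real) (f :: real ^ 'n \<Rightarrow> real) a l.
    1 \<le> q \<longrightarrow> q \<le> p \<longrightarrow> w \<in> Aq q \<longrightarrow>
    1 / p - 1 / pw = 1 / (real CARD('n) * q) \<longrightarrow>
    (\<exists>L. L-lipschitz_on UNIV f) \<longrightarrow> 0 < l \<longrightarrow>
    (let Q = cube a l in
      ((\<integral>\<^sup>+x\<in>Q. ennreal (\<bar>f x - avg Q f\<bar> powr pw * w x) \<partial>lebesgue) / wmeas w Q) epowr (1 / pw)
      \<le> ennreal C * Aq_const q w epowr (1 / (real CARD('n) * q)) * Aq_const p w epowr (2 / p)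
        * ennreal l
        * ((\<integral>\<^sup>+x\<in>Q. ennreal (norm (gradient f x) powr p * w x) \<partial>lebesgue) / wmeas w Q) epowr (1 / p)))"
proof (intro exI[of _ "16 * geom_const TYPE('n) p"] conjI allI impI)
  show "0 < 16 * geom_const TYPE('n) p" using geom_const_pos[OF assms] by simp
next
  fix q pw l :: real and w f :: "real ^ 'n \<Rightarrow> real" and a :: "real ^ 'n"
  assume *: "1 \<le> q" "q \<le> p" "w \<in> Aq q" "1 / p - 1 / pw = 1 / (real CARD('n) * q)"
    "\<exists>L. L-lipschitz_on UNIV f" "0 < l"
  from *(5) obtain L where "L-lipschitz_on UNIV f" ..
  from weighted_poincare_sobolev[OF assms *(1-4) this *(6)]
  show "let Q = cube a l in
      ((\<integral>\<^sup>+x\<in>Q. ennreal (\<bar>f x - avg Q f\<bar> powr pw * w x) \<partial>lebesgue) / wmeas w Q) epowr (1 / pw)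
      \<le> ennreal (16 * geom_const TYPE('n) p) * Aq_const q w epowr (1 / (real CARD('n) * q)) * Aq_const p w epowr (2 / p)
        * ennreal l
        * ((\<integral>\<^sup>+x\<in>Q. ennreal (norm (gradient f x) powr p * w x) \<partial>lebesgue) / wmeas w Q) epowr (1 / p)"
    unfolding Let_def .
qed

end
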